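(* Let $d,n\ge 2$, let $\mathcal D$ be a domain in $Q_0(d,n)$ whose closure $\overline{\mathcal D}$ is a compact subset of $Q_0(d,n)$, and let $\mathfrak P$ be a reduction of $\mathcal V(d,n)$ to a principal $K$-bundle over $\overline{\mathcal D}$. If $\overline{\mathcal D}$ is $\mathbb I_0(d,n)$-convex, then there is a bijective correspondence between ideals $\mathfrak a$ of $\mathbb I(\mathcal D;d,n)$ and two-sided ideals $\mathfrak A$ of $\mathbb S(\mathcal D,\mathfrak P;d,n)$ given by $\mathfrak a\mapsto\mathfrak a\,\mathbb S(\mathcal D,\mathfrak P;d,n)$ and $\mathfrak A\mapsto\mathfrak A\cap\mathbb I(\mathcal D;d,n)$.
   Context: Setting. $G=PGL(n,\mathbb C)$, $K=PU(n,\mathbb C)$, acting on $M_n(\mathbb C)$ by $s\cdot A=sAs^{-1}$ and on $M_n(\mathbb C)^d$ on the right by $\mathfrak z\cdot s=s^{-1}\mathfrak z s=(s^{-1}Z_1s,\dots,s^{-1}Z_ds)$. $\mathcal V(d,n)$ is the set of $\mathfrak z=(Z_1,\dots,Z_d)\in M_n(\mathbb C)^d$ such that $Z_1,\dots,Z_d$ generate the algebra $M_n(\mathbb C)$. $\mathbb I_0(d,n)$ is the algebra of $G$-invariant polynomial functions $M_n(\mathbb C)^d\to\mathbb C$; $p\in\mathbb I_0(d,n)$ is also identified with the matrix-valued function $\mathfrak z\mapsto p(\mathfrak z)I_n$. $\mathbb G_0(d,n)$ is the algebra of functions $M_n(\mathbb C)^d\to M_n(\mathbb C)$ generated by the coordinate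 functions $\mathcal Z_i(\mathfrak z)=Z_i$, and $\mathbb S_0(d,n)$ (the trace algebra) is the algebra generated by $\mathbb G_0(d,n)$ and $\mathbb I_0(d,n)$; its elements $\phi$ satisfy $\phi(s^{-1}\mathfrak z s)=s^{-1}\phi(\mathfrak z)s$. $Q(d,n)$ is the spectrum of the finitely generated algebra $\mathbb I_0(d,n)$, with its analytic topology, $\pi_0:M_n(\mathbb C)^d\to Q(d,n)$ is the surjection dual to the inclusion of $\mathbb I_0(d,n)$ in the polynomial functions, and $Q_0(d,n)=\pi_0(\mathcal V(d,n))$. By a theorem of Procesi (may be assumed), $Q_0(d,n)$ is an open subset of the smooth points of $Q(d,n)$ and $\pi_0:\mathcal V(d,n)\to Q_0(d,n)$ is a holomorphic principal $G$-bundle; write $[\mathfrak z]=\pi_0(\mathfrak z)$. Elements of $\mathbb I_0(d,n)$ are regarded as regular functions on $Q(d,n)$. Convexity. For a compact $X\subseteq Q(d,n)$, its $\mathbb I_0(d,n)$-convex hull is $\widehat X=\{\mathfrak w\in Q(d,n): |f(\mathfrak w)|\le\sup_{x\in X}|f(x)|\text{ for all }f\in\mathbb I_0(d,n)\}$; $X$ is $\mathbb I_0(d,n)$-convex if $X=\widehat X$. Function algebra. $\mathbb I(\mathcal D;d,n)$ is the sup-norm closure of (the restrictions to $\overline{\mathcal D}$ of) $\mathbb I_0(d,n)$ in $C(\overline{\mathcal D})$; it is a function algebra on $\overline{\mathcal D}$, and $\partial\mathcal D\subseteq\overline{\mathcal D}$ is its Shilov boundary. Reductions and bundles. A reduction $\mathfrak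 P$ of $\mathcal V(d,n)$ to a principal $K$-bundle over $\overline{\mathcal D}$ is the principal $K$-bundle given by a compact $K$-invariant subset $\mathcal P\subseteq\mathcal V(d,n)$ which $\pi_0$ maps onto $\overline{\mathcal D}$ and for which $\pi_0$ identifies $\mathcal P/K$ with $\overline{\mathcal D}$. $\mathfrak M^*(\mathfrak P;d,n)$ is the associated $M_n(\mathbb C)$-bundle, with total space $\mathcal P\times_K M_n(\mathbb C)$ (quotient of $\mathcal P\times M_n(\mathbb C)$ by $(\mathfrak z,A)\cdot k=(k^{-1}\mathfrak z k,k^{-1}Ak)$) and projection $\pi([\mathfrak z,A])=[\mathfrak z]$; each fibre $\pi^{-1}(\mathfrak u)$ is a $C^*$-algebra isomorphic to $M_n(\mathbb C)$ via $A\mapsto[\mathfrak z,A]$ for any $\mathfrak z\in\mathcal P$ with $\pi_0(\mathfrak z)=\mathfrak u$. $\Gamma_c(\partial\mathcal D,\mathfrak M^*(\mathfrak P;d,n))$ is the $C^*$-algebra of continuous cross sections over $\partial\mathcal D$, with fibrewise operations and the supremum norm. For $\phi\in\mathbb S_0(d,n)$, $\Psi(\phi)$ is the section $\Psi(\phi)([\mathfrak z])=[\mathfrak z,\phi(\mathfrak z)]$, $\mathfrak z\in\mathcal P$. $\mathbb S(\mathcal D,\mathfrak P;d,n)$ (the tracial function algebra) is the norm closure of $\Psi(\mathbb S_0(d,n))$ in $\Gamma_c(\partial\mathcal D,\mathfrak M^*(\mathfrak P;d,n))$. The algebra $\mathbb I(\mathcal D;d,n)$ is identified with a subalgebra of $\mathbb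 S(\mathcal D,\mathfrak P;d,n)$ by sending $f$ to the section $[\mathfrak z]\mapsto[\mathfrak z,f([\mathfrak z])I_n]$ over $\partial\mathcal D$. Ideals are algebraic ideals (not assumed closed). *)

theory Defs
  imports "HOL-Analysis.Analysis" "HOL-Algebra.Ideal_Product"
begin

text \<open>
  The numbers \<open>n\<close> and \<open>d\<close> are the cardinalities of the finite index types \<open>'n\<close> and \<open>'d\<close>.
  On \<^typ>\<open>complex^'n^'n\<close> the type class operation \<open>*\<close> is componentwise, so matrix products
  are written \<open>**\<close> throughout; scalars enter as \<open>mat c\<close>, that is \<open>c\<close> times the identity matrix.
\<close>

type_synonym ('n, 'd) mats = "complex^'n^'n^'d"

type_synonym ('n, 'd) point = "(('n, 'd) mats \<Rightarrow> complex) \<Rightarrow> complex"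

type_synonym ('n, 'd) bundle_point = "(('n, 'd) mats \<times> (complex^'n^'n)) set"


section \<open>Conjugation and generating tuples\<close>

text \<open>
  Scalar matrices act trivially by conjugation, so an action of the projective group \<open>PGL\<close>
  (or \<open>PU\<close>) is given by representatives in \<open>GL\<close> (or \<open>U\<close>), with the same orbits and the same
  invariants.
\<close>

definition conj_mat :: "complex^'n^'n \<Rightarrow> complex^'n^'n \<Rightarrow> complex^'n^'n" where
  "conj_mat s A = matrix_inv s ** A ** s"

definition conj_tuple :: "('n::finite, 'd::finite) mats \<Rightarrow> complex^'n^'n \<Rightarrow> ('n, 'd) mats" where
  "conj_tuple z s = (\<chi> i. conj_mat s (z $ i))"

definition adjoint_mat :: "complex^'n^'n \<Rightarrow> complex^'n^'n" where
  "adjoint_mat A = (\<chi> i j. cnj (A $ j $ i))"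

definition unitary :: "complex^'n^'n \<Rightarrow> bool" where
  "unitary k \<longleftrightarrow> adjoint_mat k ** k = mat 1 \<and> k ** adjoint_mat k = mat 1"

inductive_set generated_algebra :: "(complex^'n^'n) set \<Rightarrow> (complex^'n^'n) set"
  for S :: "(complex^'n^'n) set" where
  gen: "A \<in> S \<Longrightarrow> A \<in> generated_algebra S"
| scalar: "mat c \<in> generated_algebra S"
| add: "A \<in> generated_algebra S \<Longrightarrow> B \<in> generated_algebra S \<Longrightarrow> A + B \<in> generated_algebra S"
| mult: "A \<in> generated_algebra S \<Longrightarrow> B \<in> generated_algebra S \<Longrightarrow> A ** B \<in> generated_algebra S"

definition generating_tuples :: "('n::finite, 'd::finite) mats set" where
  "generating_tuples = {z. generated_algebra (range (($) z)) = UNIV}"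


section \<open>Invariant polynomials and the trace algebra\<close>

inductive_set polynomial_functions :: "(('n::finite, 'd::finite) mats \<Rightarrow> complex) set" where
  const: "(\<lambda>z. c) \<in> polynomial_functions"
| coord: "(\<lambda>z. z $ i $ a $ b) \<in> polynomial_functions"
| add: "p \<in> polynomial_functions \<Longrightarrow> q \<in> polynomial_functions \<Longrightarrow>
    (\<lambda>z. p z + q z) \<in> polynomial_functions"
| mult: "p \<in> polynomial_functions \<Longrightarrow> q \<in> polynomial_functions \<Longrightarrow>
    (\<lambda>z. p z * q z) \<in> polynomial_functions"

definition invariant_polynomials :: "(('n::finite, 'd::finite) mats \<Rightarrow> complex) set" where
  "invariant_polynomials =
    {p \<in> polynomial_functions. \<forall>s z. invertible s \<longrightarrow> p (conj_tuple z s) = p z}"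

inductive_set generated_function_algebra ::
  "(('n::finite, 'd::finite) mats \<Rightarrow> complex^'n^'n) set \<Rightarrow> (('n, 'd) mats \<Rightarrow> complex^'n^'n) set"
  for S :: "(('n, 'd) mats \<Rightarrow> complex^'n^'n) set" where
  gen: "f \<in> S \<Longrightarrow> f \<in> generated_function_algebra S"
| scalar: "(\<lambda>z. mat c) \<in> generated_function_algebra S"
| add: "f \<in> generated_function_algebra S \<Longrightarrow> g \<in> generated_function_algebra S \<Longrightarrow>
    (\<lambda>z. f z + g z) \<in> generated_function_algebra S"
| mult: "f \<in> generated_function_algebra S \<Longrightarrow> g \<in> generated_function_algebra S \<Longrightarrow>
    (\<lambda>z. f z ** g z) \<in> generated_function_algebra S"

definition generic_matrix_algebra :: "(('n::finite, 'd::finite) mats \<Rightarrow> complex^'n^'n) set" where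
  "generic_matrix_algebra = generated_function_algebra (range (\<lambda>i z. z $ i))"

definition trace_algebra :: "(('n::finite, 'd::finite) mats \<Rightarrow> complex^'n^'n) set" where
  "trace_algebra = generated_function_algebra
    (generic_matrix_algebra \<union> (\<lambda>p z. mat (p z)) ` invariant_polynomials)"


section \<open>The quotient variety\<close>

text \<open>
  The spectrum consists of the unital algebra homomorphisms from the invariant polynomials to
  the complex numbers; outside the invariant polynomials they are \<open>undefined\<close> by convention.
  The analytic topology is the topology of pointwise convergence, i.e. the coarsest one for which
  all regular functions \<open>\<lambda>u. u p\<close> are continuous. Since finitely many \<open>p\<close> generate the algebra, it
  is the topology induced by the corresponding embedding into an affine space.
\<close>

definition spectrum :: "('n::finite, 'd::finite) point set" where
  "spectrum = {u \<in> extensional invariant_polynomials.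
     (\<forall>c. u (\<lambda>z. c) = c) \<and>
     (\<forall>p\<in>invariant_polynomials. \<forall>q\<in>invariant_polynomials.
        u (\<lambda>z. p z + q z) = u p + u q \<and> u (\<lambda>z. p z * q z) = u p * u q)}"

definition analytic_topology :: "('n::finite, 'd::finite) point topology" where
  "analytic_topology =
    subtopology (product_topology (\<lambda>_. euclidean) invariant_polynomials) spectrum"

definition quotient_proj :: "('n::finite, 'd::finite) mats \<Rightarrow> ('n, 'd) point" where
  "quotient_proj z = (\<lambda>p\<in>invariant_polynomials. p z)"

definition regular_locus :: "('n::finite, 'd::finite) point set" where
  "regular_locus = quotient_proj ` generating_tuples"

definition invariant_hull :: "('n::finite, 'd::finite) point set \<Rightarrow> ('n, 'd) point set" where
  "invariant_hull X = {w \<in> spectrum.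
     \<forall>p\<in>invariant_polynomials. cmod (w p) \<le> (SUP x\<in>X. cmod (x p))}"

definition invariantly_convex :: "('n::finite, 'd::finite) point set \<Rightarrow> bool" where
  "invariantly_convex X \<longleftrightarrow> invariant_hull X = X"

abbreviation closure_in_spectrum ::
  "('n::finite, 'd::finite) point set \<Rightarrow> ('n, 'd) point set" where
  "closure_in_spectrum D \<equiv> analytic_topology closure_of D"


section \<open>The function algebra and its Shilov boundary\<close>

text \<open>
  For compact \<open>X\<close>, \<open>cfunspace\<close> is the space of continuous functions on \<open>X\<close> with the sup metric;
  its elements are \<open>undefined\<close> outside \<open>X\<close>.
\<close>

definition invariant_function_algebra ::
  "('n::finite, 'd::finite) point set \<Rightarrow> (('n, 'd) point \<Rightarrow> complex) set" where
  "invariant_function_algebra D =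
    mtopology_of (cfunspace (subtopology analytic_topology (closure_in_spectrum D)) euclidean_metric)
      closure_of ((\<lambda>p. \<lambda>u\<in>closure_in_spectrum D. u p) ` invariant_polynomials)"

definition closed_boundary :: "'a topology \<Rightarrow> ('a \<Rightarrow> complex) set \<Rightarrow> 'a set \<Rightarrow> bool" where
  "closed_boundary X F E \<longleftrightarrow>
    closedin X E \<and> (\<forall>f\<in>F. \<exists>x\<in>E. \<forall>y\<in>topspace X. cmod (f y) \<le> cmod (f x))"

text \<open>
  By a theorem of Shilov, the intersection of all closed boundaries of a function algebra on a
  compact Hausdorff space is again a boundary.
\<close>

definition shilov_boundary :: "'a topology \<Rightarrow> ('a \<Rightarrow> complex) set \<Rightarrow> 'a set" where
  "shilov_boundary X F = \<Inter> {E. closed_boundary X F E}"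

abbreviation domain_boundary ::
  "('n::finite, 'd::finite) point set \<Rightarrow> ('n, 'd) point set" where
  "domain_boundary D \<equiv>
    shilov_boundary (subtopology analytic_topology (closure_in_spectrum D))
      (invariant_function_algebra D)"

definition invariant_function_ring ::
  "('n::finite, 'd::finite) point set \<Rightarrow> (('n, 'd) point \<Rightarrow> complex) ring" where
  "invariant_function_ring D = \<lparr>
     carrier = invariant_function_algebra D,
     mult = (\<lambda>f g. \<lambda>u\<in>closure_in_spectrum D. f u * g u),
     one = (\<lambda>u\<in>closure_in_spectrum D. 1),
     zero = (\<lambda>u\<in>closure_in_spectrum D. 0),
     add = (\<lambda>f g. \<lambda>u\<in>closure_in_spectrum D. f u + g u)\<rparr>"


section \<open>Reductions and the associated matrix bundle\<close>

text \<open>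
  The last two clauses say that the projection identifies the orbit space of \<open>P\<close> with
  the closure of \<open>D\<close>: it is a topological quotient map whose fibres are the orbits.
\<close>

definition reduction ::
  "('n::finite, 'd::finite) point set \<Rightarrow> ('n, 'd) mats set \<Rightarrow> bool" where
  "reduction D P \<longleftrightarrow>
     compact P \<and> P \<subseteq> generating_tuples \<and>
     (\<forall>z\<in>P. \<forall>k. unitary k \<longrightarrow> conj_tuple z k \<in> P) \<and>
     quotient_map (top_of_set P) (subtopology analytic_topology (closure_in_spectrum D))
       quotient_proj \<and>
     (\<forall>z\<in>P. \<forall>w\<in>P. quotient_proj z = quotient_proj w \<longleftrightarrow>
        (\<exists>k. unitary k \<and> w = conj_tuple z k))"

text \<open>The class \<open>[z, A]\<close>, i.e. the orbit of \<open>(z, A)\<close>\<close>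

definition bundle_class ::
  "('n::finite, 'd::finite) mats \<Rightarrow> complex^'n^'n \<Rightarrow> ('n, 'd) bundle_point" where
  "bundle_class z A = {(conj_tuple z k, conj_mat k A) |k. unitary k}"

definition bundle_space ::
  "('n::finite, 'd::finite) mats set \<Rightarrow> ('n, 'd) bundle_point set" where
  "bundle_space P = {bundle_class z A |z A. z \<in> P}"

definition bundle_topology ::
  "('n::finite, 'd::finite) mats set \<Rightarrow> ('n, 'd) bundle_point topology" where
  "bundle_topology P = topology (\<lambda>U. U \<subseteq> bundle_space P \<and>
     openin (top_of_set (P \<times> UNIV)) {x \<in> P \<times> UNIV. case_prod bundle_class x \<in> U})"

lemma openin_bundle_topology:
  "openin (bundle_topology P) U \<longleftrightarrow> U \<subseteq> bundle_space P \<and>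
     openin (top_of_set (P \<times> UNIV)) {x \<in> P \<times> UNIV. case_prod bundle_class x \<in> U}"
proof -
  let ?pre = "\<lambda>U. {x \<in> P \<times> UNIV. case_prod bundle_class x \<in> U}"
  let ?L = "\<lambda>U. U \<subseteq> bundle_space P \<and> openin (top_of_set (P \<times> UNIV)) (?pre U)"
  have "istopology ?L"
    unfolding istopology_def
  proof (intro conjI allI impI)
    fix S T assume "?L S" "?L T"
    moreover have "?pre (S \<inter> T) = ?pre S \<inter> ?pre T" by auto
    ultimately show "openin (top_of_set (P \<times> UNIV)) (?pre (S \<inter> T))"
      by (simp only: openin_Int)
  next
    fix K assume *: "\<forall>S\<in>K. ?L S"
    have "?pre (\<Union>K) = (\<Union>S\<in>K. ?pre S)" by auto
    with * show "openin (top_of_set (P \<times> UNIV)) (?pre (\<Union>K))"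
      by (simp only: ) (blast intro: openin_Union)
  qed auto
  then show ?thesis
    unfolding bundle_topology_def by (simp add: topology_inverse')
qed

definition bundle_proj :: "('n::finite, 'd::finite) bundle_point \<Rightarrow> ('n, 'd) point" where
  "bundle_proj c = the_elem (quotient_proj ` fst ` c)"

text \<open>
  If \<open>op\<close> commutes with conjugation and \<open>z\<close> is generating, the following operation maps
  \<open>[z, A]\<close> and \<open>[z, B]\<close> to \<open>[z, op A B]\<close>: it is the operation of the fibre over the orbit of \<open>z\<close>.
\<close>

definition fibre_op ::
  "(complex^'n^'n \<Rightarrow> complex^'n^'n \<Rightarrow> complex^'n^'n) \<Rightarrow>
   ('n::finite, 'd::finite) bundle_point \<Rightarrow> ('n, 'd) bundle_point \<Rightarrow> ('n, 'd) bundle_point" where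
  "fibre_op op c c' = {(z, op A B) |z A B. (z, A) \<in> c \<and> (z, B) \<in> c'}"

text \<open>
  The norm of a matrix is its operator norm for the Euclidean norm of \<^typ>\<open>complex^'n\<close>, and so the
  \<open>C\<^sup>*\<close>-norm; it is constant on a class.
\<close>

definition fibre_norm :: "('n::finite, 'd::finite) bundle_point \<Rightarrow> real" where
  "fibre_norm c = the_elem ((\<lambda>(z, A). onorm ((*v) A)) ` c)"

definition continuous_sections ::
  "('n::finite, 'd::finite) mats set \<Rightarrow> ('n, 'd) point set \<Rightarrow>
   (('n, 'd) point \<Rightarrow> ('n, 'd) bundle_point) set" where
  "continuous_sections P B = {\<sigma> \<in> extensional B.
     continuous_map (subtopology analytic_topology B) (bundle_topology P) \<sigma> \<and>
     (\<forall>u\<in>B. bundle_proj (\<sigma> u) = u)}"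

definition section_op ::
  "('n::finite, 'd::finite) point set \<Rightarrow>
   (complex^'n^'n \<Rightarrow> complex^'n^'n \<Rightarrow> complex^'n^'n) \<Rightarrow>
   (('n, 'd) point \<Rightarrow> ('n, 'd) bundle_point) \<Rightarrow> (('n, 'd) point \<Rightarrow> ('n, 'd) bundle_point) \<Rightarrow>
   (('n, 'd) point \<Rightarrow> ('n, 'd) bundle_point)" where
  "section_op B op \<sigma> \<tau> = (\<lambda>u\<in>B. fibre_op op (\<sigma> u) (\<tau> u))"

definition section_norm ::
  "('n::finite, 'd::finite) point set \<Rightarrow> (('n, 'd) point \<Rightarrow> ('n, 'd) bundle_point) \<Rightarrow> real" where
  "section_norm B \<sigma> = (SUP u\<in>B. fibre_norm (\<sigma> u))"

text \<open>
  The section \<open>[z] \<mapsto> [z, \<phi> z]\<close>, which for an equivariant \<open>\<phi>\<close> does not depend on the choice of \<open>z\<close>.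
\<close>

definition section_of ::
  "('n::finite, 'd::finite) mats set \<Rightarrow> ('n, 'd) point set \<Rightarrow>
   (('n, 'd) mats \<Rightarrow> complex^'n^'n) \<Rightarrow> (('n, 'd) point \<Rightarrow> ('n, 'd) bundle_point)" where
  "section_of P B \<phi> =
    (\<lambda>u\<in>B. let z = (SOME z. z \<in> P \<and> quotient_proj z = u) in bundle_class z (\<phi> z))"


section \<open>The tracial function algebra\<close>

definition tracial_function_algebra ::
  "('n::finite, 'd::finite) point set \<Rightarrow> ('n, 'd) mats set \<Rightarrow>
   (('n, 'd) point \<Rightarrow> ('n, 'd) bundle_point) set" where
  "tracial_function_algebra D P = {\<sigma> \<in> continuous_sections P (domain_boundary D).
     \<forall>\<epsilon>>0. \<exists>\<phi>\<in>trace_algebra. section_norm (domain_boundary D)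
       (section_op (domain_boundary D) (-) \<sigma> (section_of P (domain_boundary D) \<phi>)) < \<epsilon>}"

definition tracial_function_ring ::
  "('n::finite, 'd::finite) point set \<Rightarrow> ('n, 'd) mats set \<Rightarrow>
   (('n, 'd) point \<Rightarrow> ('n, 'd) bundle_point) ring" where
  "tracial_function_ring D P = \<lparr>
     carrier = tracial_function_algebra D P,
     mult = section_op (domain_boundary D) (**),
     one = section_of P (domain_boundary D) (\<lambda>z. mat 1),
     zero = section_of P (domain_boundary D) (\<lambda>z. 0),
     add = section_op (domain_boundary D) (+)\<rparr>"

definition scalar_section ::
  "('n::finite, 'd::finite) point set \<Rightarrow> ('n, 'd) mats set \<Rightarrow>
   (('n, 'd) point \<Rightarrow> complex) \<Rightarrow> (('n, 'd) point \<Rightarrow> ('n, 'd) bundle_point)" where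
  "scalar_section D P f = section_of P (domain_boundary D) (\<lambda>z. mat (f (quotient_proj z)))"

text \<open>
  Both algebras are unital and contain the complex scalars, so their algebra ideals are the same
  as their ring ideals; \<^const>\<open>ideal\<close> means two-sided ideal. The product \<open>\<aa> S\<close> consists of
  the finite sums of products \<open>a s\<close>.
\<close>

definition extended_ideal ::
  "('n::finite, 'd::finite) point set \<Rightarrow> ('n, 'd) mats set \<Rightarrow>
   (('n, 'd) point \<Rightarrow> complex) set \<Rightarrow> (('n, 'd) point \<Rightarrow> ('n, 'd) bundle_point) set" where
  "extended_ideal D P I = ideal_prod (tracial_function_ring D P)
     (scalar_section D P ` I) (carrier (tracial_function_ring D P))"

definition contracted_ideal ::
  "('n::finite, 'd::finite) point set \<Rightarrow> ('n, 'd) mats set \<Rightarrow>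
   (('n, 'd) point \<Rightarrow> ('n, 'd) bundle_point) set \<Rightarrow> (('n, 'd) point \<Rightarrow> complex) set" where
  "contracted_ideal D P J =
    {f \<in> carrier (invariant_function_ring D). scalar_section D P f \<in> J}"

end

theory Submission
  imports Defs "HOL-Library.Function_Algebras"
begin

text \<open>
  The tracial function algebra \<open>S\<close> is an Azumaya algebra over the algebra \<open>I\<close> of invariant
  functions, and the correspondence of ideals is the one that holds for every Azumaya algebra. The
  proof uses the following explicit form of this fact.

  For each generating tuple \<open>z0\<close> there are elements \<open>w k\<close> and \<open>v k\<close> of the trace algebra and an
  invariant polynomial \<open>p\<close> with \<open>p z0 \<noteq> 0\<close> such that
  \<open>(\<Sum>k. w k ** A ** v k) = p * trace A\<close> and \<open>(\<Sum>k. trace (A ** v k) * w k) = p * A\<close>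
  for all matrices \<open>A\<close> (\<open>casimir_element_exists\<close>): the \<open>w k\<close> are the matrix units at \<open>z0\<close>, and
  the \<open>v k\<close> are obtained from the dual basis for the trace form, which Cramer's rule expresses by the
  Gram matrix, by clearing denominators.

  These identities are used in combination with two facts about \<open>I\<close>. The first is that a
  proper ideal of \<open>I\<close> has a common zero in the closure of \<open>D\<close>, at least for the regular functions in
  it (\<open>proper_ideal_has_zero\<close>). Indeed it is annihilated by a character, which exists by Zorn's lemma
  and the theorem of Gelfand and Mazur (\<open>gelfand_mazur\<close>, \<open>character_of_proper_ideal\<close>), and by
  convexity that character is evaluation at a point of the closure. Consequently
  membership in an ideal of \<open>S\<close> may be tested up to a factor \<open>p\<close> as above, with a separate choice
  of \<open>p\<close> for each \<open>z0\<close> (\<open>ideal_membership_local\<close>). The second fact is that the Shilov boundary is a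
  boundary (\<open>shilov_boundary_is_boundary\<close>). By it, the trace of a section in \<open>S\<close>, which is a priori
  defined over the boundary only, belongs to \<open>I\<close> (\<open>trace_T\<close>).

  If \<open>J\<close> is an ideal of \<open>S\<close>, the first identity shows that the traces of elements of \<open>J\<close>
  belong to \<open>J \<inter> I\<close>, and the second one that \<open>J\<close> is generated by them. Conversely, if
  \<open>f = (\<Sum>i. a i * s i)\<close> belongs to \<open>\<aa> S \<inter> I\<close>, taking traces gives
  \<open>n * f = (\<Sum>i. a i * trace (s i))\<close>, which belongs to \<open>\<aa>\<close>.

  To compute with elements of \<open>S\<close>, they are represented by equivariant matrix functions on the
  reduced bundle (\<open>tracial_function_algebra_eq\<close>).
\<close>

section \<open>The theorem of Gelfand and Mazur for a seminorm\<close>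

lemma sum_powers_root_of_unity:
  fixes n k :: nat
  assumes "0 < k" "k < n"
  shows "(\<Sum>j<n. (cis (2*pi/n) ^ j) ^ k) = 0"
proof -
  let ?w = "cis (2*pi/n)"
  have n: "n > 0" using assms by auto
  have "?w ^ k \<noteq> 1"
  proof
    assume "?w ^ k = 1"
    then have "cis (real k * (2*pi/n)) = 1" by (metis Complex.DeMoivre)
    then have "cos (2 * pi * k / n) = 1" by (simp add: complex_eq_iff mult_ac)
    then obtain m :: int where m: "2 * pi * k / n = of_int m * 2 * pi"
      using cos_one_2pi_int by blast
    then have "real k = of_int m * real n" using n by (simp add: field_simps)
    then have "int k = m * int n" by (metis of_int_eq_iff of_int_mult of_int_of_nat_eq)
    with assms show False
      by (metis int_dvd_int_iff dvd_triv_right nat_dvd_not_less)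
  qed
  moreover have "(?w ^ k) ^ n = 1"
  proof -
    have "?w ^ n = 1" using n by (simp add: Complex.DeMoivre)
    then show ?thesis by (metis power_commutes power_mult mult.commute power_one)
  qed
  moreover have "(\<Sum>j<n. (?w ^ j) ^ k) = (\<Sum>j<n. (?w ^ k) ^ j)"
    by (simp add: power_mult[symmetric] mult.commute)
  ultimately show ?thesis by (simp add: sum_gp_strict)
qed

text \<open>
  A submultiplicative seminorm \<open>N\<close>, not vanishing at \<open>1\<close>, on a commutative algebra \<open>R\<close> over the
  complex numbers. The algebra is a subset of a ring type, and \<open>sc c\<close> is the scalar \<open>c\<close> as an element of it. The
  seminorm to have in mind is the distance to an ideal of a Banach algebra.
\<close>

locale scalar_seminorm =
  fixes R :: "'r::comm_ring_1 set" and sc :: "complex \<Rightarrow> 'r" and N :: "'r \<Rightarrow> real"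
  assumes add_mem: "x \<in> R \<Longrightarrow> y \<in> R \<Longrightarrow> x + y \<in> R"
    and mult_mem: "x \<in> R \<Longrightarrow> y \<in> R \<Longrightarrow> x * y \<in> R"
    and sc_mem: "sc c \<in> R"
    and sc_add: "sc (c + d) = sc c + sc d"
    and sc_mult: "sc (c * d) = sc c * sc d"
    and sc_one: "sc 1 = 1"
    and N_nonneg: "x \<in> R \<Longrightarrow> 0 \<le> N x"
    and N_add: "x \<in> R \<Longrightarrow> y \<in> R \<Longrightarrow> N (x + y) \<le> N x + N y"
    and N_mult: "x \<in> R \<Longrightarrow> y \<in> R \<Longrightarrow> N (x * y) \<le> N x * N y"
    and N_sc: "N (sc c) \<le> cmod c"
    and N_one: "N 1 > 0"
begin

lemma sc_zero: "sc 0 = 0"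
  using sc_add[of 0 0] by simp

lemma sc_minus: "sc (- c) = - sc c"
  using sc_add[of c "-c"] sc_zero by (simp add: eq_neg_iff_add_eq_0 add.commute)

lemma sc_diff: "sc (c - d) = sc c - sc d"
  using sc_add[of c "-d"] sc_minus by simp

lemma sc_sum: "sc (\<Sum>j\<in>A. f j) = (\<Sum>j\<in>A. sc (f j))"
  by (induction A rule: infinite_finite_induct) (simp_all add: sc_zero sc_add)

lemma sc_of_nat: "sc (of_nat n) = of_nat n"
  by (induction n) (simp_all add: sc_zero sc_add sc_one)

lemma one_mem: "1 \<in> R"
  using sc_mem[of 1] sc_one by simp

lemma uminus_mem: "x \<in> R \<Longrightarrow> - x \<in> R"
  using mult_mem[OF sc_mem[of "-1"], of x] sc_minus[of 1] sc_one by simp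

lemma diff_mem: "x \<in> R \<Longrightarrow> y \<in> R \<Longrightarrow> x - y \<in> R"
  using add_mem[OF _ uminus_mem, of x y] by simp

lemma power_mem: "x \<in> R \<Longrightarrow> x ^ k \<in> R"
  by (induction k) (auto intro: mult_mem one_mem)

lemma zero_mem: "0 \<in> R"
  using sc_mem[of 0] sc_zero by simp

lemma sum_mem: "(\<And>j. j \<in> A \<Longrightarrow> f j \<in> R) \<Longrightarrow> (\<Sum>j\<in>A. f j) \<in> R"
  by (induction A rule: infinite_finite_induct) (auto intro: add_mem zero_mem)

lemma N_scale_le: "x \<in> R \<Longrightarrow> N (sc c * x) \<le> cmod c * N x"
  by (meson N_mult N_nonneg N_sc mult_right_mono order_trans sc_mem)

lemma N_scale: assumes "x \<in> R" shows "N (sc c * x) = cmod c * N x"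
proof (cases "c = 0")
  case True
  have "N (sc 0 * x) \<le> 0" using N_scale_le[of x 0] assms by simp
  then show ?thesis using True N_nonneg[of "sc 0 * x"] assms sc_mem mult_mem
    by (metis mult_zero_left norm_zero order_antisym)
next
  case False
  have "N x = N (sc (1/c) * (sc c * x))"
    using False by (simp add: mult.assoc[symmetric] sc_mult[symmetric] sc_one)
  also have "\<dots> \<le> cmod (1/c) * N (sc c * x)"
    using N_scale_le assms sc_mem mult_mem by blast
  finally have "cmod c * N x \<le> N (sc c * x)"
    using False by (simp add: norm_divide field_simps)
  with N_scale_le[OF assms, of c] show ?thesis by simp
qed

lemma N_uminus: "x \<in> R \<Longrightarrow> N (- x) = N x"
  using N_scale[of x "-1"] sc_minus[of 1] sc_one by simp

lemma N_diff: "x \<in> R \<Longrightarrow> y \<in> R \<Longrightarrow> N (x - y) \<le> N x + N y"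
  using N_add[of x "-y"] N_uminus uminus_mem by simp

lemma N_power: "x \<in> R \<Longrightarrow> k > 0 \<Longrightarrow> N (x ^ k) \<le> N x ^ k"
proof (induction k)
  case (Suc k)
  show ?case
  proof (cases "k = 0")
    case False
    have "N (x * x ^ k) \<le> N x * N (x ^ k)" using N_mult power_mem Suc.prems by blast
    also have "\<dots> \<le> N x * N x ^ k"
      using Suc False N_nonneg by (intro mult_left_mono) auto
    finally show ?thesis by simp
  qed simp
qed simp

lemma N_sum: "finite A \<Longrightarrow> (\<And>j. j \<in> A \<Longrightarrow> f j \<in> R) \<Longrightarrow> N (\<Sum>j\<in>A. f j) \<le> (\<Sum>j\<in>A. N (f j))"
proof (induction A rule: finite_induct)
  case empty
  have "N 0 \<le> 0" using N_sc[of 0] sc_zero by simp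
  then show ?case by simp
next
  case (insert a A)
  have "N (f a + sum f A) \<le> N (f a) + N (sum f A)"
    using insert by (intro N_add sum_mem) auto
  also have "\<dots> \<le> N (f a) + (\<Sum>j\<in>A. N (f j))" using insert by auto
  finally show ?case using insert by simp
qed

text \<open>
  The ideal of elements of seminorm zero; equality modulo \<open>null\<close> plays the role of equality in the
  quotient algebra.
\<close>

definition null :: "'r set" where "null = {x \<in> R. N x = 0}"

lemma null_mult: "x \<in> null \<Longrightarrow> y \<in> R \<Longrightarrow> y * x \<in> null"
  using N_mult[of y x] N_nonneg[of "y * x"] mult_mem[of y x] by (auto simp: null_def)

lemma null_add: "x \<in> null \<Longrightarrow> y \<in> null \<Longrightarrow> x + y \<in> null"
  using N_add[of x y] N_nonneg[of "x + y"] add_mem[of x y] by (auto simp: null_def)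

lemma null_diff: "x \<in> null \<Longrightarrow> y \<in> null \<Longrightarrow> x - y \<in> null"
  using N_diff[of x y] N_nonneg[of "x - y"] diff_mem[of x y] by (auto simp: null_def)

lemma zero_null: "0 \<in> null"
  using N_sc[of 0] N_nonneg[of 0] zero_mem by (simp add: null_def sc_zero)

lemma sum_null: "(\<And>j. j \<in> A \<Longrightarrow> f j \<in> null) \<Longrightarrow> (\<Sum>j\<in>A. f j) \<in> null"
  by (induction A rule: infinite_finite_induct) (auto intro: null_add zero_null)

lemma N_le_null: "x \<in> R \<Longrightarrow> y \<in> R \<Longrightarrow> x - y \<in> null \<Longrightarrow> N x \<le> N y"
  using N_add[of "x - y" y] by (auto simp: null_def)

text \<open>
  If every \<open>a - c\<close> were invertible modulo the null ideal, the norm \<open>h c\<close> of the resolvent would be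
  a continuous positive function on the plane that tends to zero at infinity, so it would attain a
  maximum. Averaging the resolvent over \<open>n\<close> equally spaced points of a circle around \<open>d\<close> gives
  the resolvent at \<open>d\<close> up to an error of order \<open>(r * h d) ^ n\<close>, where \<open>r\<close> is the radius. Hence
  \<open>h\<close> satisfies a mean value inequality on small circles, and a maximum propagates along the
  plane, which contradicts the decay. This argument needs neither a bounded linear functional nor
  a holomorphic function with values in the algebra.
\<close>

theorem gelfand_mazur:
  assumes a: "a \<in> R"
  shows "\<exists>c. \<forall>g\<in>R. N ((a - sc c) * g - 1) \<noteq> 0"
proof (rule ccontr)
  assume "\<not> ?thesis"
  then have "\<forall>c. \<exists>g\<in>R. N ((a - sc c) * g - 1) = 0" by blast
  then obtain g where gR: "\<And>c. g c \<in> R" and "\<And>c. N ((a - sc c) * g c - 1) = 0"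
    by metis
  then have g: "(a - sc c) * g c - 1 \<in> null" for c
    using a sc_mem one_mem by (auto simp: null_def intro!: diff_mem mult_mem)
  define h where "h c = N (g c)" for c
  have resolvent: "(g c - g d) - sc (c - d) * g c * g d \<in> null" for c d
  proof -
    have "(g c - g d) - sc (c - d) * g c * g d
        = g d * ((a - sc c) * g c - 1) - g c * ((a - sc d) * g d - 1)"
      by (simp add: sc_diff algebra_simps)
    also have "\<dots> \<in> null" by (rule null_diff[OF null_mult[OF g gR] null_mult[OF g gR]])
    finally show ?thesis .
  qed
  have h_nonneg: "h c \<ge> 0" for c using gR N_nonneg by (simp add: h_def)
  have h_pos: "h c > 0" for c
  proof -
    have "N 1 \<le> N ((a - sc c) * g c)"
    proof (rule N_le_null)
      show "1 - (a - sc c) * g c \<in> null"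
        using null_diff[OF zero_null g[of c]] by simp
    qed (use a sc_mem gR one_mem in \<open>auto intro!: mult_mem diff_mem\<close>)
    also have "\<dots> \<le> N (a - sc c) * h c"
      unfolding h_def using a sc_mem gR by (intro N_mult diff_mem)
    finally show ?thesis using N_one h_nonneg[of c] by (metis less_eq_real_def mult_zero_right not_less)
  qed
  have h_diff: "\<bar>h c - h d\<bar> \<le> cmod (c - d) * h c * h d" for c d
  proof -
    have *: "h c \<le> h d + cmod (c - d) * h c * h d" for c d
    proof -
      have mem: "sc (c - d) * (g c * g d) \<in> R" using gR sc_mem by (intro mult_mem)
      have "h c \<le> N (g d + sc (c - d) * (g c * g d))"
        unfolding h_def using gR mem resolvent[of c d]
        by (intro N_le_null add_mem) (auto simp: algebra_simps)
      also have "\<dots> \<le> h d + N (sc (c - d) * (g c * g d))"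
        unfolding h_def using gR mem by (intro N_add)
      also have "N (sc (c - d) * (g c * g d)) = cmod (c - d) * N (g c * g d)"
        using gR by (intro N_scale mult_mem)
      also have "\<dots> \<le> cmod (c - d) * (h c * h d)"
        unfolding h_def using gR by (intro mult_left_mono N_mult) auto
      finally show ?thesis by (simp add: mult.assoc)
    qed
    show ?thesis using *[of c d] *[of d c] by (simp add: norm_minus_commute mult_ac abs_le_iff)
  qed
  have cont: "isCont h d" for d
  proof -
    have ev: "\<forall>\<^sub>F c in at d. dist (h c) (h d) \<le> 2 * (h d)\<^sup>2 * dist c d"
      unfolding eventually_at
    proof (intro exI[of _ "1 / (2 * h d)"] conjI ballI impI)
      show "0 < 1 / (2 * h d)" using h_pos by simp
      fix c assume "c \<noteq> d \<and> dist c d < 1 / (2 * h d)"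
      then have "cmod (c - d) * h d \<le> 1/2" using h_pos[of d] by (simp add: dist_norm field_simps)
      then have "cmod (c - d) * h d * h c \<le> 1/2 * h c" by (intro mult_right_mono h_nonneg)
      then have "h c \<le> 2 * h d" using h_diff[of c d] by (simp add: mult_ac abs_le_iff)
      then have "cmod (c - d) * h c * h d \<le> cmod (c - d) * (2 * h d) * h d"
        by (intro mult_right_mono mult_left_mono h_nonneg) auto
      with h_diff[of c d] show "dist (h c) (h d) \<le> 2 * (h d)\<^sup>2 * dist c d"
        by (simp add: dist_norm power2_eq_square mult_ac)
    qed
    have "((\<lambda>c. 2 * (h d)\<^sup>2 * dist c d) \<longlongrightarrow> 2 * (h d)\<^sup>2 * dist d d) (at d)"
      by (intro tendsto_intros)
    then have "((\<lambda>c. 2 * (h d)\<^sup>2 * dist c d) \<longlongrightarrow> 0) (at d)" by simp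
    then have "((\<lambda>c. dist (h c) (h d)) \<longlongrightarrow> 0) (at d)"
      by (rule Lim_null_comparison[rotated]) (use ev in simp)
    then show ?thesis unfolding isCont_def using tendsto_dist_iff by blast
  qed
  have decay: "cmod c * h c \<le> N a * h c + N 1" for c
  proof -
    have "cmod c * h c = N (sc c * g c)" using N_scale gR by (simp add: h_def)
    also have "\<dots> \<le> N (a * g c - 1)"
    proof (rule N_le_null)
      show "sc c * g c - (a * g c - 1) \<in> null"
        using null_diff[OF zero_null g[of c]] by (simp add: algebra_simps)
    qed (use a sc_mem gR one_mem in \<open>auto intro!: mult_mem diff_mem\<close>)
    also have "\<dots> \<le> N (a * g c) + N 1"
      using a gR one_mem by (intro N_diff mult_mem)
    also have "N (a * g c) \<le> N a * h c" unfolding h_def using a gR by (intro N_mult)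
    finally show ?thesis by simp
  qed
  have small: "h c \<le> e" if e: "e > 0" and c: "cmod c \<ge> N a + N 1 / e" for c e
  proof (rule ccontr)
    assume "\<not> h c \<le> e"
    have "(N a + N 1 / e) * h c \<le> cmod c * h c" using c h_nonneg by (intro mult_right_mono)
    with decay[of c] have "N 1 / e * h c \<le> N 1" by (simp add: distrib_right)
    with \<open>\<not> h c \<le> e\<close> N_one e show False by (simp add: field_simps)
  qed
    have mean: "real n * h d \<le> (1 + (cmod w * h d) ^ n) * (\<Sum>j<n. h (d + w * cis (2*pi/n) ^ j))"
    if n: "n > 0" for n d w
  proof -
    let ?s = "\<lambda>j. w * cis (2*pi/n) ^ j"
    let ?G = "\<Sum>j<n. g (d + ?s j)"
    \<comment> \<open>The resolvent identity, iterated \<open>m\<close> times.\<close>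
    have expand: "g (d + s) - ((\<Sum>k<m. sc (s ^ k) * g d ^ Suc k) + sc (s ^ m) * g d ^ m * g (d + s))
        \<in> null" for s m
    proof (induction m)
      case 0
      show ?case by (simp add: sc_one zero_null)
    next
      case (Suc m)
      let ?r = "(g (d + s) - g d) - sc (d + s - d) * g (d + s) * g d"
      have "g (d + s) - ((\<Sum>k<Suc m. sc (s ^ k) * g d ^ Suc k)
            + sc (s ^ Suc m) * g d ^ Suc m * g (d + s))
          = (g (d + s) - ((\<Sum>k<m. sc (s ^ k) * g d ^ Suc k) + sc (s ^ m) * g d ^ m * g (d + s)))
            + (sc (s ^ m) * g d ^ m) * ?r"
        by (simp add: sc_mult algebra_simps)
      also have "\<dots> \<in> null"
        using Suc resolvent gR sc_mem by (intro null_add null_mult mult_mem power_mem)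
      finally show ?case .
    qed
    \<comment> \<open>Summation over the roots of unity removes all terms with \<open>0 < k < n\<close> of the expansion.\<close>
    have coeff: "(\<Sum>j<n. sc (?s j ^ k)) = (if k = 0 then of_nat n else 0)" if "k < n" for k
    proof (cases "k = 0")
      case False
      have "(\<Sum>j<n. ?s j ^ k) = w ^ k * (\<Sum>j<n. (cis (2*pi/n) ^ j) ^ k)"
        by (simp add: power_mult_distrib sum_distrib_left)
      also have "\<dots> = 0" using sum_powers_root_of_unity[of k n] False that by simp
      finally show ?thesis using False sc_sum[of "\<lambda>j. ?s j ^ k" "{..<n}"] sc_zero by simp
    qed (simp add: sc_one)
    have top: "?s j ^ n = w ^ n" for j
    proof -
      have "cis (2*pi/n) ^ n = 1" using n by (simp add: Complex.DeMoivre)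
      then have "(cis (2*pi/n) ^ j) ^ n = 1"
        by (metis power_mult mult.commute power_one)
      then show ?thesis by (simp add: power_mult_distrib)
    qed
    have "(\<Sum>j<n. g (d + ?s j) - ((\<Sum>k<n. sc (?s j ^ k) * g d ^ Suc k)
        + sc (?s j ^ n) * g d ^ n * g (d + ?s j))) \<in> null"
      by (intro sum_null expand)
    also have "(\<Sum>j<n. g (d + ?s j) - ((\<Sum>k<n. sc (?s j ^ k) * g d ^ Suc k)
        + sc (?s j ^ n) * g d ^ n * g (d + ?s j)))
        = ?G - ((\<Sum>j<n. \<Sum>k<n. sc (?s j ^ k) * g d ^ Suc k) + sc (w ^ n) * g d ^ n * ?G)"
      by (simp only: top sum_subtractf sum.distrib sum_distrib_left)
    also have "(\<Sum>j<n. \<Sum>k<n. sc (?s j ^ k) * g d ^ Suc k)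
        = (\<Sum>k<n. (\<Sum>j<n. sc (?s j ^ k)) * g d ^ Suc k)"
      by (subst sum.swap) (simp only: sum_distrib_right)
    also have "\<dots> = (\<Sum>k<n. (if k = 0 then of_nat n * g d else 0))"
      by (intro sum.cong) (auto simp: coeff)
    also have "\<dots> = of_nat n * g d" using n by simp
    finally have null: "?G - (of_nat n * g d + sc (w ^ n) * g d ^ n * ?G) \<in> null" .
    have GR: "?G \<in> R" using gR by (intro sum_mem)
    have R2: "sc (w ^ n) * (g d ^ n * ?G) \<in> R" using gR GR sc_mem by (intro mult_mem power_mem)
    have "real n * h d = N (of_nat n * g d)"
      using N_scale[OF gR, of "of_nat n" d] by (simp add: sc_of_nat h_def)
    also have "\<dots> \<le> N (?G - sc (w ^ n) * (g d ^ n * ?G))"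
    proof (rule N_le_null)
      show "of_nat n * g d - (?G - sc (w ^ n) * (g d ^ n * ?G)) \<in> null"
        using null_diff[OF zero_null null] by (simp add: algebra_simps)
      show "of_nat n * g d \<in> R" using mult_mem[OF sc_mem gR, of "of_nat n" d] by (simp add: sc_of_nat)
    qed (intro diff_mem GR R2)
    also have "\<dots> \<le> N ?G + N (sc (w ^ n) * (g d ^ n * ?G))" by (intro N_diff GR R2)
    also have "N (sc (w ^ n) * (g d ^ n * ?G)) = cmod w ^ n * N (g d ^ n * ?G)"
      using gR GR N_scale[of "g d ^ n * ?G" "w ^ n"] mult_mem power_mem by (simp add: norm_power)
    also have "\<dots> \<le> cmod w ^ n * (h d ^ n * N ?G)"
    proof -
      have "N (g d ^ n * ?G) \<le> N (g d ^ n) * N ?G" using gR GR by (intro N_mult power_mem)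
      also have "\<dots> \<le> h d ^ n * N ?G"
        unfolding h_def using N_power[OF gR n] N_nonneg[OF GR] by (intro mult_right_mono)
      finally show ?thesis by (intro mult_left_mono) auto
    qed
    also have "N ?G + cmod w ^ n * (h d ^ n * N ?G) = (1 + (cmod w * h d) ^ n) * N ?G"
      by (simp add: algebra_simps power_mult_distrib)
    also have "\<dots> \<le> (1 + (cmod w * h d) ^ n) * (\<Sum>j<n. h (d + ?s j))"
      unfolding h_def using gR N_sum[of "{..<n}" "\<lambda>j. g (d + ?s j)"] N_nonneg[OF gR]
      by (intro mult_left_mono) auto
    finally show ?thesis by simp
  qed
    obtain c0 where c0: "\<And>c. h c \<le> h c0"
  proof -
    let ?r = "N a + N 1 / h 0"
    have r0: "?r \<ge> 0" using a N_nonneg N_one h_pos[of 0] by simp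
    obtain c0 where "c0 \<in> cball 0 ?r" and *: "\<forall>c\<in>cball 0 ?r. h c \<le> h c0"
      using continuous_attains_sup[of "cball 0 ?r" h] r0 cont
      by (auto simp: continuous_at_imp_continuous_on)
    have "h c \<le> h c0" for c
    proof (cases "c \<in> cball 0 ?r")
      case False
      then have "h c \<le> h 0" by (intro small h_pos) auto
      also have "h 0 \<le> h c0" using * r0 by simp
      finally show ?thesis .
    qed (use * in blast)
    then show ?thesis using that by blast
  qed
  define m where "m = h c0"
  have m_pos: "m > 0" using h_pos by (simp add: m_def)
  have h_le: "h c \<le> m" for c using c0 by (simp add: m_def)
  have spread: "h (d + w) = m" if d: "h d = m" and w: "cmod w * m < 1" for d w
  proof (rule ccontr)
    assume "h (d + w) \<noteq> m"
    with h_le[of "d + w"] have "h (d + w) < m" by simp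
    define e where "e = (m - h (d + w)) / 2"
    have e: "e > 0" using \<open>h (d + w) < m\<close> by (simp add: e_def)
    have "isCont (\<lambda>t. h (d + w * cis t)) 0"
      by (intro continuous_intros isCont_o2[OF _ cont])
        (use tendsto_cis[OF tendsto_ident_at, of 0] in \<open>simp add: isCont_def\<close>)
    then obtain b where b: "b > 0" and
      bd: "\<And>t. \<bar>t\<bar> < b \<Longrightarrow> \<bar>h (d + w * cis t) - h (d + w)\<bar> < e"
      using e unfolding continuous_at_eps_delta dist_real_def by fastforce
    obtain K :: nat where K: "2 * pi / b < real K" using reals_Archimedean2 by blast
    have K0: "K > 0" using K b pi_gt_zero by (cases "K = 0") (auto simp: field_simps dest: order.strict_trans)
    \<comment> \<open>Of \<open>K * l\<close> equally spaced points on the circle, the first \<open>l\<close> lie on an arc where \<open>h\<close> is at most \<open>m - e\<close>.\<close>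
    have arc: "h (d + w * cis (2*pi/(K * l)) ^ j) \<le> m - e" if "l > 0" "j < l" for l j :: nat
    proof -
      have "2 * pi * real j / (K * l) \<le> 2 * pi / K"
      proof -
        have "2 * pi * real j / (K * l) = (2 * pi / K) * (real j / real l)" by simp
        also have "\<dots> \<le> (2 * pi / K) * 1" using that by (intro mult_left_mono) auto
        finally show ?thesis by simp
      qed
      also have "\<dots> < b" using K K0 b by (simp add: field_simps)
      finally have "\<bar>real j * (2 * pi / (K * l))\<bar> < b" by (simp add: mult_ac)
      from bd[OF this] have "h (d + w * cis (2*pi/(K * l)) ^ j) < h (d + w) + e"
        unfolding Complex.DeMoivre by linarith
      also have "\<dots> = m - e" by (simp add: e_def field_simps)
      finally show ?thesis by simp
    qed
    have ineq: "m \<le> (1 + (cmod w * m) ^ (K * l)) * (m - e / K)" if l: "l > 0" for l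
    proof -
      let ?f = "\<lambda>j. h (d + w * cis (2*pi/(K * l)) ^ j)"
      have "{..<K * l} = {..<l} \<union> {l..<K * l}" using K0 by (auto simp: Suc_leI)
        (metis le_trans less_le_trans mult_le_mono1 nat_mult_1 Suc_leI One_nat_def)
      then have "(\<Sum>j<K * l. ?f j) = (\<Sum>j<l. ?f j) + (\<Sum>j=l..<K * l. ?f j)"
        by (simp add: sum.union_disjoint ivl_disj_int)
      also have "\<dots> \<le> (\<Sum>j<l. m - e) + (\<Sum>j=l..<K * l. m)"
        using arc[OF l] h_le by (intro add_mono sum_mono) auto
      also have "\<dots> = real (K * l) * (m - e / K)"
      proof -
        have "l \<le> K * l" using K0 by simp
        then show ?thesis using K0 by (simp add: of_nat_diff field_simps)
      qed
      finally have S: "(\<Sum>j<K * l. ?f j) \<le> real (K * l) * (m - e / K)" .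
      have Kl: "K * l > 0" using K0 l by simp
      have "real (K * l) * m \<le> (1 + (cmod w * m) ^ (K * l)) * (\<Sum>j<K * l. ?f j)"
        using mean[OF Kl, of d w] d by simp
      also have "\<dots> \<le> (1 + (cmod w * m) ^ (K * l)) * (real (K * l) * (m - e / K))"
        using S m_pos by (intro mult_left_mono) auto
      finally have "real (K * l) * m \<le> real (K * l) * ((1 + (cmod w * m) ^ (K * l)) * (m - e / K))"
        by (simp only: mult_ac)
      then show ?thesis using Kl by (metis mult_le_cancel_left_pos of_nat_0_less_iff)
    qed
    have "(\<lambda>i. ((cmod w * m) ^ K) ^ i) \<longlonglongrightarrow> 0"
      using w m_pos K0 power_strict_mono[of "cmod w * m" 1 K] by (intro LIMSEQ_realpow_zero) auto
    then have "(\<lambda>l. (1 + ((cmod w * m) ^ K) ^ l) * (m - e / K)) \<longlonglongrightarrow> (1 + 0) * (m - e / K)"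
      by (intro tendsto_mult tendsto_add tendsto_const)
    then have "m \<le> (1 + 0) * (m - e / K)"
      by (rule LIMSEQ_le_const) (use ineq in \<open>auto simp: power_mult intro!: exI[of _ 1]\<close>)
    then show False using e K0 by (simp add: field_simps)
  qed
  \<comment> \<open>Every step of length \<open>1 / (2 * m)\<close> leads from one maximum point to another.\<close>
  define r where "r = complex_of_real (1 / (2 * m))"
  have r: "cmod r * m < 1" using m_pos by (simp add: r_def norm_divide)
  have walk: "h (c0 + of_nat k * r) = m" for k
  proof (induction k)
    case (Suc k)
    show ?case using spread[OF Suc r] by (simp add: algebra_simps)
  qed (simp add: m_def)
  obtain k :: nat where k: "(N a + N 1 / (m/2) + cmod c0) / cmod r < real k"
    using reals_Archimedean2 by blast
  have "cmod r > 0" using m_pos by (simp add: r_def)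
  then have "N a + N 1 / (m/2) + cmod c0 < real k * cmod r" using k by (simp add: field_simps)
  also have "\<dots> = cmod (of_nat k * r)" by (simp add: norm_mult)
  also have "\<dots> \<le> cmod (c0 + of_nat k * r) + cmod c0"
    using norm_triangle_ineq4[of "c0 + of_nat k * r" c0] by simp
  finally have "h (c0 + of_nat k * r) \<le> m / 2" using m_pos by (intro small) auto
  then show False using walk m_pos by simp
qed

end


section \<open>Characters of uniform algebras\<close>

text \<open>
  The members of \<open>R\<close> are total functions of which only the values on \<open>X\<close> matter; by
  completeness \<open>R\<close> contains every function that agrees on \<open>X\<close> with a member of \<open>R\<close>. No topology
  on \<open>X\<close> is needed.
\<close>

locale uniform_algebra =
  fixes X :: "'x set" and R :: "('x \<Rightarrow> complex) set"
  assumes nonempty: "X \<noteq> {}"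
    and const: "(\<lambda>x. c) \<in> R"
    and add: "f \<in> R \<Longrightarrow> g \<in> R \<Longrightarrow> (\<lambda>x. f x + g x) \<in> R"
    and mult: "f \<in> R \<Longrightarrow> g \<in> R \<Longrightarrow> (\<lambda>x. f x * g x) \<in> R"
    and bounded: "f \<in> R \<Longrightarrow> \<exists>B. \<forall>x\<in>X. cmod (f x) \<le> B"
    and complete: "(\<And>e. e > 0 \<Longrightarrow> \<exists>g\<in>R. \<forall>x\<in>X. cmod (f x - g x) < e) \<Longrightarrow> f \<in> R"
begin

text \<open>
  The supremum of the moduli of the values on \<open>X\<close>, a real number for members of \<open>R\<close>, as these
  are bounded on \<open>X\<close>.
\<close>

definition sup_norm :: "('x \<Rightarrow> complex) \<Rightarrow> real" where
  "sup_norm f = (SUP x\<in>X. cmod (f x))"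

text \<open>
  An ideal that contains the functions vanishing on \<open>X\<close> is the same as an ideal of the algebra of
  restrictions to \<open>X\<close>. Additive inverses are multiples by the constant \<open>-1\<close>.
\<close>

definition proper_ideal :: "('x \<Rightarrow> complex) set \<Rightarrow> bool" where
  "proper_ideal I \<longleftrightarrow> I \<subseteq> R \<and> (\<lambda>x. 1) \<notin> I \<and>
     (\<forall>f\<in>I. \<forall>g\<in>I. (\<lambda>x. f x + g x) \<in> I) \<and>
     (\<forall>f\<in>R. \<forall>g\<in>I. (\<lambda>x. f x * g x) \<in> I) \<and>
     (\<forall>f. (\<forall>x\<in>X. f x = 0) \<longrightarrow> f \<in> I)"

lemma ideal_mem: "proper_ideal M \<Longrightarrow> f \<in> M \<Longrightarrow> f \<in> R"
  by (auto simp: proper_ideal_def)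

lemma ideal_one: "proper_ideal M \<Longrightarrow> (\<lambda>x. 1) \<notin> M"
  by (simp add: proper_ideal_def)

lemma ideal_add: "proper_ideal M \<Longrightarrow> f \<in> M \<Longrightarrow> g \<in> M \<Longrightarrow> (\<lambda>x. f x + g x) \<in> M"
  by (simp add: proper_ideal_def)

lemma ideal_mult: "proper_ideal M \<Longrightarrow> f \<in> R \<Longrightarrow> g \<in> M \<Longrightarrow> (\<lambda>x. f x * g x) \<in> M"
  by (simp add: proper_ideal_def)

lemma ideal_vanishing: "proper_ideal M \<Longrightarrow> (\<And>x. x \<in> X \<Longrightarrow> f x = 0) \<Longrightarrow> f \<in> M"
  by (simp add: proper_ideal_def)

lemma zero_in_ideal: "proper_ideal M \<Longrightarrow> (\<lambda>x. 0) \<in> M"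
  by (simp add: ideal_vanishing)

lemma ideal_uminus: "proper_ideal M \<Longrightarrow> m \<in> M \<Longrightarrow> (\<lambda>x. - m x) \<in> M"
  using ideal_mult[OF _ const[of "-1"], of M m] by simp

lemma sup_norm_upper: "f \<in> R \<Longrightarrow> x \<in> X \<Longrightarrow> cmod (f x) \<le> sup_norm f"
  unfolding sup_norm_def using bounded[of f]
  by (intro cSUP_upper) (auto simp: bdd_above_def)

lemma sup_norm_least: "(\<And>x. x \<in> X \<Longrightarrow> cmod (f x) \<le> b) \<Longrightarrow> sup_norm f \<le> b"
  unfolding sup_norm_def using nonempty by (intro cSUP_least) auto

lemma sup_norm_nonneg: "f \<in> R \<Longrightarrow> 0 \<le> sup_norm f"
  using sup_norm_upper nonempty by (meson all_not_in_conv norm_ge_zero order_trans)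

lemma uminus_mem: "f \<in> R \<Longrightarrow> (\<lambda>x. - f x) \<in> R"
  using mult[OF const[of "-1"], of f] by simp

lemma diff_mem: "f \<in> R \<Longrightarrow> g \<in> R \<Longrightarrow> (\<lambda>x. f x - g x) \<in> R"
  using add[OF _ uminus_mem, of f g] by simp

lemma power_mem: "f \<in> R \<Longrightarrow> (\<lambda>x. f x ^ k) \<in> R"
  by (induction k) (auto intro: mult const)

lemma sum_mem: "(\<And>j. j \<in> A \<Longrightarrow> f j \<in> R) \<Longrightarrow> (\<lambda>x. \<Sum>j\<in>A. f j x) \<in> R"
  by (induction A rule: infinite_finite_induct) (auto intro: add const)

text \<open>
  The inverse is the uniform limit of the partial sums of the geometric series.
\<close>

lemma inverse_near_one:
  assumes f: "f \<in> R" and q: "q < 1" "\<And>x. x \<in> X \<Longrightarrow> cmod (1 - f x) \<le> q"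
  shows "(\<lambda>x. 1 / f x) \<in> R"
proof (rule complete)
  fix e :: real assume e: "e > 0"
  have q0: "0 \<le> q" using q nonempty by (meson all_not_in_conv norm_ge_zero order_trans)
  obtain n where n: "q ^ n < e * (1 - q)"
    using real_arch_pow_inv[of "e * (1 - q)" q] q e by auto
  let ?g = "\<lambda>x. \<Sum>k<n. (1 - f x) ^ k"
  have "?g \<in> R" using f by (intro sum_mem power_mem diff_mem const)
  moreover have "cmod (1 / f x - ?g x) < e" if x: "x \<in> X" for x
  proof -
    have low: "1 - q \<le> cmod (f x)"
      using q(2)[OF x] norm_triangle_ineq2[of 1 "1 - f x"] by simp
    then have nz: "f x \<noteq> 0" using q by auto
    have "?g x = (1 - (1 - f x) ^ n) / f x"
      using nz by (simp add: sum_gp_strict)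
    then have "1 / f x - ?g x = (1 - f x) ^ n / f x" using nz by (simp add: field_simps)
    then have "cmod (1 / f x - ?g x) = cmod (1 - f x) ^ n / cmod (f x)"
      by (simp add: norm_divide norm_power)
    also have "\<dots> \<le> q ^ n / (1 - q)"
      using q(2)[OF x] low q q0 by (intro frac_le power_mono) auto
    also have "\<dots> < e" using n q by (simp add: field_simps)
    finally show ?thesis .
  qed
  ultimately show "\<exists>g\<in>R. \<forall>x\<in>X. cmod (1 / f x - g x) < e"
    by (intro bexI[of _ ?g] ballI)
qed

lemma proper_ideal_far_from_one:
  assumes M: "proper_ideal M" and m: "m \<in> M" "q < 1" "\<And>x. x \<in> X \<Longrightarrow> cmod (1 - m x) \<le> q"
  shows False
proof -
  have mR: "m \<in> R" using M m by (auto simp: proper_ideal_def)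
  have nz: "m x \<noteq> 0" if "x \<in> X" for x using m(2) m(3)[OF that] by auto
  have "(\<lambda>x. 1 / m x * m x) \<in> M"
    by (rule ideal_mult[OF M inverse_near_one[OF mR m(2,3)] m(1)])
  moreover have "(\<lambda>x. 1 - 1 / m x * m x) \<in> M"
    by (rule ideal_vanishing[OF M]) (simp add: nz)
  ultimately have "(\<lambda>x. 1 / m x * m x + (1 - 1 / m x * m x)) \<in> M"
    by (rule ideal_add[OF M])
  then show False using ideal_one[OF M] by simp
qed

lemma maximal_ideal_exists:
  assumes I: "proper_ideal I"
  obtains M where "proper_ideal M" "I \<subseteq> M" "\<And>M'. proper_ideal M' \<Longrightarrow> M \<subseteq> M' \<Longrightarrow> M' = M"
proof -
  let ?A = "{M. proper_ideal M \<and> I \<subseteq> M}"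
  have "\<exists>M\<in>?A. \<forall>M'\<in>?A. M \<subseteq> M' \<longrightarrow> M' = M"
  proof (rule subset_Zorn_nonempty)
    show "?A \<noteq> {}" using I by blast
    fix C assume C: "C \<noteq> {}" "subset.chain ?A C"
    then have CA: "\<And>M. M \<in> C \<Longrightarrow> proper_ideal M \<and> I \<subseteq> M"
      by (auto simp: subset_chain_def)
    have two: "\<exists>M\<in>C. f \<in> M \<and> g \<in> M" if fg: "f \<in> \<Union>C" "g \<in> \<Union>C" for f g
    proof -
      obtain A B where AB: "A \<in> C" "f \<in> A" "B \<in> C" "g \<in> B" using fg by blast
      then have "A \<subseteq> B \<or> B \<subseteq> A" using C by (auto simp: subset_chain_def)
      with AB show ?thesis by blast
    qed
    have "proper_ideal (\<Union>C)"
      unfolding proper_ideal_def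
    proof (intro conjI ballI allI impI)
      show "(\<lambda>x. f x + g x) \<in> \<Union>C" if "f \<in> \<Union>C" "g \<in> \<Union>C" for f g
        using two[OF that] CA ideal_add by blast
      show "(\<lambda>x. f x * g x) \<in> \<Union>C" if "f \<in> R" "g \<in> \<Union>C" for f g
        using that CA ideal_mult by blast
      show "f \<in> \<Union>C" if "\<forall>x\<in>X. f x = 0" for f
        using that CA C(1) ideal_vanishing by blast
      show "\<Union>C \<subseteq> R" using CA ideal_mem by blast
      show "(\<lambda>x. 1) \<notin> \<Union>C" using CA ideal_one by blast
    qed
    moreover have "I \<subseteq> \<Union>C" using CA C(1) by blast
    ultimately show "\<Union>C \<in> ?A" by blast
  qed
  then obtain M where M: "proper_ideal M" "I \<subseteq> M" and max: "\<forall>M'\<in>?A. M \<subseteq> M' \<longrightarrow> M' = M"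
    by auto
  show thesis
  proof (rule that[OF M])
    show "M' = M" if "proper_ideal M'" "M \<subseteq> M'" for M'
      using bspec[OF max, of M'] that M by simp
  qed
qed

text \<open>
  The distance to \<open>M\<close> in the supremum norm.
\<close>

definition quotient_norm :: "('x \<Rightarrow> complex) set \<Rightarrow> ('x \<Rightarrow> complex) \<Rightarrow> real" where
  "quotient_norm M f = (INF m\<in>M. sup_norm (\<lambda>x. f x - m x))"

lemma quotient_norm_le:
  assumes "proper_ideal M" "f \<in> R" "m \<in> M" "\<And>x. x \<in> X \<Longrightarrow> cmod (f x - m x) \<le> b"
  shows "quotient_norm M f \<le> b"
proof -
  have "bdd_below ((\<lambda>m. sup_norm (\<lambda>x. f x - m x)) ` M)"
    using assms by (intro bdd_belowI[of _ 0])
      (auto intro!: sup_norm_nonneg diff_mem intro: ideal_mem)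
  then have "quotient_norm M f \<le> sup_norm (\<lambda>x. f x - m x)"
    unfolding quotient_norm_def using assms by (intro cINF_lower)
  also have "\<dots> \<le> b" using assms by (intro sup_norm_least)
  finally show ?thesis .
qed

lemma quotient_norm_approx:
  assumes "proper_ideal M" "f \<in> R" "e > 0"
  obtains m where "m \<in> M" "\<And>x. x \<in> X \<Longrightarrow> cmod (f x - m x) \<le> quotient_norm M f + e"
proof -
  have "\<exists>m\<in>M. sup_norm (\<lambda>x. f x - m x) < quotient_norm M f + e"
  proof (rule ccontr)
    assume "\<not> ?thesis"
    then have "quotient_norm M f + e \<le> quotient_norm M f"
      unfolding quotient_norm_def using zero_in_ideal[OF assms(1)]
      by (intro cINF_greatest) (auto simp: not_less)
    then show False using assms by simp
  qed
  then obtain m where m: "m \<in> M" "sup_norm (\<lambda>x. f x - m x) < quotient_norm M f + e" by blast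
  have "(\<lambda>x. f x - m x) \<in> R" using diff_mem[OF assms(2) ideal_mem[OF assms(1) m(1)]] .
  from sup_norm_upper[OF this] m(2) have "cmod (f x - m x) \<le> quotient_norm M f + e" if "x \<in> X" for x
    using that by force
  with m(1) show thesis using that by blast
qed

lemma quotient_norm_nonneg: "proper_ideal M \<Longrightarrow> f \<in> R \<Longrightarrow> 0 \<le> quotient_norm M f"
  unfolding quotient_norm_def using zero_in_ideal[of M]
  by (intro cINF_greatest sup_norm_nonneg diff_mem) (auto intro: ideal_mem)

lemma quotient_norm_seminorm:
  assumes M: "proper_ideal M"
  shows "scalar_seminorm R (\<lambda>c x. c) (quotient_norm M)"
proof
  let ?N = "quotient_norm M"
  fix f g :: "'x \<Rightarrow> complex" and c d :: complex
  show "(\<lambda>x. c + d) = (\<lambda>x. c) + (\<lambda>x. d)" "(\<lambda>x. c * d) = (\<lambda>x. c) * (\<lambda>x. d)" "(\<lambda>x. 1) = 1"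
    by (auto simp: fun_eq_iff)
  show "?N (\<lambda>x. c) \<le> cmod c"
    using quotient_norm_le[OF M const zero_in_ideal[OF M], of c "cmod c"] by simp
  show "0 < ?N 1"
  proof (rule ccontr)
    assume "\<not> 0 < ?N 1"
    then have "?N (\<lambda>x. 1) + 1/2 \<le> 1/2" by (simp add: one_fun_def)
    moreover obtain m where "m \<in> M" "\<And>x. x \<in> X \<Longrightarrow> cmod (1 - m x) \<le> ?N (\<lambda>x. 1) + 1/2"
      using quotient_norm_approx[OF M const, of "1/2" 1] by auto
    ultimately show False using proper_ideal_far_from_one[OF M, of m "1/2"] by force
  qed
  assume f: "f \<in> R"
  show "0 \<le> ?N f" using quotient_norm_nonneg M f .
  assume g: "g \<in> R"
  show sumR: "f + g \<in> R" and prodR: "f * g \<in> R"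
    using add[OF f g] mult[OF f g] by (simp_all add: plus_fun_def times_fun_def)
  show "?N (f + g) \<le> ?N f + ?N g"
  proof (rule field_le_epsilon)
    fix e :: real assume "e > 0"
    then have e: "e/2 > 0" by simp
    obtain m where m: "m \<in> M" "\<And>x. x \<in> X \<Longrightarrow> cmod (f x - m x) \<le> ?N f + e/2"
      using quotient_norm_approx[OF M f e] by auto
    obtain m' where m': "m' \<in> M" "\<And>x. x \<in> X \<Longrightarrow> cmod (g x - m' x) \<le> ?N g + e/2"
      using quotient_norm_approx[OF M g e] by auto
    show "?N (f + g) \<le> ?N f + ?N g + e"
    proof (rule quotient_norm_le[OF M sumR])
      show "(\<lambda>x. m x + m' x) \<in> M" using ideal_add[OF M m(1) m'(1)] .
      fix x assume x: "x \<in> X"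
      show "cmod ((f + g) x - (m x + m' x)) \<le> ?N f + ?N g + e"
        using norm_triangle_ineq[of "f x - m x" "g x - m' x"] m(2)[OF x] m'(2)[OF x]
        by (simp add: algebra_simps)
    qed
  qed
  have approx: "?N (f * g) \<le> (?N f + e) * (?N g + e)" if e: "e > 0" for e
  proof -
    obtain m where m: "m \<in> M" "\<And>x. x \<in> X \<Longrightarrow> cmod (f x - m x) \<le> ?N f + e"
      using quotient_norm_approx[OF M f e] by auto
    obtain m' where m': "m' \<in> M" "\<And>x. x \<in> X \<Longrightarrow> cmod (g x - m' x) \<le> ?N g + e"
      using quotient_norm_approx[OF M g e] by auto
    have "(\<lambda>x. f x * m' x + (g x - m' x) * m x) \<in> M"
      by (intro ideal_add[OF M] ideal_mult[OF M] diff_mem f g m(1) m'(1) ideal_mem[OF M])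
    then show ?thesis
    proof (rule quotient_norm_le[OF M prodR])
      fix x assume x: "x \<in> X"
      have "cmod ((f * g) x - (f x * m' x + (g x - m' x) * m x))
          = cmod (f x - m x) * cmod (g x - m' x)"
        by (simp add: norm_mult[symmetric] algebra_simps)
      also have "\<dots> \<le> (?N f + e) * (?N g + e)"
        using m(2)[OF x] m'(2)[OF x] e quotient_norm_nonneg[OF M f] by (intro mult_mono) auto
      finally show "cmod ((f * g) x - (f x * m' x + (g x - m' x) * m x)) \<le> (?N f + e) * (?N g + e)" .
    qed
  qed
  have "(\<lambda>n. (?N f + inverse (real (Suc n))) * (?N g + inverse (real (Suc n))))
      \<longlonglongrightarrow> (?N f + 0) * (?N g + 0)"
    by (intro tendsto_intros LIMSEQ_inverse_real_of_nat)
  then show "?N (f * g) \<le> ?N f * ?N g"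
    using approx by (intro LIMSEQ_le_const[of _ "?N f * ?N g"]) auto
qed (rule const)

text \<open>
  The character is the quotient map by a maximal ideal \<open>M\<close> containing \<open>I\<close>: by the theorem of
  Gelfand and Mazur, each \<open>f\<close> differs from a unique constant by a member of \<open>M\<close>.
\<close>

theorem character_of_proper_ideal:
  assumes I: "proper_ideal I"
  shows "\<exists>\<xi>. (\<forall>c. \<xi> (\<lambda>x. c) = c) \<and>
      (\<forall>f\<in>R. \<forall>g\<in>R. \<xi> (\<lambda>x. f x + g x) = \<xi> f + \<xi> g \<and> \<xi> (\<lambda>x. f x * g x) = \<xi> f * \<xi> g) \<and>
      (\<forall>f\<in>R. cmod (\<xi> f) \<le> sup_norm f) \<and> (\<forall>f\<in>I. \<xi> f = 0)"
proof -
  obtain M where M: "proper_ideal M" and IM: "I \<subseteq> M"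
    and max: "\<And>M'. proper_ideal M' \<Longrightarrow> M \<subseteq> M' \<Longrightarrow> M' = M"
    using maximal_ideal_exists[OF I] by blast
  interpret scalar_seminorm R "\<lambda>c x. c" "quotient_norm M"
    using quotient_norm_seminorm[OF M] .
  have M_add: "(\<lambda>x. f x + g x) \<in> M" if "f \<in> M" "g \<in> M" for f g
    using that M by (simp add: proper_ideal_def)
  have M_mult: "(\<lambda>x. f x * g x) \<in> M" if "f \<in> R" "g \<in> M" for f g
    using that M by (simp add: proper_ideal_def)
  have M_R: "f \<in> R" if "f \<in> M" for f using that M by (auto simp: proper_ideal_def)
  have M_zero: "f \<in> M" if "\<And>x. x \<in> X \<Longrightarrow> f x = 0" for f
    using that M by (simp add: proper_ideal_def)
  have M_one: "(\<lambda>x. 1) \<notin> M" using M by (simp add: proper_ideal_def)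
  have ex: "\<exists>c. (\<lambda>x. f x - c) \<in> M" if f: "f \<in> R" for f
  proof -
    obtain c where c: "\<And>g. g \<in> R \<Longrightarrow> quotient_norm M ((f - (\<lambda>x. c)) * g - 1) \<noteq> 0"
      using gelfand_mazur[OF f] by blast
    have fc: "(\<lambda>x. f x - c) \<in> R" using uniform_algebra.diff_mem[OF uniform_algebra_axioms f const] .
    have "(\<lambda>x. f x - c) \<in> M"
    proof (rule ccontr)
      assume notin: "(\<lambda>x. f x - c) \<notin> M"
      define M' where "M' = {(\<lambda>x. m x + g x * (f x - c)) |m g. m \<in> M \<and> g \<in> R}"
      have M'I: "(\<lambda>x. m x + g x * (f x - c)) \<in> M'" if "m \<in> M" "g \<in> R" for m g
        using that by (auto simp: M'_def)
      have "M \<subseteq> M'"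
      proof
        fix m assume "m \<in> M"
        from M'I[OF this const[of 0]] show "m \<in> M'" by simp
      qed
      moreover have "(\<lambda>x. f x - c) \<in> M'"
        using M'I[OF M_zero const[of 1], of "\<lambda>x. 0"] by simp
      ultimately have "\<not> proper_ideal M'" using max notin by blast
      moreover have "M' \<subseteq> R" using M_R fc by (auto simp: M'_def intro!: add mult)
      moreover have "(\<lambda>x. p x + q x) \<in> M'" if pq: "p \<in> M'" "q \<in> M'" for p q
      proof -
        obtain m g where p: "p = (\<lambda>x. m x + g x * (f x - c))" and mg: "m \<in> M" "g \<in> R"
          using pq by (auto simp: M'_def)
        obtain m' g' where q: "q = (\<lambda>x. m' x + g' x * (f x - c))" and mg': "m' \<in> M" "g' \<in> R"
          using pq by (auto simp: M'_def)
        have "(\<lambda>x. p x + q x) = (\<lambda>x. (m x + m' x) + (g x + g' x) * (f x - c))"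
          by (auto simp: p q fun_eq_iff algebra_simps)
        then show ?thesis using M'I[OF M_add[OF mg(1) mg'(1)] add[OF mg(2) mg'(2)]] by simp
      qed
      moreover have "(\<lambda>x. p x * q x) \<in> M'" if pq: "p \<in> R" "q \<in> M'" for p q
      proof -
        obtain m g where q: "q = (\<lambda>x. m x + g x * (f x - c))" and mg: "m \<in> M" "g \<in> R"
          using pq by (auto simp: M'_def)
        have "(\<lambda>x. p x * q x) = (\<lambda>x. p x * m x + (p x * g x) * (f x - c))"
          by (auto simp: q fun_eq_iff algebra_simps)
        then show ?thesis using M'I[OF M_mult[OF pq(1) mg(1)] mult[OF pq(1) mg(2)]] by simp
      qed
      moreover have "p \<in> M'" if "\<forall>x\<in>X. p x = 0" for p
        using \<open>M \<subseteq> M'\<close> M_zero that by blast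
      ultimately have "(\<lambda>x. 1) \<in> M'" unfolding proper_ideal_def by blast
      then obtain m g where one: "(\<lambda>x. 1) = (\<lambda>x. m x + g x * (f x - c))" and m: "m \<in> M" and g: "g \<in> R"
        by (auto simp: M'_def)
      have "m x = 1 - g x * (f x - c)" for x
        using fun_cong[OF one, of x] by (simp add: algebra_simps)
      then have "(f - (\<lambda>x. c)) * g - 1 = (\<lambda>x. - m x)"
        by (simp add: fun_eq_iff algebra_simps)
      moreover have "(\<lambda>x. - m x) \<in> M" using ideal_uminus M m by blast
      then have "quotient_norm M (\<lambda>x. - m x) \<le> 0"
        using M_R by (intro quotient_norm_le[OF M]) auto
      moreover have "0 \<le> quotient_norm M (\<lambda>x. - m x)"
        using M_R \<open>(\<lambda>x. - m x) \<in> M\<close> by (intro quotient_norm_nonneg[OF M])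
      ultimately show False using c[OF g] by simp
    qed
    then show ?thesis ..
  qed
  have unique: "c = d" if "(\<lambda>x. f x - c) \<in> M" "(\<lambda>x. f x - d) \<in> M" for c d f
  proof (rule ccontr)
    assume "c \<noteq> d"
    have "(\<lambda>x. (f x - c) + - (f x - d)) \<in> M" using that ideal_uminus M by (intro M_add)
    then have "(\<lambda>x. d - c) \<in> M" by (simp add: algebra_simps)
    from M_mult[OF const[of "1/(d-c)"] this] show False using M_one \<open>c \<noteq> d\<close> by simp
  qed
  define \<xi> where "\<xi> f = (THE c. (\<lambda>x. f x - c) \<in> M)" for f
  have \<xi>_eq: "\<xi> f = c" if "(\<lambda>x. f x - c) \<in> M" for f c
    unfolding \<xi>_def using that unique by blast
  have \<xi>: "(\<lambda>x. f x - \<xi> f) \<in> M" if "f \<in> R" for f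
    using ex[OF that] \<xi>_eq by blast
  show ?thesis
  proof (intro exI[of _ \<xi>] conjI allI ballI)
    show "\<xi> (\<lambda>x. c) = c" for c by (rule \<xi>_eq) (simp add: M_zero)
    show "\<xi> (\<lambda>x. f x + g x) = \<xi> f + \<xi> g" if "f \<in> R" "g \<in> R" for f g
      using M_add[OF \<xi>[OF that(1)] \<xi>[OF that(2)]] by (intro \<xi>_eq) (simp add: algebra_simps)
    show "\<xi> (\<lambda>x. f x * g x) = \<xi> f * \<xi> g" if "f \<in> R" "g \<in> R" for f g
      using M_add[OF M_mult[OF that(1) \<xi>[OF that(2)]] M_mult[OF const[of "\<xi> g"] \<xi>[OF that(1)]]]
      by (intro \<xi>_eq) (simp add: algebra_simps)
    show "\<xi> f = 0" if "f \<in> I" for f using that IM by (intro \<xi>_eq) auto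
    show "cmod (\<xi> f) \<le> sup_norm f" if f: "f \<in> R" for f
    proof (rule ccontr)
      assume "\<not> ?thesis"
      then have less: "sup_norm f < cmod (\<xi> f)" by simp
      then have nz: "cmod (\<xi> f) > 0" using sup_norm_nonneg[OF f] by linarith
      have "(\<lambda>x. (- 1 / \<xi> f) * (f x - \<xi> f)) \<in> M" using \<xi>[OF f] const by (intro M_mult)
      moreover have "cmod (1 - (- 1 / \<xi> f) * (f x - \<xi> f)) \<le> sup_norm f / cmod (\<xi> f)"
        if "x \<in> X" for x
      proof -
        have "1 - (- 1 / \<xi> f) * (f x - \<xi> f) = f x / \<xi> f" using nz by (simp add: field_simps)
        then show ?thesis
          using sup_norm_upper[OF f that] nz by (simp add: norm_divide divide_right_mono)
      qed
      moreover have "sup_norm f / cmod (\<xi> f) < 1" using less nz by simp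
      ultimately show False using proper_ideal_far_from_one[OF M] by blast
    qed
  qed
qed

end


section \<open>The Shilov boundary\<close>

text \<open>
  A basic open set \<open>V\<close> that is missed by one closed boundary can be removed from every closed
  boundary. Otherwise some \<open>f\<close> has maximum modulus \<open>1\<close> but is bounded by \<open>\<rho> < 1\<close> on \<open>E - V\<close>.
  For large \<open>k\<close> the products \<open>f ^ k * g\<close> have modulus less than \<open>1\<close> on \<open>E\<close>, therefore everywhere,
  so all points where \<open>f\<close> has modulus \<open>1\<close> lie in \<open>V\<close>; but one of them lies in \<open>E0\<close>.
\<close>

lemma closed_boundary_remove:
  assumes comp: "compact_space X"
    and cont: "\<And>f. f \<in> F \<Longrightarrow> continuous_map X euclidean f"
    and mult: "\<And>f g. f \<in> F \<Longrightarrow> g \<in> F \<Longrightarrow> (\<lambda>x. f x * g x) \<in> F"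
    and const: "\<And>c. (\<lambda>x. c) \<in> F"
    and G: "finite G" "G \<subseteq> F"
    and V: "V = {x \<in> topspace X. \<forall>g\<in>G. cmod (g x) < 1}"
    and E0: "closed_boundary X F E0" "E0 \<inter> V = {}"
    and E: "closed_boundary X F E"
  shows "closed_boundary X F (E - V)"
proof (rule ccontr)
  assume neg: "\<not> closed_boundary X F (E - V)"
  have cnorm: "continuous_map X euclideanreal (\<lambda>x. cmod (f x))" if "f \<in> F" for f
    using cont[OF that] by (intro continuous_map_norm)
  have pow: "(\<lambda>x. f x ^ k) \<in> F" if "f \<in> F" for f k
    by (induction k) (use that const[of 1] mult in auto)
  have E_sub: "E \<subseteq> topspace X" and E_closed: "closedin X E"
    and E0_sub: "E0 \<subseteq> topspace X"
    using E E0 closedin_subset by (auto simp: closed_boundary_def)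
  have "V = (\<Inter>g\<in>G. {x \<in> topspace X. cmod (g x) \<in> {..<1}}) \<inter> topspace X"
    using V by auto
  moreover have "openin X {x \<in> topspace X. cmod (g x) \<in> {..<1}}" if "g \<in> G" for g
    using cnorm that G by (intro openin_continuous_map_preimage[of X euclideanreal]) auto
  ultimately have V_open: "openin X V"
    using openin_INT[OF G(1), of X "\<lambda>g. {x \<in> topspace X. cmod (g x) \<in> {..<1}}"] by simp
  have EV: "closedin X (E - V)" using E_closed V_open by (rule closedin_diff)
  then have EV_comp: "compactin X (E - V)" using comp closedin_compact_space by blast
  obtain f \<rho> where f: "f \<in> F" and f_le: "\<And>x. x \<in> topspace X \<Longrightarrow> cmod (f x) \<le> 1"
    and f_max: "\<exists>x\<in>topspace X. cmod (f x) = 1"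
    and \<rho>: "0 \<le> \<rho>" "\<rho> < 1" "\<And>x. x \<in> E - V \<Longrightarrow> cmod (f x) \<le> \<rho>"
  proof (cases "E - V = {}")
    case True
    obtain e where "e \<in> E" using E const[of 1] unfolding closed_boundary_def by blast
    then have e: "e \<in> topspace X" using E_sub by blast
    show ?thesis
    proof (rule that[of "\<lambda>x. 1" 0])
      show "\<exists>x\<in>topspace X. cmod 1 = 1" using e by auto
      show "cmod 1 \<le> 0" if "x \<in> E - V" for x using True that by blast
    qed (simp_all add: const)
  next
    case False
    from neg EV obtain f where f: "f \<in> F"
      and nomax: "\<And>x. x \<in> E - V \<Longrightarrow> \<exists>y\<in>topspace X. cmod (f x) < cmod (f y)"
      unfolding closed_boundary_def by (meson not_le)
    obtain e where e: "e \<in> E" "\<And>y. y \<in> topspace X \<Longrightarrow> cmod (f y) \<le> cmod (f e)"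
      using E f by (auto simp: closed_boundary_def)
    have "compact ((\<lambda>x. cmod (f x)) ` (E - V))"
      using image_compactin[OF EV_comp cnorm[OF f]] by simp
    then obtain x0 where x0: "x0 \<in> E - V" "\<And>x. x \<in> E - V \<Longrightarrow> cmod (f x) \<le> cmod (f x0)"
      using compact_attains_sup[of "(\<lambda>x. cmod (f x)) ` (E - V)"] False by auto
    have less: "cmod (f x0) < cmod (f e)"
      using nomax[OF x0(1)] e by (meson less_le_trans)
    then have pos: "cmod (f e) > 0" by (meson norm_ge_zero le_less_trans)
    show ?thesis
    proof (rule that[of "\<lambda>x. (1 / f e) * f x" "cmod (f x0) / cmod (f e)"])
      show "(\<lambda>x. (1 / f e) * f x) \<in> F" using mult[OF const f] .
      show "\<exists>x\<in>topspace X. cmod (1 / f e * f x) = 1" using e(1) E_sub pos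
        by (intro bexI[of _ e]) (auto simp: norm_divide)
    qed (use pos less e x0 in \<open>auto simp: norm_divide divide_simps\<close>)
  qed
  have "\<exists>B. \<forall>x\<in>topspace X. cmod (g x) \<le> B" if "g \<in> F" for g
    using E that by (auto simp: closed_boundary_def)
  then obtain B where B: "\<And>g x. g \<in> F \<Longrightarrow> x \<in> topspace X \<Longrightarrow> cmod (g x) \<le> B g" by metis
  define C where "C = 1 + (\<Sum>g\<in>G. \<bar>B g\<bar>)"
  have C: "cmod (g x) < C" if "g \<in> G" "x \<in> topspace X" for g x
  proof -
    have "cmod (g x) \<le> \<bar>B g\<bar>" using B[of g x] that G by force
    also have "\<dots> \<le> (\<Sum>g\<in>G. \<bar>B g\<bar>)" using that G by (intro member_le_sum) auto
    finally show ?thesis by (simp add: C_def)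
  qed
  have C_pos: "C > 0" by (simp add: C_def add_pos_nonneg sum_nonneg)
  obtain k where k: "\<rho> ^ k * C < 1"
  proof -
    obtain k where "\<rho> ^ k < 1 / C" using real_arch_pow_inv[of "1 / C" \<rho>] \<rho> C_pos by auto
    then show ?thesis using that C_pos by (simp add: field_simps)
  qed
  have prod_less: "cmod (f y ^ k * g y) < 1" if g: "g \<in> G" and y: "y \<in> topspace X" for g y
  proof -
    have "(\<lambda>x. f x ^ k * g x) \<in> F" using mult pow f g G by blast
    then obtain e where e: "e \<in> E" and "cmod (f y ^ k * g y) \<le> cmod (f e ^ k * g e)"
      using E y by (auto simp: closed_boundary_def)
    note this(2)
    also have "cmod (f e ^ k * g e) < 1"
    proof (cases "e \<in> V")
      case True
      have "cmod (f e) ^ k * cmod (g e) \<le> 1 * cmod (g e)"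
        using f_le e E_sub by (intro mult_right_mono power_le_one) auto
      also have "\<dots> < 1" using True g V by auto
      finally show ?thesis by (simp add: norm_mult norm_power)
    next
      case False
      have "cmod (f e) ^ k * cmod (g e) \<le> \<rho> ^ k * C"
        using \<rho> False e C[OF g] E_sub by (intro mult_mono power_mono) (auto intro: less_imp_le)
      then show ?thesis using k by (simp add: norm_mult norm_power)
    qed
    finally show ?thesis .
  qed
  obtain e0 where e0: "e0 \<in> E0" "\<And>y. y \<in> topspace X \<Longrightarrow> cmod (f y) \<le> cmod (f e0)"
    using E0 f by (auto simp: closed_boundary_def)
  have "cmod (f e0) = 1" using e0 f_max f_le E0_sub by (metis order_antisym subsetD)
  then have "cmod (g e0) < 1" if "g \<in> G" for g
    using prod_less[OF that, of e0] e0 E0_sub by (auto simp: norm_mult norm_power)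
  then have "e0 \<in> V" using V e0 E0_sub by auto
  then show False using E0 e0 by auto
qed

text \<open>
  If the modulus of \<open>f\<close> had no maximum point in the intersection of all closed boundaries, then the
  compact set \<open>K\<close> of its maximum points would be covered by finitely many basic open sets, each
  missed by some closed boundary. Removing them one by one from the whole space leaves a closed boundary
  disjoint from \<open>K\<close>.
\<close>

theorem shilov_boundary_is_boundary:
  assumes comp: "compact_space X" and ne: "topspace X \<noteq> {}"
    and cont: "\<And>f. f \<in> F \<Longrightarrow> continuous_map X euclidean f"
    and mult: "\<And>f g. f \<in> F \<Longrightarrow> g \<in> F \<Longrightarrow> (\<lambda>x. f x * g x) \<in> F"
    and const: "\<And>c. (\<lambda>x. c) \<in> F"
    and base: "\<And>U x. openin X U \<Longrightarrow> x \<in> U \<Longrightarrow> \<exists>G. finite G \<and> G \<subseteq> F \<and>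
       x \<in> {y \<in> topspace X. \<forall>g\<in>G. cmod (g y) < 1} \<and> {y \<in> topspace X. \<forall>g\<in>G. cmod (g y) < 1} \<subseteq> U"
  shows "closed_boundary X F (shilov_boundary X F)"
proof -
  define V where "V G = {y \<in> topspace X. \<forall>g\<in>G. cmod (g y) < 1}" for G :: "('a \<Rightarrow> complex) set"
  let ?S = "shilov_boundary X F"
  have cnorm: "continuous_map X euclideanreal (\<lambda>x. cmod (f x))" if "f \<in> F" for f
    using cont[OF that] by (intro continuous_map_norm)
  have attain: "\<exists>x\<in>topspace X. \<forall>y\<in>topspace X. cmod (f y) \<le> cmod (f x)" if "f \<in> F" for f
  proof -
    have "compact ((\<lambda>x. cmod (f x)) ` topspace X)"
      using image_compactin[OF _ cnorm[OF that]] comp by (simp add: compact_space_def)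
    then show ?thesis
      using compact_attains_sup[of "(\<lambda>x. cmod (f x)) ` topspace X"] ne by auto
  qed
  have top: "closed_boundary X F (topspace X)"
    using attain by (simp add: closed_boundary_def)
  have closed: "closedin X ?S"
    unfolding shilov_boundary_def using top
    by (intro closedin_Inter) (auto simp: closed_boundary_def)
  moreover have "\<exists>x\<in>?S. \<forall>y\<in>topspace X. cmod (f y) \<le> cmod (f x)" if f: "f \<in> F" for f
  proof (rule ccontr)
    assume neg: "\<not> ?thesis"
    obtain m where m: "m \<in> topspace X" "\<And>y. y \<in> topspace X \<Longrightarrow> cmod (f y) \<le> cmod (f m)"
      using attain[OF f] by blast
    define K where "K = {x \<in> topspace X. cmod (f x) \<in> {cmod (f m)}}"
    have "closedin X K" unfolding K_def using cnorm[OF f]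
      by (intro closedin_continuous_map_preimage[of X euclideanreal]) auto
    then have K_comp: "compactin X K" using comp closedin_compact_space by blast
    have "\<exists>G E. finite G \<and> G \<subseteq> F \<and> x \<in> V G \<and> closed_boundary X F E \<and> E \<inter> V G = {}"
      if x: "x \<in> K" for x
    proof -
      have "x \<notin> ?S" using neg x m by (auto simp: K_def)
      then obtain E where E: "closed_boundary X F E" "x \<notin> E"
        by (auto simp: shilov_boundary_def)
      have "openin X (topspace X - E)" using E by (auto simp: closed_boundary_def)
      moreover have "x \<in> topspace X - E" using x E by (auto simp: K_def)
      ultimately obtain G where "finite G" "G \<subseteq> F" "x \<in> V G" "V G \<subseteq> topspace X - E"
        unfolding V_def using base[of "topspace X - E" x] by auto
      moreover then have "E \<inter> V G = {}" by blast
      ultimately show ?thesis using E by blast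
    qed
    then obtain G E where G: "\<And>x. x \<in> K \<Longrightarrow> finite (G x) \<and> G x \<subseteq> F \<and> x \<in> V (G x)"
      and E: "\<And>x. x \<in> K \<Longrightarrow> closed_boundary X F (E x) \<and> E x \<inter> V (G x) = {}"
      by metis
    have V_open: "openin X (V G)" if "finite G" "G \<subseteq> F" for G
    proof -
      have "V G = (\<Inter>g\<in>G. {x \<in> topspace X. cmod (g x) \<in> {..<1}}) \<inter> topspace X"
        by (auto simp: V_def)
      moreover have "openin X {x \<in> topspace X. cmod (g x) \<in> {..<1}}" if "g \<in> G" for g
        using cnorm that \<open>G \<subseteq> F\<close> by (intro openin_continuous_map_preimage[of X euclideanreal]) auto
      ultimately show ?thesis
        using openin_INT[OF that(1), of X "\<lambda>g. {x \<in> topspace X. cmod (g x) \<in> {..<1}}"] by simp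
    qed
    obtain T where T: "finite T" "T \<subseteq> K" "K \<subseteq> (\<Union>x\<in>T. V (G x))"
    proof -
      have "\<exists>\<F>. finite \<F> \<and> \<F> \<subseteq> (\<lambda>x. V (G x)) ` K \<and> K \<subseteq> \<Union>\<F>"
        using K_comp G V_open by (intro compactinD) auto
      then show ?thesis using that by (metis finite_subset_image)
    qed
    have "closed_boundary X F (topspace X - (\<Union>x\<in>T. V (G x)))"
      using T(1,2)
    proof (induction T rule: finite_induct)
      case empty
      then show ?case using top by simp
    next
      case (insert x T)
      have "closed_boundary X F ((topspace X - (\<Union>x\<in>T. V (G x))) - V (G x))"
        by (rule closed_boundary_remove[where G = "G x" and V = "V (G x)" and ?E0.0 = "E x" and F = F])
          (use insert.IH insert.prems G[of x] E[of x] comp cont mult const V_def in blast)+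
      moreover have "(topspace X - (\<Union>x\<in>T. V (G x))) - V (G x) = topspace X - (\<Union>x\<in>insert x T. V (G x))"
        by blast
      ultimately show ?case by simp
    qed
    then obtain x where x: "x \<in> topspace X" "x \<notin> (\<Union>x\<in>T. V (G x))"
        "\<forall>y\<in>topspace X. cmod (f y) \<le> cmod (f x)"
      using f unfolding closed_boundary_def by blast
    then have "x \<in> K" using m by (auto simp: K_def intro: order_antisym)
    then show False using x T by auto
  qed
  ultimately show ?thesis by (simp add: closed_boundary_def)
qed


section \<open>Trace algebra and Casimir elements\<close>

lemma matrix_inv_cancel:
  assumes "invertible s"
  shows "matrix_inv s ** s = mat 1" "s ** matrix_inv s = mat 1"
proof -
  have "\<exists>A'. s ** A' = mat 1 \<and> A' ** s = mat 1" using assms by (simp add: invertible_def)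
  from someI_ex[OF this] show "matrix_inv s ** s = mat 1" "s ** matrix_inv s = mat 1"
    by (simp_all add: matrix_inv_def)
qed

lemma mat_mult_left: "mat c ** A = (\<chi> i j. c * A $ i $ j)" for A :: "complex^'n^'m"
  by (simp add: matrix_matrix_mult_def mat_def vec_eq_iff if_distrib sum.delta' sum.delta
      if_distribR cong: if_cong)

lemma mat_mult_right: "A ** mat c = mat c ** A" for A :: "complex^'n^'n"
  unfolding mat_mult_left
  by (simp add: matrix_matrix_mult_def mat_def vec_eq_iff if_distrib sum.delta' sum.delta
      if_distribR mult.commute cong: if_cong)

lemma trace_mat_mult: "trace (mat c ** A) = c * trace A" for A :: "complex^'n^'n"
  by (simp add: mat_mult_left trace_def sum_distrib_left)

lemma trace_mat: "trace (mat c :: complex^'n^'n) = of_nat CARD('n) * c"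
  by (simp add: trace_def mat_def)

lemma mat_add: "mat (c + d) = (mat c + mat d :: complex^'n^'n)"
  by (simp add: mat_def vec_eq_iff)

lemma mat_mult: "mat (c * d) = (mat c ** mat d :: complex^'n^'n)"
  unfolding mat_mult_left by (simp add: mat_def vec_eq_iff)

lemma matrix_add_distrib_right: "(A + B) ** C = A ** C + B ** C" for A B :: "complex^'n^'m"
  by (simp add: matrix_matrix_mult_def vec_eq_iff sum.distrib distrib_right)

lemma conj_mat_add: "conj_mat s (A + B) = conj_mat s A + conj_mat s B"
  by (simp add: conj_mat_def matrix_matrix_mult_def vec_eq_iff sum.distrib algebra_simps)

lemma conj_mat_diff: "conj_mat s (A - B) = conj_mat s A - conj_mat s B"
  using conj_mat_add[of s "A - B" B] by (simp add: algebra_simps)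

lemma conj_mat_mult: "invertible s \<Longrightarrow> conj_mat s (A ** B) = conj_mat s A ** conj_mat s B"
  by (simp add: conj_mat_def matrix_mul_assoc) (metis matrix_inv_cancel matrix_mul_assoc matrix_mul_rid)

lemma conj_mat_scalar: "invertible s \<Longrightarrow> conj_mat s (mat c) = mat c"
  by (simp add: conj_mat_def mat_mult_right) (metis matrix_inv_cancel(1) matrix_mul_assoc matrix_mul_rid)

lemma trace_conj_mat: "invertible s \<Longrightarrow> trace (conj_mat s A) = trace A"
  unfolding conj_mat_def
  by (subst trace_mul_sym) (simp add: matrix_mul_assoc matrix_inv_cancel)

lemma conj_tuple_nth: "conj_tuple z s $ i = conj_mat s (z $ i)"
  by (simp add: conj_tuple_def)

lemma polynomial_sum: "(\<And>j. j \<in> J \<Longrightarrow> f j \<in> polynomial_functions) \<Longrightarrow>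
    (\<lambda>z. \<Sum>j\<in>J. f j z) \<in> polynomial_functions"
  by (induction J rule: infinite_finite_induct)
    (auto intro: polynomial_functions.intros)

lemma polynomial_prod: "(\<And>j. j \<in> J \<Longrightarrow> f j \<in> polynomial_functions) \<Longrightarrow>
    (\<lambda>z. \<Prod>j\<in>J. f j z) \<in> polynomial_functions"
  by (induction J rule: infinite_finite_induct)
    (auto intro: polynomial_functions.intros)

lemma invariant_const: "(\<lambda>z. c) \<in> invariant_polynomials"
  by (simp add: invariant_polynomials_def polynomial_functions.const)

lemma invariant_add: "p \<in> invariant_polynomials \<Longrightarrow> q \<in> invariant_polynomials \<Longrightarrow>
    (\<lambda>z. p z + q z) \<in> invariant_polynomials"
  by (simp add: invariant_polynomials_def polynomial_functions.add)

lemma invariant_mult: "p \<in> invariant_polynomials \<Longrightarrow> q \<in> invariant_polynomials \<Longrightarrow>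
    (\<lambda>z. p z * q z) \<in> invariant_polynomials"
  by (simp add: invariant_polynomials_def polynomial_functions.mult)

lemma invariant_det:
  assumes "\<And>i j. (\<lambda>z. M z $ i $ j) \<in> invariant_polynomials"
  shows "(\<lambda>z. det (M z)) \<in> invariant_polynomials"
proof -
  have "(\<lambda>z. det (M z)) \<in> polynomial_functions"
    unfolding det_def using assms
    by (intro polynomial_sum polynomial_functions.mult polynomial_functions.const polynomial_prod)
      (simp add: invariant_polynomials_def)
  moreover have "M (conj_tuple z s) = M z" if "invertible s" for z s
    using assms that by (simp add: invariant_polynomials_def vec_eq_iff)
  ultimately show ?thesis by (simp add: invariant_polynomials_def)
qed

lemma trace_algebra_const: "(\<lambda>z. mat c) \<in> trace_algebra"
  unfolding trace_algebra_def by (rule generated_function_algebra.scalar)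

lemma trace_algebra_add: "\<phi> \<in> trace_algebra \<Longrightarrow> \<psi> \<in> trace_algebra \<Longrightarrow>
    (\<lambda>z. \<phi> z + \<psi> z) \<in> trace_algebra"
  unfolding trace_algebra_def by (rule generated_function_algebra.add)

lemma trace_algebra_mult: "\<phi> \<in> trace_algebra \<Longrightarrow> \<psi> \<in> trace_algebra \<Longrightarrow>
    (\<lambda>z. \<phi> z ** \<psi> z) \<in> trace_algebra"
  unfolding trace_algebra_def by (rule generated_function_algebra.mult)

lemma trace_algebra_generic: "\<phi> \<in> generic_matrix_algebra \<Longrightarrow> \<phi> \<in> trace_algebra"
  unfolding trace_algebra_def by (rule generated_function_algebra.gen) simp

lemma trace_algebra_invariant: "p \<in> invariant_polynomials \<Longrightarrow> (\<lambda>z. mat (p z)) \<in> trace_algebra"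
  unfolding trace_algebra_def by (rule generated_function_algebra.gen) simp

lemma trace_algebra_sum: "(\<And>j. j \<in> J \<Longrightarrow> f j \<in> trace_algebra) \<Longrightarrow>
    (\<lambda>z. \<Sum>j\<in>J. f j z) \<in> trace_algebra"
  using trace_algebra_const[of 0]
  by (induction J rule: infinite_finite_induct) (auto intro: trace_algebra_add simp: mat_0)

lemma generated_algebra_equivariant:
  assumes "\<phi> \<in> generated_function_algebra S" "invertible s"
    and "\<And>\<psi> z. \<psi> \<in> S \<Longrightarrow> \<psi> (conj_tuple z s) = conj_mat s (\<psi> z)"
  shows "\<phi> (conj_tuple z s) = conj_mat s (\<phi> z)"
  using assms(1)
  by induction (simp_all add: assms conj_mat_scalar conj_mat_add conj_mat_mult)

lemma trace_algebra_equivariant: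
  assumes "\<phi> \<in> trace_algebra" "invertible s"
  shows "\<phi> (conj_tuple z s) = conj_mat s (\<phi> z)"
proof (rule generated_algebra_equivariant[OF assms(1)[unfolded trace_algebra_def] assms(2)])
  fix \<psi> :: "('a, 'b) mats \<Rightarrow> complex^'a^'a" and z
  assume "\<psi> \<in> generic_matrix_algebra \<union> (\<lambda>p z. mat (p z)) ` invariant_polynomials"
  then consider "\<psi> \<in> generic_matrix_algebra" | p where "p \<in> invariant_polynomials" "\<psi> = (\<lambda>z. mat (p z))"
    by blast
  then show "\<psi> (conj_tuple z s) = conj_mat s (\<psi> z)"
  proof cases
    case 1
    then show ?thesis unfolding generic_matrix_algebra_def
      by (rule generated_algebra_equivariant) (use assms in \<open>auto simp: conj_tuple_nth\<close>)
  next
    case 2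
    then show ?thesis using assms by (simp add: invariant_polynomials_def conj_mat_scalar)
  qed
qed

lemma generated_algebra_polynomial:
  assumes "\<phi> \<in> generated_function_algebra S"
    and "\<And>\<psi> a b. \<psi> \<in> S \<Longrightarrow> (\<lambda>z. \<psi> z $ a $ b) \<in> polynomial_functions"
  shows "(\<lambda>z. \<phi> z $ a $ b) \<in> polynomial_functions"
  using assms(1)
proof (induction arbitrary: a b)
  case (scalar c)
  show ?case by (simp add: mat_def polynomial_functions.const)
next
  case (mult f g)
  then show ?case
    by (simp add: matrix_matrix_mult_def polynomial_sum polynomial_functions.mult)
qed (simp_all add: assms polynomial_functions.add)

lemma trace_algebra_polynomial:
  assumes "\<phi> \<in> trace_algebra"
  shows "(\<lambda>z. \<phi> z $ a $ b) \<in> polynomial_functions"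
proof (rule generated_algebra_polynomial[OF assms[unfolded trace_algebra_def]])
  fix \<psi> :: "('a, 'b) mats \<Rightarrow> complex^'a^'a" and a b
  assume "\<psi> \<in> generic_matrix_algebra \<union> (\<lambda>p z. mat (p z)) ` invariant_polynomials"
  then consider "\<psi> \<in> generic_matrix_algebra" | p where "p \<in> invariant_polynomials" "\<psi> = (\<lambda>z. mat (p z))"
    by blast
  then show "(\<lambda>z. \<psi> z $ a $ b) \<in> polynomial_functions"
  proof cases
    case 1
    then show ?thesis unfolding generic_matrix_algebra_def
      by (rule generated_algebra_polynomial) (auto intro: polynomial_functions.coord)
  next
    case 2
    then show ?thesis by (cases "a = b") (simp_all add: mat_def invariant_polynomials_def polynomial_functions.const)
  qed
qed

lemma trace_algebra_trace:
  assumes "\<phi> \<in> trace_algebra"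
  shows "(\<lambda>z. trace (\<phi> z)) \<in> invariant_polynomials"
  unfolding invariant_polynomials_def
proof (intro CollectI conjI allI impI)
  show "(\<lambda>z. trace (\<phi> z)) \<in> polynomial_functions"
    unfolding trace_def using assms by (intro polynomial_sum trace_algebra_polynomial)
  show "trace (\<phi> (conj_tuple z s)) = trace (\<phi> z)" if "invertible s" for s z
    using assms that by (simp add: trace_algebra_equivariant trace_conj_mat)
qed

text \<open>
  In particular, if \<open>z0\<close> is a generating tuple, then every matrix is a value at \<open>z0\<close>.
\<close>

lemma generic_matrix_algebra_attains:
  assumes "B \<in> generated_algebra (range (($) z0))"
  shows "\<exists>\<phi>\<in>generic_matrix_algebra. \<phi> z0 = B"
  using assms unfolding generic_matrix_algebra_def
proof induction
  case (gen A)
  then obtain i where "A = z0 $ i" by blast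
  then show ?case
    by (intro bexI[of _ "\<lambda>z. z $ i"] generated_function_algebra.gen) auto
next
  case (scalar c)
  show ?case by (rule bexI[OF _ generated_function_algebra.scalar]) simp
next
  case (add A B)
  then obtain f g where "f \<in> generated_function_algebra (range (\<lambda>i z. z $ i))" "f z0 = A"
    "g \<in> generated_function_algebra (range (\<lambda>i z. z $ i))" "g z0 = B" by blast
  then show ?case by (intro bexI[of _ "\<lambda>z. f z + g z"] generated_function_algebra.add) auto
next
  case (mult A B)
  then obtain f g where "f \<in> generated_function_algebra (range (\<lambda>i z. z $ i))" "f z0 = A"
    "g \<in> generated_function_algebra (range (\<lambda>i z. z $ i))" "g z0 = B" by blast
  then show ?case by (intro bexI[of _ "\<lambda>z. f z ** g z"] generated_function_algebra.mult) auto
qed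

text \<open>
  If \<open>w\<close> and \<open>v\<close> are bases that are dual for the trace form, up to the factor \<open>p\<close>, then
  \<open>\<Sum>k. w k \<otimes> v k\<close> is the Casimir element of the matrix algebra, up to the same factor. It sends \<open>A\<close>
  to its trace, and it expands \<open>A\<close> in the basis \<open>w\<close>.
\<close>

lemma casimir_identities:
  fixes w v :: "'i::finite \<Rightarrow> complex^'n^'n" and A :: "complex^'n^'n"
  assumes "\<And>a b c d. (\<Sum>k\<in>UNIV. v k $ b $ a * w k $ c $ d) = (if a = c \<and> b = d then p else 0)"
  shows "(\<Sum>k\<in>UNIV. w k ** A ** v k) = mat (p * trace A)"
    and "(\<Sum>k\<in>UNIV. mat (trace (A ** v k)) ** w k) = mat p ** A"
proof -
  have "(\<Sum>k\<in>UNIV. w k ** A ** v k) $ c $ a = mat (p * trace A) $ c $ a" for a c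
  proof -
    have "(\<Sum>k\<in>UNIV. w k ** A ** v k) $ c $ a
        = (\<Sum>k\<in>UNIV. \<Sum>b\<in>UNIV. \<Sum>d\<in>UNIV. A $ d $ b * (v k $ b $ a * w k $ c $ d))"
      by (simp add: matrix_matrix_mult_def sum_distrib_right sum_distrib_left mult_ac)
    also have "\<dots> = (\<Sum>b\<in>UNIV. \<Sum>k\<in>UNIV. \<Sum>d\<in>UNIV. A $ d $ b * (v k $ b $ a * w k $ c $ d))"
      by (rule sum.swap)
    also have "\<dots> = (\<Sum>b\<in>UNIV. \<Sum>d\<in>UNIV. \<Sum>k\<in>UNIV. A $ d $ b * (v k $ b $ a * w k $ c $ d))"
      by (intro sum.cong refl sum.swap)
    also have "\<dots> = (\<Sum>b\<in>UNIV. \<Sum>d\<in>UNIV. A $ d $ b * (if a = c \<and> b = d then p else 0))"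
      by (simp only: sum_distrib_left[symmetric] assms)
    also have "\<dots> = (\<Sum>b\<in>UNIV. \<Sum>d\<in>UNIV. if b = d then (if a = c then A $ d $ b * p else 0) else 0)"
      by (intro sum.cong) auto
    also have "\<dots> = mat (p * trace A) $ c $ a"
      by (simp add: mat_def trace_def sum_distrib_left mult.commute)
    finally show ?thesis .
  qed
  then show "(\<Sum>k\<in>UNIV. w k ** A ** v k) = mat (p * trace A)" by (simp add: vec_eq_iff)
  have "(\<Sum>k\<in>UNIV. mat (trace (A ** v k)) ** w k) $ c $ d = (mat p ** A) $ c $ d" for c d
  proof -
    have "(\<Sum>k\<in>UNIV. mat (trace (A ** v k)) ** w k) $ c $ d
        = (\<Sum>k\<in>UNIV. \<Sum>a\<in>UNIV. \<Sum>b\<in>UNIV. A $ a $ b * (v k $ b $ a * w k $ c $ d))"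
      by (simp add: mat_mult_left trace_def)
        (simp add: matrix_matrix_mult_def sum_distrib_right sum_distrib_left mult_ac)
    also have "\<dots> = (\<Sum>a\<in>UNIV. \<Sum>k\<in>UNIV. \<Sum>b\<in>UNIV. A $ a $ b * (v k $ b $ a * w k $ c $ d))"
      by (rule sum.swap)
    also have "\<dots> = (\<Sum>a\<in>UNIV. \<Sum>b\<in>UNIV. \<Sum>k\<in>UNIV. A $ a $ b * (v k $ b $ a * w k $ c $ d))"
      by (intro sum.cong refl sum.swap)
    also have "\<dots> = (\<Sum>a\<in>UNIV. \<Sum>b\<in>UNIV. A $ a $ b * (if a = c \<and> b = d then p else 0))"
      by (simp only: sum_distrib_left[symmetric] assms)
    also have "\<dots> = (\<Sum>a\<in>UNIV. if a = c then A $ a $ d * p else 0)"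
    proof (intro sum.cong refl)
      fix a
      have "(\<Sum>b\<in>UNIV. A $ a $ b * (if a = c \<and> b = d then p else 0))
          = (\<Sum>b\<in>UNIV. if b = d then (if a = c then A $ a $ b * p else 0) else 0)"
        by (intro sum.cong) auto
      then show "(\<Sum>b\<in>UNIV. A $ a $ b * (if a = c \<and> b = d then p else 0))
          = (if a = c then A $ a $ d * p else 0)" by simp
    qed
    also have "\<dots> = (mat p ** A) $ c $ d"
      by (simp add: mat_mult_left mult.commute)
    finally show ?thesis .
  qed
  then show "(\<Sum>k\<in>UNIV. mat (trace (A ** v k)) ** w k) = mat p ** A" by (simp add: vec_eq_iff)
qed

text \<open>
  Elements \<open>w k\<close> of the trace algebra are chosen whose values at \<open>z0\<close> are the matrix units.
  Their Gram matrix \<open>G\<close> for the trace form has invariant entries, and its determinant \<open>\<Delta>\<close> does not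
  vanish at \<open>z0\<close>. By Cramer's rule \<open>\<Delta>\<close> times the inverse of \<open>G\<close> has invariant entries \<open>C\<close> as well,
  and this yields the dual basis \<open>v\<close> within the trace algebra. With the factor \<open>p = \<Delta> * \<Delta>\<close>
  instead of \<open>\<Delta>\<close> the identities also hold, trivially, where \<open>\<Delta>\<close> vanishes.
\<close>

theorem casimir_element_exists:
  fixes z0 :: "('n::finite, 'd::finite) mats"
  assumes z0: "z0 \<in> generating_tuples"
  shows "\<exists>p\<in>invariant_polynomials. \<exists>w v :: 'n \<times> 'n \<Rightarrow> ('n, 'd) mats \<Rightarrow> complex^'n^'n.
    p z0 \<noteq> 0 \<and> (\<forall>k. w k \<in> trace_algebra \<and> v k \<in> trace_algebra) \<and>
    (\<forall>z A. (\<Sum>k\<in>UNIV. w k z ** A ** v k z) = mat (p z * trace A) \<and>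
      (\<Sum>k\<in>UNIV. mat (trace (A ** v k z)) ** w k z) = mat (p z) ** A)"
proof -
  define E :: "'n \<times> 'n \<Rightarrow> complex^'n^'n" where
    "E k = (\<chi> c d. if c = fst k \<and> d = snd k then 1 else 0)" for k
  have "\<exists>\<phi>\<in>generic_matrix_algebra. \<phi> z0 = E k" for k
    using z0 by (intro generic_matrix_algebra_attains) (simp add: generating_tuples_def)
  then obtain w where "\<And>k. w k \<in> generic_matrix_algebra" and w0: "\<And>k. w k z0 = E k" by metis
  then have w: "w k \<in> trace_algebra" for k by (simp add: trace_algebra_generic)
  define G :: "('n, 'd) mats \<Rightarrow> complex^('n \<times> 'n)^('n \<times> 'n)" where
    "G z = (\<chi> i j. trace (w i z ** w j z))" for z
  define \<Delta> where "\<Delta> z = det (G z)" for z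
  define C where "C z i k = det (\<chi> a b. if b = i then (axis k 1 :: complex^('n \<times> 'n)) $ a else G z $ a $ b)"
    for z and i k :: "'n \<times> 'n"
  define u where "u k z = (\<Sum>i\<in>UNIV. mat (C z i k) ** w i z)" for k z
  define v where "v k z = mat (\<Delta> z) ** u k z" for k z
  have G_inv: "(\<lambda>z. G z $ i $ j) \<in> invariant_polynomials" for i j
    unfolding G_def using trace_algebra_trace[OF trace_algebra_mult[OF w w]] by simp
  have \<Delta>_inv: "\<Delta> \<in> invariant_polynomials"
    unfolding \<Delta>_def[abs_def] using G_inv by (rule invariant_det)
  have C_inv: "(\<lambda>z. C z i k) \<in> invariant_polynomials" for i k
    unfolding C_def
  proof (rule invariant_det)
    show "(\<lambda>z. (\<chi> a b. if b = i then (axis k 1 :: complex^('n \<times> 'n)) $ a else G z $ a $ b) $ a $ b)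
        \<in> invariant_polynomials" for a b
      using G_inv[of a b] invariant_const by (cases "b = i") auto
  qed
  have v: "v k \<in> trace_algebra" for k
    unfolding v_def[abs_def] u_def
    by (intro trace_algebra_mult trace_algebra_sum trace_algebra_invariant \<Delta>_inv C_inv w)
  have key: "(\<Sum>k\<in>UNIV. v k z $ b $ a * w k z $ c $ d) = (if a = c \<and> b = d then \<Delta> z * \<Delta> z else 0)"
    for z a b c d
  proof (cases "\<Delta> z = 0")
    case True
    then show ?thesis by (simp add: v_def mat_mult_left)
  next
    case False
    have gram: "(\<Sum>i\<in>UNIV. G z $ j $ i * C z i k) = (if j = k then \<Delta> z else 0)" for j k
    proof -
      let ?x = "\<chi> i. C z i k / \<Delta> z"
      have "G z *v ?x = axis k 1"
        unfolding C_def \<Delta>_def by (subst cramer) (use False in \<open>auto simp: \<Delta>_def\<close>)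
      then have "(G z *v ?x) $ j = axis k 1 $ j" by simp
      then have "(\<Sum>i\<in>UNIV. G z $ j $ i * C z i k) / \<Delta> z = axis k 1 $ j"
        by (simp add: matrix_vector_mult_def sum_divide_distrib)
      then show ?thesis using False by (simp add: axis_def field_simps split: if_splits)
    qed
    \<comment> \<open>As \<open>W\<close> and \<open>V\<close> are square matrices, \<open>W ** V = mat 1\<close> gives \<open>V ** W = mat 1\<close>, the dual relation.\<close>
    define W :: "complex^('n \<times> 'n)^('n \<times> 'n)" where "W = (\<chi> j x. w j z $ fst x $ snd x)"
    define V :: "complex^('n \<times> 'n)^('n \<times> 'n)" where "V = (\<chi> x k. u k z $ snd x $ fst x / \<Delta> z)"
    have tr: "trace (w j z ** u k z) = (if j = k then \<Delta> z else 0)" for j k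
    proof -
      have "trace (w j z ** u k z) = (\<Sum>i\<in>UNIV. G z $ j $ i * C z i k)"
      proof -
        have "w j z ** u k z = (\<Sum>i\<in>UNIV. mat (C z i k) ** (w j z ** w i z))"
          unfolding u_def
          by (simp only: mat_mult_left)
            (simp add: matrix_matrix_mult_def vec_eq_iff sum_distrib_left mult_ac, intro allI sum.swap)
        then have "trace (w j z ** u k z) = (\<Sum>i\<in>UNIV. trace (mat (C z i k) ** (w j z ** w i z)))"
          by (simp add: trace_def) (rule sum.swap)
        then show ?thesis by (simp add: trace_mat_mult G_def mult.commute)
      qed
      then show ?thesis using gram by simp
    qed
    have "W ** V = mat 1"
    proof -
      have "(W ** V) $ j $ k = mat 1 $ j $ k" for j k
      proof -
        have "(W ** V) $ j $ k = (\<Sum>x\<in>UNIV \<times> UNIV. w j z $ fst x $ snd x * u k z $ snd x $ fst x) / \<Delta> z"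
          by (simp add: matrix_matrix_mult_def W_def V_def sum_divide_distrib)
        also have "(\<Sum>x\<in>UNIV \<times> UNIV. w j z $ fst x $ snd x * u k z $ snd x $ fst x)
            = trace (w j z ** u k z)"
          by (simp add: trace_def matrix_matrix_mult_def sum.cartesian_product case_prod_unfold)
        finally show ?thesis using tr False by (simp add: mat_def)
      qed
      then show ?thesis by (simp add: vec_eq_iff)
    qed
    then have "V ** W = mat 1" by (simp add: matrix_left_right_inverse)
    then have "(V ** W) $ (a, b) $ (c, d) = mat 1 $ (a, b) $ (c, d)" by simp
    then have "(\<Sum>k\<in>UNIV. u k z $ b $ a * w k z $ c $ d) / \<Delta> z = (if a = c \<and> b = d then 1 else 0)"
      by (simp add: matrix_matrix_mult_def W_def V_def mat_def sum_divide_distrib)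
    then have "(\<Sum>k\<in>UNIV. u k z $ b $ a * w k z $ c $ d) = (if a = c \<and> b = d then \<Delta> z else 0)"
      using False by (simp add: field_simps split: if_splits)
    moreover have "(\<Sum>k\<in>UNIV. v k z $ b $ a * w k z $ c $ d)
        = \<Delta> z * (\<Sum>k\<in>UNIV. u k z $ b $ a * w k z $ c $ d)"
      by (simp add: v_def mat_mult_left sum_distrib_left mult_ac)
    ultimately show ?thesis by simp
  qed
  have \<Delta>0: "\<Delta> z0 \<noteq> 0"
  proof -
    have tr: "G z0 $ i $ j = (if j = prod.swap i then 1 else 0)" for i j
    proof -
      have "trace (E i ** E j) = (\<Sum>c\<in>UNIV. \<Sum>d\<in>UNIV.
          if c = fst i then if d = snd i then if d = fst j \<and> c = snd j then 1 else 0 else 0 else 0)"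
        unfolding trace_def matrix_matrix_mult_def E_def by (auto intro!: sum.cong)
      also have "\<dots> = (\<Sum>c\<in>UNIV. if c = fst i then (\<Sum>d\<in>UNIV.
          if d = snd i then if d = fst j \<and> c = snd j then 1 else 0 else 0) else 0)"
        by (intro sum.cong) auto
      also have "\<dots> = (if j = prod.swap i then 1 else 0)"
        by (cases i; cases j) (auto simp: prod.swap_def)
      finally show ?thesis by (simp add: G_def w0)
    qed
    have "(G z0 ** G z0) $ i $ j = mat 1 $ i $ j" for i j
    proof -
      have "(G z0 ** G z0) $ i $ j = (\<Sum>k\<in>UNIV. if k = prod.swap i then (if j = prod.swap k then 1 else 0) else 0)"
        by (simp only: matrix_matrix_mult_def vec_lambda_beta tr) (intro sum.cong refl, simp)
      also have "\<dots> = (if i = j then 1 else 0)" by auto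
      finally show ?thesis by (simp add: mat_def)
    qed
    then have "G z0 ** G z0 = mat 1" by (simp add: vec_eq_iff)
    then have "invertible (G z0)" using invertible_right_inverse by blast
    then show ?thesis by (simp add: \<Delta>_def invertible_det_nz)
  qed
  show ?thesis
  proof (intro bexI exI conjI allI)
    show "(\<lambda>z. \<Delta> z * \<Delta> z) \<in> invariant_polynomials" using \<Delta>_inv by (intro invariant_mult)
    show "\<Delta> z0 * \<Delta> z0 \<noteq> 0" using \<Delta>0 by simp
    show "w k \<in> trace_algebra" for k by (rule w)
    show "v k \<in> trace_algebra" for k by (rule v)
    show "(\<Sum>k\<in>UNIV. w k z ** A ** v k z) = mat (\<Delta> z * \<Delta> z * trace A)" for z A
      using casimir_identities(1)[of "\<lambda>k. v k z" "\<lambda>k. w k z", OF key] .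
    show "(\<Sum>k\<in>UNIV. mat (trace (A ** v k z)) ** w k z) = mat (\<Delta> z * \<Delta> z) ** A" for z A
      using casimir_identities(2)[of "\<lambda>k. v k z" "\<lambda>k. w k z", OF key] .
  qed
qed


section \<open>The algebra of invariant functions\<close>

lemma topspace_analytic: "topspace (analytic_topology :: ('n::finite, 'd::finite) point topology) = spectrum"
  by (auto simp: analytic_topology_def spectrum_def PiE_def)

lemma spectrum_const: "u \<in> spectrum \<Longrightarrow> u (\<lambda>z. c) = c"
  by (simp add: spectrum_def)

lemma spectrum_add: "u \<in> spectrum \<Longrightarrow> p \<in> invariant_polynomials \<Longrightarrow> q \<in> invariant_polynomials \<Longrightarrow>
    u (\<lambda>z. p z + q z) = u p + u q"
  by (simp add: spectrum_def)

lemma spectrum_mult: "u \<in> spectrum \<Longrightarrow> p \<in> invariant_polynomials \<Longrightarrow> q \<in> invariant_polynomials \<Longrightarrow>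
    u (\<lambda>z. p z * q z) = u p * u q"
  by (simp add: spectrum_def)

lemma continuous_evaluation:
  assumes "p \<in> invariant_polynomials"
  shows "continuous_map analytic_topology euclidean (\<lambda>u. u p)"
  unfolding analytic_topology_def
  by (intro continuous_map_from_subtopology continuous_map_product_projection assms)

lemma continuous_euclidean_uniform_limit:
  fixes f :: "'a \<Rightarrow> 'b::metric_space"
  assumes "\<And>e. e > 0 \<Longrightarrow> \<exists>g. continuous_map Y euclidean g \<and> (\<forall>x\<in>topspace Y. dist (f x) (g x) < e)"
  shows "continuous_map Y euclidean f"
proof -
  have "\<exists>g. continuous_map Y euclidean g \<and> (\<forall>x\<in>topspace Y. dist (f x) (g x) < inverse (Suc n))" for n
    by (rule assms) simp
  then obtain g where g: "\<And>n. continuous_map Y euclidean (g n)"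
    and gf: "\<And>n x. x \<in> topspace Y \<Longrightarrow> dist (f x) (g n x) < inverse (Suc n)" by metis
  have "continuous_map Y Met_TC.mtopology f"
  proof (rule Met_TC.continuous_map_uniform_limit_alt[where F = sequentially and f = g])
    fix e :: real assume "e > 0"
    then have "\<forall>\<^sub>F n in sequentially. inverse (Suc n) < e"
      using LIMSEQ_inverse_real_of_nat by (simp add: order_tendstoD)
    then show "\<forall>\<^sub>F n in sequentially. \<forall>x\<in>topspace Y. dist (g n x) (f x) < e"
      by eventually_elim (metis dist_commute gf less_trans)
  qed (use g in auto)
  then show ?thesis by simp
qed

text \<open>
  The closure of \<open>D\<close> is assumed to be compact and nonempty. This suffices for the properties of the
  function algebra on it and of its Shilov boundary; convexity is an additional hypothesis of
  \<open>proper_ideal_has_zero\<close>.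
\<close>

locale compact_closure =
  fixes D :: "('n::finite, 'd::finite) point set"
  assumes closure_nonempty: "closure_in_spectrum D \<noteq> {}"
    and closure_compact: "compactin analytic_topology (closure_in_spectrum D)"
begin

abbreviation X :: "('n, 'd) point set" where "X \<equiv> closure_in_spectrum D"

abbreviation X_top :: "('n, 'd) point topology" where "X_top \<equiv> subtopology analytic_topology X"

text \<open>
  The uniform limits on the closure \<open>X\<close> of regular functions, as total functions without a
  condition outside \<open>X\<close>. Restriction to \<open>X\<close> maps \<open>R\<close> onto \<^const>\<open>invariant_function_algebra\<close>.
\<close>

definition R :: "(('n, 'd) point \<Rightarrow> complex) set" where
  "R = {f. \<forall>e>0. \<exists>p\<in>invariant_polynomials. \<forall>u\<in>X. cmod (f u - u p) < e}"

lemma X_spectrum: "X \<subseteq> spectrum"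
  using closure_of_subset_topspace topspace_analytic by metis

lemma topspace_X_top: "topspace X_top = X"
  using X_spectrum topspace_analytic by auto

lemma topspace_Int_X [simp]: "topspace analytic_topology \<inter> X = X"
  using topspace_X_top by simp

lemma compact_X_top: "compact_space X_top"
  using closure_compact by (simp add: compact_space_subtopology)

lemma R_D: "f \<in> R \<Longrightarrow> e > 0 \<Longrightarrow> \<exists>p\<in>invariant_polynomials. \<forall>u\<in>X. cmod (f u - u p) < e"
  by (simp add: R_def)

lemma evaluation_continuous_X:
  "p \<in> invariant_polynomials \<Longrightarrow> continuous_map X_top euclidean (\<lambda>u. u p)"
  by (intro continuous_map_from_subtopology continuous_evaluation)

lemma evaluation_mem: "p \<in> invariant_polynomials \<Longrightarrow> (\<lambda>u. u p) \<in> R"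
  unfolding R_def by (auto intro!: bexI[of _ p])

lemma R_cong: "f \<in> R \<Longrightarrow> (\<And>u. u \<in> X \<Longrightarrow> f u = g u) \<Longrightarrow> g \<in> R"
  unfolding R_def by simp

lemma R_continuous: assumes f: "f \<in> R" shows "continuous_map X_top euclidean f"
proof (rule continuous_euclidean_uniform_limit)
  fix e :: real assume "e > 0"
  then obtain p where "p \<in> invariant_polynomials" "\<forall>u\<in>X. cmod (f u - u p) < e"
    using R_D[OF f] by blast
  then show "\<exists>g. continuous_map X_top euclidean g \<and> (\<forall>u\<in>topspace X_top. dist (f u) (g u) < e)"
    unfolding topspace_X_top dist_norm by (intro exI[of _ "\<lambda>u. u p"]) (auto intro: evaluation_continuous_X)
qed

lemma R_bounded: assumes "f \<in> R" shows "\<exists>B. \<forall>u\<in>X. cmod (f u) \<le> B"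
proof -
  have "compactin euclidean (f ` X)"
    using image_compactin[OF _ R_continuous[OF assms], of X] closure_compact by (simp add: compactin_subtopology)
  then have "bounded (f ` X)" by (simp add: compact_imp_bounded)
  then show ?thesis by (auto simp: bounded_iff)
qed

lemma R_const: "(\<lambda>u. c) \<in> R"
  by (rule R_cong[OF evaluation_mem[OF invariant_const]]) (use X_spectrum in \<open>auto simp: spectrum_const\<close>)

lemma R_add: assumes f: "f \<in> R" and g: "g \<in> R" shows "(\<lambda>u. f u + g u) \<in> R"
  unfolding R_def
proof (intro CollectI allI impI)
  fix e :: real assume e: "e > 0"
  obtain p where p: "p \<in> invariant_polynomials" "\<forall>u\<in>X. cmod (f u - u p) < e/2"
    using R_D[OF f, of "e/2"] e by auto
  obtain q where q: "q \<in> invariant_polynomials" "\<forall>u\<in>X. cmod (g u - u q) < e/2"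
    using R_D[OF g, of "e/2"] e by auto
  have "cmod (f u + g u - u (\<lambda>z. p z + q z)) < e" if u: "u \<in> X" for u
  proof -
    have "u (\<lambda>z. p z + q z) = u p + u q" using spectrum_add p q u X_spectrum by blast
    then have "cmod (f u + g u - u (\<lambda>z. p z + q z)) \<le> cmod (f u - u p) + cmod (g u - u q)"
      using norm_triangle_ineq[of "f u - u p" "g u - u q"] by (simp add: algebra_simps)
    then show ?thesis using p(2) q(2) u by fastforce
  qed
  then show "\<exists>p\<in>invariant_polynomials. \<forall>u\<in>X. cmod (f u + g u - u p) < e"
    using invariant_add[OF p(1) q(1)] by (intro bexI[of _ "\<lambda>z. p z + q z"]) auto
qed

lemma R_mult: assumes f: "f \<in> R" and g: "g \<in> R" shows "(\<lambda>u. f u * g u) \<in> R"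
  unfolding R_def
proof (intro CollectI allI impI)
  fix e :: real assume e: "e > 0"
  obtain B where B: "\<And>u. u \<in> X \<Longrightarrow> cmod (g u) \<le> B" using R_bounded[OF g] by blast
  have B0: "B \<ge> 0" using B closure_nonempty by (meson all_not_in_conv norm_ge_zero order_trans)
  obtain p where p: "p \<in> invariant_polynomials" "\<forall>u\<in>X. cmod (f u - u p) < e / (2 * (B + 1))"
    using R_D[OF f, of "e / (2 * (B + 1))"] e B0 by auto
  obtain C where C: "\<And>u. u \<in> X \<Longrightarrow> cmod (u p) \<le> C" using R_bounded[OF evaluation_mem[OF p(1)]] by blast
  have C0: "C \<ge> 0" using C closure_nonempty by (meson all_not_in_conv norm_ge_zero order_trans)
  obtain q where q: "q \<in> invariant_polynomials" "\<forall>u\<in>X. cmod (g u - u q) < e / (2 * (C + 1))"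
    using R_D[OF g, of "e / (2 * (C + 1))"] e C0 by auto
  have "cmod (f u * g u - u (\<lambda>z. p z * q z)) < e" if u: "u \<in> X" for u
  proof -
    have "u (\<lambda>z. p z * q z) = u p * u q" using spectrum_mult p q u X_spectrum by blast
    then have "f u * g u - u (\<lambda>z. p z * q z) = (f u - u p) * g u + u p * (g u - u q)"
      by (simp add: algebra_simps)
    then have "cmod (f u * g u - u (\<lambda>z. p z * q z)) \<le> cmod (f u - u p) * cmod (g u) + cmod (u p) * cmod (g u - u q)"
      using norm_triangle_ineq[of "(f u - u p) * g u" "u p * (g u - u q)"] by (simp add: norm_mult)
    also have "\<dots> \<le> e / (2 * (B + 1)) * B + C * (e / (2 * (C + 1)))"
      using p(2) q(2) u B C e B0 C0 by (intro add_mono mult_mono) (auto intro: less_imp_le)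
    also have "\<dots> < e / 2 + e / 2"
      using e B0 C0 by (intro add_strict_mono) (auto simp: field_simps)
    finally show ?thesis by simp
  qed
  then show "\<exists>p\<in>invariant_polynomials. \<forall>u\<in>X. cmod (f u * g u - u p) < e"
    using invariant_mult[OF p(1) q(1)] by (intro bexI[of _ "\<lambda>z. p z * q z"]) auto
qed

lemma R_complete:
  assumes "\<And>e. e > 0 \<Longrightarrow> \<exists>g\<in>R. \<forall>u\<in>X. cmod (f u - g u) < e"
  shows "f \<in> R"
  unfolding R_def
proof (intro CollectI allI impI)
  fix e :: real assume e: "e > 0"
  obtain g where g: "g \<in> R" "\<forall>u\<in>X. cmod (f u - g u) < e/2" using assms[of "e/2"] e by auto
  obtain p where p: "p \<in> invariant_polynomials" "\<forall>u\<in>X. cmod (g u - u p) < e/2"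
    using R_D[OF g(1), of "e/2"] e by auto
  have "cmod (f u - u p) < e" if "u \<in> X" for u
    using g(2) p(2) that norm_triangle_ineq[of "f u - g u" "g u - u p"] by fastforce
  then show "\<exists>p\<in>invariant_polynomials. \<forall>u\<in>X. cmod (f u - u p) < e" using p(1) by blast
qed

lemma uniform_algebra_R: "uniform_algebra X R"
  by unfold_locales (use closure_nonempty R_const R_add R_mult R_bounded R_complete in auto)

lemma invariant_function_algebra_eq: "invariant_function_algebra D = (\<lambda>f. restrict f X) ` R"
proof -
  let ?C = "cfunspace X_top (euclidean_metric :: complex metric)"
  let ?S = "(\<lambda>p. \<lambda>u\<in>X. u p) ` invariant_polynomials"
  have mspace: "f \<in> mspace ?C \<longleftrightarrow> f \<in> extensional X \<and> continuous_map X_top euclidean f" for f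
    using compactin_mspace_cfunspace[of X_top "euclidean_metric :: complex metric"] compact_X_top
    by (simp add: topspace_X_top compact_space_def mtopology_of_euclidean del: mspace_cfunspace)
  have S: "(\<lambda>u\<in>X. u p) \<in> mspace ?C" if "p \<in> invariant_polynomials" for p
    unfolding mspace using evaluation_continuous_X[OF that]
    by (auto intro: continuous_map_eq simp: topspace_X_top)
  have le: "mdist ?C f g \<le> a \<longleftrightarrow> (\<forall>u\<in>X. cmod (f u - g u) \<le> a)" if "f \<in> mspace ?C" "g \<in> mspace ?C" for f g a
    using cfunspace_mdist_le[OF that] closure_nonempty by (simp add: topspace_X_top dist_norm)
  interpret M: Metric_space "mspace ?C" "mdist ?C" by (rule Metric_space_mspace_mdist)
  have cl: "invariant_function_algebra D = {f \<in> mspace ?C. \<forall>r>0. \<exists>g\<in>?S. g \<in> M.mcball f r}"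
    unfolding invariant_function_algebra_def mtopology_of_def by (rule M.metric_closure_of_alt)
  show ?thesis
  proof (intro equalityI subsetI)
    fix f assume "f \<in> invariant_function_algebra D"
    then have f: "f \<in> mspace ?C" and ap: "\<And>r. r > 0 \<Longrightarrow> \<exists>g\<in>?S. g \<in> M.mcball f r"
      unfolding cl by blast+
    have "f \<in> R" unfolding R_def
    proof (intro CollectI allI impI)
      fix e :: real assume "e > 0"
      then obtain p where p: "p \<in> invariant_polynomials" "(\<lambda>u\<in>X. u p) \<in> M.mcball f (e/2)"
        using ap[of "e/2"] by auto
      then have "\<forall>u\<in>X. cmod (f u - u p) \<le> e/2"
        unfolding M.in_mcball using le[OF f S[OF p(1)], of "e/2"] by simp
      then have "\<forall>u\<in>X. cmod (f u - u p) < e" using \<open>e > 0\<close> by fastforce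
      then show "\<exists>p\<in>invariant_polynomials. \<forall>u\<in>X. cmod (f u - u p) < e" using p(1) by blast
    qed
    moreover have "restrict f X = f" using f mspace by (simp add: extensional_restrict)
    ultimately show "f \<in> (\<lambda>f. restrict f X) ` R" by (metis image_eqI)
  next
    fix f' assume "f' \<in> (\<lambda>f. restrict f X) ` R"
    then obtain f where f: "f \<in> R" "f' = restrict f X" by blast
    have f': "f' \<in> mspace ?C"
      unfolding mspace f(2) using R_continuous[OF f(1)]
      by (auto intro: continuous_map_eq simp: topspace_X_top)
    have "\<exists>g\<in>?S. g \<in> M.mcball f' r" if r: "r > 0" for r
    proof -
      obtain p where p: "p \<in> invariant_polynomials" "\<forall>u\<in>X. cmod (f u - u p) < r"
        using R_D[OF f(1) r] by blast
      then have "mdist ?C f' (\<lambda>u\<in>X. u p) \<le> r"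
        unfolding le[OF f' S[OF p(1)]] using f(2) by (auto intro: less_imp_le)
      then have "(\<lambda>u\<in>X. u p) \<in> M.mcball f' r"
        unfolding M.in_mcball using f' S[OF p(1)] by blast
      then show ?thesis using p(1) by blast
    qed
    then show "f' \<in> invariant_function_algebra D" unfolding cl using f' by blast
  qed
qed

lemma domain_boundary_eq: "domain_boundary D = shilov_boundary X_top R"
proof -
  have "closed_boundary X_top (invariant_function_algebra D) E \<longleftrightarrow> closed_boundary X_top R E" for E
  proof (cases "closedin X_top E")
    case True
    then have "E \<subseteq> X" using closedin_subset topspace_X_top by metis
    then show ?thesis using True
      by (auto simp: closed_boundary_def invariant_function_algebra_eq topspace_X_top subset_iff)
  qed (simp add: closed_boundary_def)
  then show ?thesis by (simp add: shilov_boundary_def)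
qed

text \<open>
  The topology of \<open>X\<close> is the coarsest one for which the regular functions are continuous.
\<close>

lemma X_top_base:
  assumes U: "openin X_top U" and x: "x \<in> U"
  shows "\<exists>G. finite G \<and> G \<subseteq> R \<and>
       x \<in> {y \<in> topspace X_top. \<forall>g\<in>G. cmod (g y) < 1} \<and> {y \<in> topspace X_top. \<forall>g\<in>G. cmod (g y) < 1} \<subseteq> U"
proof -
  have xX: "x \<in> X" using U x openin_subset topspace_X_top by blast
  obtain V where V: "openin (product_topology (\<lambda>_. euclidean) invariant_polynomials) V"
    and UV: "U = V \<inter> spectrum \<inter> X"
    using U unfolding analytic_topology_def openin_subtopology by auto
  obtain W where W: "finite {p \<in> invariant_polynomials. W p \<noteq> UNIV}"
    and Wo: "\<And>p. p \<in> invariant_polynomials \<Longrightarrow> open (W p)"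
    and xW: "x \<in> Pi\<^sub>E invariant_polynomials W" and WV: "Pi\<^sub>E invariant_polynomials W \<subseteq> V"
    using V x UV unfolding openin_product_topology_alt by fastforce
  define J where "J = {p \<in> invariant_polynomials. W p \<noteq> UNIV}"
  have "\<exists>e>0. ball (x p) e \<subseteq> W p" if "p \<in> J" for p
    using Wo[of p] xW that by (auto simp: J_def open_contains_ball PiE_mem)
  then obtain e where e: "\<And>p. p \<in> J \<Longrightarrow> e p > 0" and eW: "\<And>p. p \<in> J \<Longrightarrow> ball (x p) (e p) \<subseteq> W p"
    by metis
  let ?g = "\<lambda>p u. complex_of_real (1 / e p) * (u p + - x p)"
  have gR: "?g p \<in> R" if "p \<in> J" for p
    using that by (intro R_mult R_add R_const evaluation_mem) (simp add: J_def)
  have g1: "cmod (?g p u) < 1 \<longleftrightarrow> u p \<in> ball (x p) (e p)" if "p \<in> J" for p u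
    using e[OF that] by (simp add: norm_mult norm_divide dist_norm norm_minus_commute divide_simps)
  show ?thesis
  proof (intro exI conjI)
    show "finite (?g ` J)" using W by (simp add: J_def)
    show "?g ` J \<subseteq> R" using gR by blast
    show "x \<in> {y \<in> topspace X_top. \<forall>g\<in>?g ` J. cmod (g y) < 1}"
      using xX by (auto simp: topspace_X_top)
    show "{y \<in> topspace X_top. \<forall>g\<in>?g ` J. cmod (g y) < 1} \<subseteq> U"
    proof
      fix y assume "y \<in> {y \<in> topspace X_top. \<forall>g\<in>?g ` J. cmod (g y) < 1}"
      then have y: "y \<in> X" and "\<And>p. p \<in> J \<Longrightarrow> y p \<in> ball (x p) (e p)"
        using g1 by (auto simp only: topspace_X_top mem_Collect_eq ball_simps)
      then have "y p \<in> W p" if "p \<in> invariant_polynomials" for p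
      proof (cases "p \<in> J")
        case True
        then show ?thesis using eW \<open>\<And>p. p \<in> J \<Longrightarrow> y p \<in> ball (x p) (e p)\<close> by blast
      qed (use that in \<open>simp add: J_def\<close>)
      moreover have "y \<in> extensional invariant_polynomials"
        using y X_spectrum by (auto simp: spectrum_def)
      ultimately have "y \<in> Pi\<^sub>E invariant_polynomials W" by (simp add: PiE_iff)
      then show "y \<in> U" using WV UV y X_spectrum by blast
    qed
  qed
qed

lemma domain_boundary_is_boundary: "closed_boundary X_top R (domain_boundary D)"
  unfolding domain_boundary_eq
proof (rule shilov_boundary_is_boundary)
  show "compact_space X_top" by (rule compact_X_top)
  show "topspace X_top \<noteq> {}" using closure_nonempty topspace_X_top by simp
qed (fact R_continuous R_mult R_const X_top_base)+

lemma domain_boundary_subset: "domain_boundary D \<subseteq> X"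
  using domain_boundary_is_boundary closedin_subset topspace_X_top unfolding closed_boundary_def by metis

lemma domain_boundary_nonempty: "domain_boundary D \<noteq> {}"
  using domain_boundary_is_boundary R_const unfolding closed_boundary_def by blast

lemma bounded_by_boundary:
  assumes f: "f \<in> R" and c: "\<And>u. u \<in> domain_boundary D \<Longrightarrow> cmod (f u) \<le> c" and u: "u \<in> X"
  shows "cmod (f u) \<le> c"
proof -
  obtain x where "x \<in> domain_boundary D" "cmod (f u) \<le> cmod (f x)"
    using domain_boundary_is_boundary f u unfolding closed_boundary_def topspace_X_top by blast
  then show ?thesis using c order_trans by blast
qed

text \<open>
  A character of \<open>R\<close>, restricted to the regular functions, is a point \<open>w\<close> of the spectrum, and \<open>w\<close>
  belongs to the hull of \<open>X\<close> as the character is bounded by the supremum norm. This is the only use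
  of convexity: it makes \<open>w\<close> a point of \<open>X\<close>.
\<close>

theorem proper_ideal_has_zero:
  assumes conv: "invariantly_convex X" and K: "uniform_algebra.proper_ideal X R K"
  obtains w where "w \<in> X" "\<And>p. p \<in> invariant_polynomials \<Longrightarrow> (\<lambda>u. u p) \<in> K \<Longrightarrow> w p = 0"
proof -
  interpret uniform_algebra X R by (rule uniform_algebra_R)
  obtain \<xi> where \<xi>: "(\<forall>c. \<xi> (\<lambda>x. c) = c) \<and>
      (\<forall>f\<in>R. \<forall>g\<in>R. \<xi> (\<lambda>x. f x + g x) = \<xi> f + \<xi> g \<and> \<xi> (\<lambda>x. f x * g x) = \<xi> f * \<xi> g) \<and>
      (\<forall>f\<in>R. cmod (\<xi> f) \<le> sup_norm f) \<and> (\<forall>f\<in>K. \<xi> f = 0)"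
    using character_of_proper_ideal[OF K] ..
  have const: "\<xi> (\<lambda>x. c) = c" for c using \<xi> by simp
  have add: "\<xi> (\<lambda>x. f x + g x) = \<xi> f + \<xi> g" if "f \<in> R" "g \<in> R" for f g using \<xi> that by simp
  have mult: "\<xi> (\<lambda>x. f x * g x) = \<xi> f * \<xi> g" if "f \<in> R" "g \<in> R" for f g using \<xi> that by simp
  have norm: "cmod (\<xi> f) \<le> sup_norm f" if "f \<in> R" for f using \<xi> that by simp
  have zero: "\<xi> f = 0" if "f \<in> K" for f using \<xi> that by simp
  have cong: "\<xi> f = \<xi> g" if f: "f \<in> R" and g: "g \<in> R" and eq: "\<And>u. u \<in> X \<Longrightarrow> f u = g u" for f g
  proof -
    have "(\<lambda>u. f u - g u) \<in> K" using ideal_vanishing[OF K] eq by simp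
    then have "\<xi> (\<lambda>u. f u - g u) = 0" by (rule zero)
    moreover have "\<xi> (\<lambda>u. (f u - g u) + g u) = \<xi> (\<lambda>u. f u - g u) + \<xi> g"
      by (intro add diff_mem f g)
    ultimately show ?thesis by simp
  qed
  define w where "w = (\<lambda>p\<in>invariant_polynomials. \<xi> (\<lambda>u. u p))"
  have w: "w p = \<xi> (\<lambda>u. u p)" if "p \<in> invariant_polynomials" for p
    using that by (simp add: w_def)
  have "w \<in> spectrum"
    unfolding spectrum_def
  proof (intro CollectI conjI ballI allI)
    show "w \<in> extensional invariant_polynomials" by (simp add: w_def)
    show "w (\<lambda>z. c) = c" for c
    proof -
      have "\<xi> (\<lambda>u. u (\<lambda>z. c)) = \<xi> (\<lambda>u. c)"
        using X_spectrum by (intro cong evaluation_mem invariant_const R_const) (auto simp: spectrum_const)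
      then show ?thesis using const by (simp add: w invariant_const)
    qed
    fix p q :: "('n, 'd) mats \<Rightarrow> complex" assume p: "p \<in> invariant_polynomials" and q: "q \<in> invariant_polynomials"
    have "\<xi> (\<lambda>u. u (\<lambda>z. p z + q z)) = \<xi> (\<lambda>u. u p + u q)"
      using X_spectrum p q by (intro cong evaluation_mem invariant_add R_add) (auto intro: spectrum_add)
    then show "w (\<lambda>z. p z + q z) = w p + w q"
      using p q by (simp add: w invariant_add add evaluation_mem)
    have "\<xi> (\<lambda>u. u (\<lambda>z. p z * q z)) = \<xi> (\<lambda>u. u p * u q)"
      using X_spectrum p q by (intro cong evaluation_mem invariant_mult R_mult) (auto intro: spectrum_mult)
    then show "w (\<lambda>z. p z * q z) = w p * w q"
      using p q by (simp add: w invariant_mult mult evaluation_mem)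
  qed
  then have "w \<in> invariant_hull X"
    using norm[OF evaluation_mem] unfolding invariant_hull_def sup_norm_def by (simp add: w)
  then have "w \<in> X" using conv by (simp add: invariantly_convex_def)
  then show thesis by (rule that) (simp add: w zero)
qed

end


section \<open>The fibres of the associated bundle\<close>

lemma unitary_invertible:
  assumes "unitary k" shows "invertible k"
  using assms unfolding unitary_def invertible_def by blast

lemma matrix_inv_eqI: "s ** t = mat 1 \<Longrightarrow> matrix_inv s = (t :: complex^'n^'n)"
  by (metis invertible_right_inverse matrix_inv_cancel(1) matrix_mul_assoc matrix_mul_lid matrix_mul_rid)

lemma unitary_inv:
  assumes "unitary k" shows "matrix_inv k = adjoint_mat k"
  using assms by (intro matrix_inv_eqI) (simp add: unitary_def)

lemma adjoint_mat_mult: "adjoint_mat (A ** B) = adjoint_mat B ** adjoint_mat A"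
  by (simp add: adjoint_mat_def matrix_matrix_mult_def vec_eq_iff mult.commute)

lemma adjoint_mat_adjoint [simp]: "adjoint_mat (adjoint_mat A) = A"
  by (simp add: adjoint_mat_def vec_eq_iff)

lemma unitary_adjoint: "unitary k \<Longrightarrow> unitary (adjoint_mat k)"
  by (simp add: unitary_def)

lemma unitary_one: "unitary (mat 1)"
proof -
  have "adjoint_mat (mat 1) = (mat 1 :: complex^'n^'n)"
    by (simp add: adjoint_mat_def mat_def vec_eq_iff)
  then show ?thesis by (simp add: unitary_def)
qed

lemma unitary_mult:
  assumes "unitary k" "unitary l" shows "unitary (k ** l)"
proof -
  have "adjoint_mat l ** (adjoint_mat k ** k) ** l = mat 1" "k ** (l ** adjoint_mat l) ** adjoint_mat k = mat 1"
    using assms by (simp_all add: unitary_def)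
  then show ?thesis by (simp add: unitary_def adjoint_mat_mult matrix_mul_assoc)
qed

lemma conj_mat_unitary: "unitary k \<Longrightarrow> conj_mat k A = adjoint_mat k ** A ** k"
  by (simp add: conj_mat_def unitary_inv)

lemma conj_mat_compose:
  "unitary k \<Longrightarrow> unitary l \<Longrightarrow> conj_mat l (conj_mat k A) = conj_mat (k ** l) A"
  by (simp add: conj_mat_unitary unitary_mult adjoint_mat_mult matrix_mul_assoc)

lemma conj_tuple_compose:
  "unitary k \<Longrightarrow> unitary l \<Longrightarrow> conj_tuple (conj_tuple z k) l = conj_tuple z (k ** l)"
  by (simp add: vec_eq_iff conj_tuple_nth conj_mat_compose)

lemma conj_mat_one [simp]: "conj_mat (mat 1) A = A"
  by (simp add: conj_mat_def matrix_inv_eqI)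

lemma conj_tuple_one [simp]: "conj_tuple z (mat 1) = z"
  by (simp add: vec_eq_iff conj_tuple_nth)

lemma conj_mat_cancel [simp]:
  assumes "unitary k"
  shows "conj_mat (adjoint_mat k) (conj_mat k A) = A" "conj_mat k (conj_mat (adjoint_mat k) A) = A"
  using assms by (simp_all add: conj_mat_compose unitary_adjoint) (simp_all add: unitary_def)

lemma conj_tuple_cancel [simp]:
  assumes "unitary k"
  shows "conj_tuple (conj_tuple z k) (adjoint_mat k) = z"
  using assms by (simp add: vec_eq_iff conj_tuple_nth)

text \<open>
  The stabilizer of a generating tuple acts trivially on all matrices. This makes the fibres of the
  associated bundle copies of the matrix algebra.
\<close>

lemma conj_mat_determined_by_tuple:
  assumes z: "z \<in> generating_tuples" and "invertible k" "invertible l"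
    and eq: "conj_tuple z k = conj_tuple z l"
  shows "conj_mat k A = conj_mat l A"
proof -
  have "A \<in> generated_algebra (range (($) z))" using z by (simp add: generating_tuples_def)
  then show ?thesis
  proof induction
    case (gen A)
    then show ?case using eq by (metis conj_tuple_nth rangeE)
  qed (use assms in \<open>simp_all add: conj_mat_scalar conj_mat_add conj_mat_mult\<close>)
qed

lemma quotient_proj_conj: "invertible s \<Longrightarrow> quotient_proj (conj_tuple z s) = quotient_proj z"
  by (auto simp: quotient_proj_def invariant_polynomials_def restrict_def fun_eq_iff)

lemma quotient_proj_apply: "p \<in> invariant_polynomials \<Longrightarrow> quotient_proj z p = p z"
  by (simp add: quotient_proj_def)

lemma bundle_class_self: "(z, A) \<in> bundle_class z A"
  unfolding bundle_class_def using unitary_one by (force intro!: exI[of _ "mat 1"])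

lemma bundle_class_conj:
  assumes k: "unitary k"
  shows "bundle_class (conj_tuple z k) (conj_mat k A) = bundle_class z A"
proof -
  have sub: "bundle_class (conj_tuple z k) (conj_mat k A) \<subseteq> bundle_class z A" if k: "unitary k" for z k A
  proof
    fix x assume "x \<in> bundle_class (conj_tuple z k) (conj_mat k A)"
    then obtain m where m: "unitary m" and x: "x = (conj_tuple z (k ** m), conj_mat (k ** m) A)"
      using k by (auto simp: bundle_class_def conj_tuple_compose conj_mat_compose)
    show "x \<in> bundle_class z A" unfolding bundle_class_def x using unitary_mult[OF k m] by blast
  qed
  show ?thesis
    using sub[OF k, of z A] sub[OF unitary_adjoint[OF k], of "conj_tuple z k" "conj_mat k A"] k by simp
qed

lemma bundle_class_unique:
  assumes "z \<in> generating_tuples" and "(z, A') \<in> bundle_class z A"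
  shows "A' = A"
proof -
  obtain k where k: "unitary k" "z = conj_tuple z k" "A' = conj_mat k A"
    using assms(2) by (auto simp: bundle_class_def)
  have "conj_tuple z k = conj_tuple z (mat 1)" using k(2) by simp
  then have "conj_mat k A = conj_mat (mat 1) A"
    using assms(1) k(1) unitary_one by (intro conj_mat_determined_by_tuple unitary_invertible)
  then show ?thesis using k(3) by simp
qed

lemma bundle_class_inject:
  "z \<in> generating_tuples \<Longrightarrow> bundle_class z A = bundle_class z B \<longleftrightarrow> A = B"
  using bundle_class_unique bundle_class_self by metis

text \<open>
  The operations on matrices that induce operations on the fibres of the associated bundle.
\<close>

definition unitary_equivariant :: "(complex^'n^'n \<Rightarrow> complex^'n^'n \<Rightarrow> complex^'n^'n) \<Rightarrow> bool" where
  "unitary_equivariant op \<longleftrightarrow>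
     (\<forall>k A B. unitary k \<longrightarrow> conj_mat k (op A B) = op (conj_mat k A) (conj_mat k B))"

lemma unitary_equivariant_ops:
  "unitary_equivariant (+)" "unitary_equivariant (-)" "unitary_equivariant (**)"
  by (simp_all add: unitary_equivariant_def conj_mat_add conj_mat_diff conj_mat_mult unitary_invertible)

lemma fibre_op_bundle_class:
  assumes z: "z \<in> generating_tuples" and op: "unitary_equivariant op"
  shows "fibre_op op (bundle_class z A) (bundle_class z B) = bundle_class z (op A B)"
proof (intro equalityI subsetI)
  fix x assume "x \<in> fibre_op op (bundle_class z A) (bundle_class z B)"
  then obtain k l where k: "unitary k" and l: "unitary l" and eq: "conj_tuple z k = conj_tuple z l"
    and x: "x = (conj_tuple z k, op (conj_mat k A) (conj_mat l B))"
    by (auto simp: fibre_op_def bundle_class_def)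
  have "conj_mat l B = conj_mat k B"
    using conj_mat_determined_by_tuple[OF z _ _ eq] k l unitary_invertible by metis
  then show "x \<in> bundle_class z (op A B)"
    using x k op by (auto simp: bundle_class_def unitary_equivariant_def)
next
  fix x assume "x \<in> bundle_class z (op A B)"
  then obtain k where k: "unitary k" and "x = (conj_tuple z k, conj_mat k (op A B))"
    by (auto simp: bundle_class_def)
  then have x: "x = (conj_tuple z k, op (conj_mat k A) (conj_mat k B))"
    using op by (simp add: unitary_equivariant_def)
  have "(conj_tuple z k, conj_mat k C) \<in> bundle_class z C" for C
    unfolding bundle_class_def using k by blast
  then show "x \<in> fibre_op op (bundle_class z A) (bundle_class z B)"
    unfolding fibre_op_def x by blast
qed

lemma bundle_proj_bundle_class: "bundle_proj (bundle_class z A) = quotient_proj z"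
proof -
  have "quotient_proj ` fst ` bundle_class z A = {quotient_proj z}"
    using bundle_class_self[of z A]
    by (force simp: bundle_class_def quotient_proj_conj unitary_invertible)
  then show ?thesis by (simp add: bundle_proj_def)
qed

lemma matrix_vector_bounded_linear: "bounded_linear ((*v) (A :: complex^'n^'m))"
proof (rule linear_conv_bounded_linear[THEN iffD1], rule linearI)
  show "A *v (x + y) = A *v x + A *v y" for x y by (rule matrix_vector_right_distrib)
  show "A *v (r *\<^sub>R x) = r *\<^sub>R (A *v x)" for r x
    by (simp add: matrix_vector_mult_def vec_eq_iff scaleR_sum_right)
qed

lemma norm_unitary_mult_vec:
  assumes "unitary k" shows "norm (k *v x) = norm x"
proof -
  have adj: "(\<Sum>i\<in>UNIV. (k *v x) $ i * cnj ((k *v x) $ i)) = (\<Sum>j\<in>UNIV. x $ j * cnj ((adjoint_mat k *v (k *v x)) $ j))"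
  proof -
    have "(\<Sum>i\<in>UNIV. (k *v x) $ i * cnj ((k *v x) $ i))
        = (\<Sum>i\<in>UNIV. \<Sum>j\<in>UNIV. x $ j * (k $ i $ j * cnj ((k *v x) $ i)))"
      unfolding matrix_vector_mult_def[of k x] by (simp add: sum_distrib_right mult_ac)
    also have "\<dots> = (\<Sum>j\<in>UNIV. \<Sum>i\<in>UNIV. x $ j * (k $ i $ j * cnj ((k *v x) $ i)))"
      by (rule sum.swap)
    also have "\<dots> = (\<Sum>j\<in>UNIV. x $ j * cnj ((adjoint_mat k *v (k *v x)) $ j))"
      unfolding matrix_vector_mult_def[of "adjoint_mat k"]
      by (simp add: adjoint_mat_def sum_distrib_left)
    finally show ?thesis .
  qed
  have nrm: "complex_of_real ((norm y)\<^sup>2) = (\<Sum>i\<in>UNIV. y $ i * cnj (y $ i))" for y :: "complex^'n"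
    by (simp add: norm_vec_def L2_set_def sum_nonneg complex_norm_square del: of_real_power)
  have "adjoint_mat k *v (k *v x) = x"
    using assms by (simp add: matrix_vector_mul_assoc unitary_def)
  then have "complex_of_real ((norm (k *v x))\<^sup>2) = complex_of_real ((norm x)\<^sup>2)"
    unfolding nrm adj by simp
  then have "(norm (k *v x))\<^sup>2 = (norm x)\<^sup>2" by (simp only: of_real_eq_iff)
  then show ?thesis by simp
qed

lemma onorm_conj_mat:
  assumes k: "unitary k" shows "onorm ((*v) (conj_mat k A)) = onorm ((*v) A)"
proof -
  have le: "onorm ((*v) (conj_mat l B)) \<le> onorm ((*v) B)" if l: "unitary l" for l B
  proof (rule onorm_bound)
    show "0 \<le> onorm ((*v) B)" using matrix_vector_bounded_linear by (rule onorm_pos_le)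
    fix x
    have "norm (conj_mat l B *v x) = norm (adjoint_mat l *v (B *v (l *v x)))"
      using l by (simp add: conj_mat_unitary matrix_vector_mul_assoc matrix_mul_assoc)
    also have "\<dots> = norm (B *v (l *v x))"
      using l by (intro norm_unitary_mult_vec unitary_adjoint)
    also have "\<dots> \<le> onorm ((*v) B) * norm (l *v x)"
      using matrix_vector_bounded_linear by (rule onorm)
    finally show "norm (conj_mat l B *v x) \<le> onorm ((*v) B) * norm x"
      using l by (simp add: norm_unitary_mult_vec)
  qed
  show ?thesis
    using le[OF k, of A] le[OF unitary_adjoint[OF k], of "conj_mat k A"] k by simp
qed

lemma fibre_norm_bundle_class: "fibre_norm (bundle_class z A) = onorm ((*v) A)"
proof -
  have "(\<lambda>(z, A). onorm ((*v) A)) ` bundle_class z A = {onorm ((*v) A)}"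
    using bundle_class_self[of z A] by (force simp: bundle_class_def onorm_conj_mat)
  then show ?thesis by (simp add: fibre_norm_def)
qed

text \<open>
  The operator norm and the norm of the type \<^typ>\<open>complex^'n^'n\<close> are equivalent; the constants
  below are not sharp.
\<close>

lemma norm_entry_le: "cmod (A $ i $ j) \<le> norm (A :: complex^'n^'m)"
  by (rule order_trans[OF Finite_Cartesian_Product.norm_nth_le Finite_Cartesian_Product.norm_nth_le])

lemma norm_le_sum_entries: "norm (A :: complex^'n^'m) \<le> (\<Sum>i\<in>UNIV. \<Sum>j\<in>UNIV. cmod (A $ i $ j))"
proof -
  have "norm A \<le> (\<Sum>i\<in>UNIV. norm (A $ i))" unfolding norm_vec_def[of A] by (rule L2_set_le_sum) simp
  also have "\<dots> \<le> (\<Sum>i\<in>UNIV. \<Sum>j\<in>UNIV. cmod (A $ i $ j))"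
    by (intro sum_mono) (auto simp: norm_vec_def intro: L2_set_le_sum)
  finally show ?thesis .
qed

lemma norm_le_onorm: "norm (A :: complex^'n^'n) \<le> (real CARD('n))\<^sup>2 * onorm ((*v) A)"
proof -
  have "cmod (A $ i $ j) \<le> onorm ((*v) A)" for i j
  proof -
    have "A $ i $ j = (A *v axis j 1) $ i"
      by (simp add: matrix_vector_mult_def axis_def if_distrib cong: if_cong)
    also have "cmod \<dots> \<le> norm (A *v axis j 1)" by (rule Finite_Cartesian_Product.norm_nth_le)
    also have "\<dots> \<le> onorm ((*v) A) * norm (axis j (1::complex))"
      using matrix_vector_bounded_linear by (rule onorm)
    also have "norm (axis j (1::complex) :: complex^'n) = 1"
      by (rule norm_Basis) (simp add: axis_in_Basis_iff Basis_complex_def)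
    finally show ?thesis by simp
  qed
  then have "(\<Sum>i\<in>UNIV. \<Sum>j\<in>UNIV. cmod (A $ i $ j)) \<le> (\<Sum>i\<in>(UNIV::'n set). \<Sum>j\<in>(UNIV::'n set). onorm ((*v) A))"
    by (intro sum_mono)
  then show ?thesis using norm_le_sum_entries[of A] by (simp add: power2_eq_square)
qed

lemma norm_matrix_mult_le: "norm (A ** B) \<le> (real CARD('n))^3 * (norm A * norm (B :: complex^'n^'n))"
  for A :: "complex^'n^'n"
proof -
  have "cmod ((A ** B) $ i $ j) \<le> (\<Sum>k\<in>(UNIV::'n set). norm A * norm B)" for i j
  proof -
    have "cmod (\<Sum>k\<in>UNIV. A $ i $ k * B $ k $ j) \<le> (\<Sum>k\<in>(UNIV::'n set). norm A * norm B)"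
      by (intro sum_norm_le) (simp add: norm_mult mult_mono norm_entry_le)
    then show ?thesis by (simp add: matrix_matrix_mult_def)
  qed
  then have "(\<Sum>i\<in>UNIV. \<Sum>j\<in>UNIV. cmod ((A ** B) $ i $ j))
      \<le> (\<Sum>i\<in>(UNIV::'n set). \<Sum>j\<in>(UNIV::'n set). \<Sum>k\<in>(UNIV::'n set). norm A * norm B)"
    by (intro sum_mono)
  then show ?thesis using norm_le_sum_entries[of "A ** B"] by (simp add: power3_eq_cube)
qed

lemma onorm_le_norm: "onorm ((*v) A) \<le> (real CARD('n))\<^sup>2 * norm (A :: complex^'n^'n)"
proof (rule onorm_bound)
  fix x :: "complex^'n"
  have "cmod ((A *v x) $ i) \<le> (\<Sum>j\<in>(UNIV::'n set). norm A * norm x)" for i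
  proof -
    have "cmod (\<Sum>j\<in>UNIV. A $ i $ j * x $ j) \<le> (\<Sum>j\<in>(UNIV::'n set). norm A * norm x)"
      by (intro sum_norm_le)
        (simp add: norm_mult mult_mono norm_entry_le Finite_Cartesian_Product.norm_nth_le)
    then show ?thesis by (simp add: matrix_vector_mult_def)
  qed
  then have "(\<Sum>i\<in>UNIV. cmod ((A *v x) $ i)) \<le> (\<Sum>i\<in>(UNIV::'n set). \<Sum>j\<in>(UNIV::'n set). norm A * norm x)"
    by (intro sum_mono)
  moreover have "norm (A *v x) \<le> (\<Sum>i\<in>UNIV. cmod ((A *v x) $ i))"
    unfolding norm_vec_def by (rule L2_set_le_sum) simp
  ultimately show "norm (A *v x) \<le> (real CARD('n))\<^sup>2 * norm A * norm x"
    by (simp add: power2_eq_square mult_ac)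
qed simp

lemma norm_trace_le: "cmod (trace A) \<le> real CARD('n) * norm (A :: complex^'n^'n)"
proof -
  have "cmod (trace A) \<le> (\<Sum>i\<in>(UNIV::'n set). norm A)"
    unfolding trace_def by (intro sum_norm_le norm_entry_le)
  then show ?thesis by simp
qed

lemma continuous_onorm: "continuous_on UNIV (\<lambda>A :: complex^'n^'n. onorm ((*v) A))"
proof -
  have le: "onorm ((*v) A) \<le> onorm ((*v) B) + (real CARD('n))\<^sup>2 * norm (A - B)" for A B :: "complex^'n^'n"
  proof -
    have "(\<lambda>x. A *v x) = (\<lambda>x. B *v x + (A - B) *v x)"
      by (simp add: matrix_vector_mult_add_rdistrib[symmetric] fun_eq_iff)
    then have "onorm ((*v) A) \<le> onorm ((*v) B) + onorm ((*v) (A - B))"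
      using onorm_triangle[OF matrix_vector_bounded_linear[of B] matrix_vector_bounded_linear[of "A - B"]] by simp
    then show ?thesis using onorm_le_norm[of "A - B"] by linarith
  qed
  show ?thesis
  proof (rule continuous_onI)
    fix A :: "complex^'n^'n" and e :: real assume e: "e > 0"
    show "\<exists>d>0. \<forall>B\<in>UNIV. dist B A < d \<longrightarrow> dist (onorm ((*v) B)) (onorm ((*v) A)) \<le> e"
    proof (intro exI[of _ "e / (real CARD('n))\<^sup>2"] conjI ballI impI)
      fix B :: "complex^'n^'n" assume "dist B A < e / (real CARD('n))\<^sup>2"
      then have "(real CARD('n))\<^sup>2 * norm (B - A) \<le> e" by (simp add: dist_norm field_simps)
      then show "dist (onorm ((*v) B)) (onorm ((*v) A)) \<le> e"
        using le[of A B] le[of B A] by (simp add: dist_real_def norm_minus_commute abs_le_iff)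
    qed (use e in simp)
  qed
qed

lemma topspace_bundle_topology: "topspace (bundle_topology P) = bundle_space P"
proof (intro equalityI)
  show "topspace (bundle_topology P) \<subseteq> bundle_space P"
    using openin_bundle_topology openin_topspace by blast
  have "{x \<in> P \<times> UNIV. case_prod bundle_class x \<in> bundle_space P} = P \<times> UNIV"
    by (auto simp: bundle_space_def)
  then have "openin (bundle_topology P) (bundle_space P)"
    unfolding openin_bundle_topology by simp
  then show "bundle_space P \<subseteq> topspace (bundle_topology P)" by (rule openin_subset)
qed

lemma continuous_map_bundle_class:
  "continuous_map (top_of_set (P \<times> UNIV)) (bundle_topology P) (case_prod bundle_class)"
  unfolding continuous_map_def
  by (auto simp: topspace_bundle_topology openin_bundle_topology bundle_space_def)

lemma continuous_map_fibre_norm: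
  fixes P :: "('n::finite, 'd::finite) mats set"
  shows "continuous_map (bundle_topology P) euclideanreal fibre_norm"
  unfolding continuous_map_def
proof (intro conjI allI impI)
  fix U :: "real set" assume U: "openin euclidean U"
  have "continuous_on (P \<times> UNIV) (\<lambda>x :: ('n, 'd) mats \<times> (complex^'n^'n). onorm ((*v) (snd x)))"
    by (rule continuous_on_compose2[OF continuous_onorm continuous_on_snd[OF continuous_on_id]]) simp
  then have "openin (top_of_set (P \<times> UNIV))
      {x \<in> P \<times> (UNIV :: (complex^'n^'n) set). onorm ((*v) (snd x)) \<in> U}"
    using U continuous_openin_preimage_gen by (fastforce simp: vimage_def Int_def)
  moreover have "{x \<in> P \<times> UNIV. case_prod bundle_class x \<in> {c \<in> topspace (bundle_topology P). fibre_norm c \<in> U}}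
      = {x \<in> P \<times> UNIV. onorm ((*v) (snd x)) \<in> U}"
    by (auto simp: topspace_bundle_topology bundle_space_def fibre_norm_bundle_class)
  ultimately show "openin (bundle_topology P) {c \<in> topspace (bundle_topology P). fibre_norm c \<in> U}"
    unfolding openin_bundle_topology by (auto simp: topspace_bundle_topology)
qed simp


section \<open>Sections as equivariant matrix functions\<close>

lemma polynomial_continuous: "p \<in> polynomial_functions \<Longrightarrow> continuous_on UNIV p"
  by (induction rule: polynomial_functions.induct) (auto intro!: continuous_intros)

lemma trace_algebra_continuous:
  assumes "\<phi> \<in> trace_algebra" shows "continuous_on UNIV \<phi>"
proof -
  have "continuous_on UNIV (\<lambda>z. \<chi> a b. \<phi> z $ a $ b)"
    using assms by (intro continuous_on_vec_lambda polynomial_continuous trace_algebra_polynomial)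
  then show ?thesis by simp
qed

lemma norm_mat_le: "norm (mat c :: complex^'n^'n) \<le> real CARD('n) * cmod c"
proof -
  have "(\<Sum>i\<in>UNIV. \<Sum>j\<in>UNIV. cmod ((mat c :: complex^'n^'n) $ i $ j)) = (\<Sum>i\<in>(UNIV::'n set). cmod c)"
    by (intro sum.cong refl) (simp add: mat_def if_distrib cong: if_cong)
  then show ?thesis using norm_le_sum_entries[of "mat c :: complex^'n^'n"] by simp
qed

lemma norm_conj_mat_le:
  assumes "unitary k"
  shows "norm (conj_mat k A) \<le> (real CARD('n))^4 * norm (A :: complex^'n^'n)"
proof -
  have "norm (conj_mat k A) \<le> (real CARD('n))\<^sup>2 * onorm ((*v) (conj_mat k A))" by (rule norm_le_onorm)
  also have "onorm ((*v) (conj_mat k A)) = onorm ((*v) A)" using assms by (rule onorm_conj_mat)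
  also have "(real CARD('n))\<^sup>2 * onorm ((*v) A) \<le> (real CARD('n))\<^sup>2 * ((real CARD('n))\<^sup>2 * norm A)"
    by (intro mult_left_mono onorm_le_norm) simp
  finally show ?thesis by (simp add: power_add[symmetric] mult.assoc[symmetric])
qed

text \<open>
  The closure of \<open>D\<close> is compact, nonempty and convex, and \<open>P\<close> is the total space of a reduction
  over it.
\<close>

locale tracial_setting = compact_closure D
  for D :: "('n::finite, 'd::finite) point set" +
  fixes P :: "('n, 'd) mats set"
  assumes is_reduction: "reduction D P"
    and convex: "invariantly_convex (closure_in_spectrum D)"
begin

abbreviation B :: "('n, 'd) point set" where "B \<equiv> domain_boundary D"

text \<open>
  The part of the reduced bundle over the Shilov boundary \<open>B\<close>.
\<close>

definition PB :: "('n, 'd) mats set" where "PB = {z \<in> P. quotient_proj z \<in> B}"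

text \<open>
  The section given by an equivariant matrix function on \<open>PB\<close>.
\<close>

abbreviation sec :: "(('n, 'd) mats \<Rightarrow> complex^'n^'n) \<Rightarrow> ('n, 'd) point \<Rightarrow> ('n, 'd) bundle_point" where
  "sec \<equiv> section_of P B"

text \<open>
  The uniform limits on \<open>PB\<close> of elements of the trace algebra, as total functions. They are
  continuous and equivariant on \<open>PB\<close>, and the tracial function algebra consists of their sections.
\<close>

definition T :: "(('n, 'd) mats \<Rightarrow> complex^'n^'n) set" where
  "T = {a. \<forall>e>0. \<exists>\<phi>\<in>trace_algebra. \<forall>z\<in>PB. norm (a z - \<phi> z) < e}"

lemma P_compact: "compact P"
  using is_reduction by (simp add: reduction_def)

lemma P_generating: "z \<in> P \<Longrightarrow> z \<in> generating_tuples"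
  using is_reduction by (auto simp: reduction_def)

lemma P_conj: "z \<in> P \<Longrightarrow> unitary k \<Longrightarrow> conj_tuple z k \<in> P"
  using is_reduction by (auto simp: reduction_def)

lemma quotient_map_P: "quotient_map (top_of_set P) X_top quotient_proj"
  using is_reduction by (simp add: reduction_def)

lemma quotient_proj_P: "quotient_proj ` P = X"
  using quotient_imp_surjective_map[OF quotient_map_P] by (simp add: topspace_X_top)

lemma P_orbit:
  assumes "z \<in> P" "w \<in> P" "quotient_proj z = quotient_proj w"
  obtains k where "unitary k" "w = conj_tuple z k"
  using is_reduction assms by (auto simp: reduction_def)

lemma PB_P: "z \<in> PB \<Longrightarrow> z \<in> P"
  by (simp add: PB_def)

lemma PB_B: "z \<in> PB \<Longrightarrow> quotient_proj z \<in> B"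
  by (simp add: PB_def)

lemma PB_X: "z \<in> PB \<Longrightarrow> quotient_proj z \<in> X"
  using PB_B domain_boundary_subset by blast

lemma PB_generating: "z \<in> PB \<Longrightarrow> z \<in> generating_tuples"
  by (simp add: PB_def P_generating)

lemma PB_conj: "z \<in> PB \<Longrightarrow> unitary k \<Longrightarrow> conj_tuple z k \<in> PB"
  by (simp add: PB_def P_conj quotient_proj_conj unitary_invertible)

lemma PB_over:
  assumes "u \<in> B" obtains z where "z \<in> PB" "quotient_proj z = u"
proof -
  have "u \<in> quotient_proj ` P" using assms domain_boundary_subset quotient_proj_P by blast
  then show thesis using assms that by (auto simp: PB_def)
qed

lemma T_D: "a \<in> T \<Longrightarrow> e > 0 \<Longrightarrow> \<exists>\<phi>\<in>trace_algebra. \<forall>z\<in>PB. norm (a z - \<phi> z) < e"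
  by (simp add: T_def)

lemma T_trace_algebra: "\<phi> \<in> trace_algebra \<Longrightarrow> \<phi> \<in> T"
  unfolding T_def by (auto intro!: bexI[of _ \<phi>])

lemma T_const: "(\<lambda>z. mat c) \<in> T"
  by (intro T_trace_algebra trace_algebra_const)

lemma T_zero: "(\<lambda>z. 0) \<in> T"
  using T_const[of 0] by (simp add: mat_0)

lemma trace_algebra_bounded:
  assumes "\<phi> \<in> trace_algebra"
  obtains C where "C \<ge> 0" "\<And>z. z \<in> P \<Longrightarrow> norm (\<phi> z) \<le> C"
proof -
  have "compact (\<phi> ` P)"
    using P_compact continuous_on_subset[OF trace_algebra_continuous[OF assms]]
    by (intro compact_continuous_image) auto
  then obtain C where C: "\<forall>x\<in>\<phi> ` P. norm x \<le> C" using compact_imp_bounded bounded_iff by metis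
  then have "norm (\<phi> z) \<le> \<bar>C\<bar>" if "z \<in> P" for z using that by force
  then show thesis using that[of "\<bar>C\<bar>"] by simp
qed

lemma T_bounded:
  assumes "a \<in> T" obtains C where "C \<ge> 0" "\<And>z. z \<in> PB \<Longrightarrow> norm (a z) \<le> C"
proof -
  obtain \<phi> where \<phi>: "\<phi> \<in> trace_algebra" "\<forall>z\<in>PB. norm (a z - \<phi> z) < 1" using T_D[OF assms, of 1] by auto
  obtain C where C: "C \<ge> 0" "\<And>z. z \<in> P \<Longrightarrow> norm (\<phi> z) \<le> C" using trace_algebra_bounded[OF \<phi>(1)] by blast
  have "norm (a z) \<le> C + 1" if z: "z \<in> PB" for z
    using \<phi>(2) C(2)[OF PB_P[OF z]] z norm_triangle_ineq[of "a z - \<phi> z" "\<phi> z"] by fastforce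
  then show thesis using that[of "C + 1"] C(1) by simp
qed

lemma T_add: assumes a: "a \<in> T" and b: "b \<in> T" shows "(\<lambda>z. a z + b z) \<in> T"
  unfolding T_def
proof (intro CollectI allI impI)
  fix e :: real assume e: "e > 0"
  obtain \<phi> where \<phi>: "\<phi> \<in> trace_algebra" "\<forall>z\<in>PB. norm (a z - \<phi> z) < e/2" using T_D[OF a, of "e/2"] e by auto
  obtain \<psi> where \<psi>: "\<psi> \<in> trace_algebra" "\<forall>z\<in>PB. norm (b z - \<psi> z) < e/2" using T_D[OF b, of "e/2"] e by auto
  have "norm (a z + b z - (\<phi> z + \<psi> z)) < e" if z: "z \<in> PB" for z
    using \<phi>(2) \<psi>(2) z norm_triangle_ineq[of "a z - \<phi> z" "b z - \<psi> z"] by (fastforce simp: algebra_simps)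
  then show "\<exists>\<phi>\<in>trace_algebra. \<forall>z\<in>PB. norm (a z + b z - \<phi> z) < e"
    using trace_algebra_add[OF \<phi>(1) \<psi>(1)] by (intro bexI[of _ "\<lambda>z. \<phi> z + \<psi> z"]) auto
qed

lemma T_mult: assumes a: "a \<in> T" and b: "b \<in> T" shows "(\<lambda>z. a z ** b z) \<in> T"
  unfolding T_def
proof (intro CollectI allI impI)
  fix e :: real assume e: "e > 0"
  define N where "N = (real CARD('n))^3"
  have N: "N > 0" by (simp add: N_def)
  obtain C where C: "C \<ge> 0" "\<And>z. z \<in> PB \<Longrightarrow> norm (b z) \<le> C" using T_bounded[OF b] by blast
  obtain \<phi> where \<phi>: "\<phi> \<in> trace_algebra" "\<forall>z\<in>PB. norm (a z - \<phi> z) < e / (2 * N * (C + 1))"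
    using T_D[OF a, of "e / (2 * N * (C + 1))"] e C N by auto
  obtain C' where C': "C' \<ge> 0" "\<And>z. z \<in> P \<Longrightarrow> norm (\<phi> z) \<le> C'" using trace_algebra_bounded[OF \<phi>(1)] by blast
  obtain \<psi> where \<psi>: "\<psi> \<in> trace_algebra" "\<forall>z\<in>PB. norm (b z - \<psi> z) < e / (2 * N * (C' + 1))"
    using T_D[OF b, of "e / (2 * N * (C' + 1))"] e C' N by auto
  have "norm (a z ** b z - \<phi> z ** \<psi> z) < e" if z: "z \<in> PB" for z
  proof -
    have "a z ** b z - \<phi> z ** \<psi> z = (a z - \<phi> z) ** b z + \<phi> z ** (b z - \<psi> z)"
      by (simp add: matrix_matrix_mult_def vec_eq_iff sum.distrib sum_subtractf algebra_simps)
    then have "norm (a z ** b z - \<phi> z ** \<psi> z) \<le> norm ((a z - \<phi> z) ** b z) + norm (\<phi> z ** (b z - \<psi> z))"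
      by (simp only: norm_triangle_ineq)
    also have "\<dots> \<le> N * (norm (a z - \<phi> z) * norm (b z)) + N * (norm (\<phi> z) * norm (b z - \<psi> z))"
      unfolding N_def by (intro add_mono norm_matrix_mult_le)
    also have "\<dots> \<le> N * (e / (2 * N * (C + 1)) * C) + N * (C' * (e / (2 * N * (C' + 1))))"
      using \<phi>(2) \<psi>(2) z C C' e N PB_P[OF z]
      by (intro add_mono mult_left_mono mult_mono) (auto intro: less_imp_le)
    also have "\<dots> = e/2 * (C / (C + 1)) + e/2 * (C' / (C' + 1))" using N by simp
    also have "\<dots> < e/2 * 1 + e/2 * 1"
      using e C(1) C'(1) by (intro add_strict_mono mult_strict_left_mono) auto
    finally show ?thesis by simp
  qed
  then show "\<exists>\<phi>\<in>trace_algebra. \<forall>z\<in>PB. norm (a z ** b z - \<phi> z) < e"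
    using trace_algebra_mult[OF \<phi>(1) \<psi>(1)] by (intro bexI[of _ "\<lambda>z. \<phi> z ** \<psi> z"]) auto
qed

lemma T_uminus: "a \<in> T \<Longrightarrow> (\<lambda>z. - a z) \<in> T"
proof -
  assume a: "a \<in> T"
  have "mat (-1) ** A = - A" for A :: "complex^'n^'n" by (simp add: mat_mult_left vec_eq_iff)
  then show ?thesis using T_mult[OF T_const[of "-1"] a] by simp
qed

lemma T_scalar:
  assumes f: "f \<in> R" shows "(\<lambda>z. mat (f (quotient_proj z))) \<in> T"
  unfolding T_def
proof (intro CollectI allI impI)
  fix e :: real assume e: "e > 0"
  obtain p where p: "p \<in> invariant_polynomials" "\<forall>u\<in>X. cmod (f u - u p) < e / real CARD('n)"
    using R_D[OF f, of "e / real CARD('n)"] e by auto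
  have "norm (mat (f (quotient_proj z)) - mat (p z) :: complex^'n^'n) < e" if z: "z \<in> PB" for z
  proof -
    have "mat (f (quotient_proj z)) - mat (p z) = (mat (f (quotient_proj z) - p z) :: complex^'n^'n)"
      using mat_add[of "f (quotient_proj z) - p z" "p z"] by (simp add: algebra_simps)
    then have "norm (mat (f (quotient_proj z)) - mat (p z) :: complex^'n^'n)
        \<le> real CARD('n) * cmod (f (quotient_proj z) - p z)" by (simp only: norm_mat_le)
    also have "\<dots> < real CARD('n) * (e / real CARD('n))"
      using p(2) PB_X[OF z] quotient_proj_apply[OF p(1), of z] by (intro mult_strict_left_mono) auto
    finally show ?thesis by simp
  qed
  then show "\<exists>\<phi>\<in>trace_algebra. \<forall>z\<in>PB. norm (mat (f (quotient_proj z)) - \<phi> z) < e"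
    using trace_algebra_invariant[OF p(1)] by (intro bexI[of _ "\<lambda>z. mat (p z)"]) auto
qed

lemma T_equivariant:
  assumes a: "a \<in> T" and z: "z \<in> PB" and k: "unitary k"
  shows "a (conj_tuple z k) = conj_mat k (a z)"
proof -
  define N where "N = (real CARD('n))^4"
  have N: "N \<ge> 0" by (simp add: N_def)
  have "norm (a (conj_tuple z k) - conj_mat k (a z)) \<le> 0 + e" if e: "e > 0" for e
  proof -
    obtain \<phi> where \<phi>: "\<phi> \<in> trace_algebra" "\<forall>z\<in>PB. norm (a z - \<phi> z) < e / (1 + N)"
      using T_D[OF a, of "e / (1 + N)"] e N by auto
    have eq: "\<phi> (conj_tuple z k) = conj_mat k (\<phi> z)"
      using trace_algebra_equivariant[OF \<phi>(1)] k unitary_invertible by blast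
    have "a (conj_tuple z k) - conj_mat k (a z)
        = (a (conj_tuple z k) - \<phi> (conj_tuple z k)) - conj_mat k (a z - \<phi> z)"
      by (simp add: eq conj_mat_diff)
    then have "norm (a (conj_tuple z k) - conj_mat k (a z))
        \<le> norm (a (conj_tuple z k) - \<phi> (conj_tuple z k)) + norm (conj_mat k (a z - \<phi> z))"
      by (simp only: norm_triangle_ineq4)
    also have "\<dots> \<le> e / (1 + N) + N * (e / (1 + N))"
    proof (rule add_mono)
      show "norm (a (conj_tuple z k) - \<phi> (conj_tuple z k)) \<le> e / (1 + N)"
        using \<phi>(2) PB_conj[OF z k] by (auto intro: less_imp_le)
      have "norm (conj_mat k (a z - \<phi> z)) \<le> N * norm (a z - \<phi> z)"
        unfolding N_def using k by (rule norm_conj_mat_le)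
      also have "\<dots> \<le> N * (e / (1 + N))" using \<phi>(2) z N by (intro mult_left_mono) (auto intro: less_imp_le)
      finally show "norm (conj_mat k (a z - \<phi> z)) \<le> N * (e / (1 + N))" .
    qed
    also have "\<dots> = (1 + N) * (e / (1 + N))" by (simp only: distrib_right mult_1_left)
    also have "\<dots> = e" using N by simp
    finally show ?thesis by simp
  qed
  then have "norm (a (conj_tuple z k) - conj_mat k (a z)) \<le> 0" by (rule field_le_epsilon)
  then show ?thesis by simp
qed

lemma T_continuous:
  assumes a: "a \<in> T" shows "continuous_on PB a"
proof -
  have "continuous_map (top_of_set PB) euclidean a"
  proof (rule continuous_euclidean_uniform_limit)
    fix e :: real assume "e > 0"
    then obtain \<phi> where \<phi>: "\<phi> \<in> trace_algebra" "\<forall>z\<in>PB. norm (a z - \<phi> z) < e" using T_D[OF a] by blast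
    have "continuous_on PB \<phi>" using trace_algebra_continuous[OF \<phi>(1)] continuous_on_subset by blast
    then show "\<exists>g. continuous_map (top_of_set PB) euclidean g \<and> (\<forall>x\<in>topspace (top_of_set PB). dist (a x) (g x) < e)"
      using \<phi>(2) by (intro exI[of _ \<phi>]) (simp add: dist_norm)
  qed
  then show ?thesis by simp
qed

text \<open>
  The section of every \<open>a\<close> is evaluated at the same point \<open>z\<close> over \<open>u\<close>, so identities between
  sections can be checked there without equivariance.
\<close>

lemma section_choice:
  assumes "u \<in> B"
  obtains z where "z \<in> PB" "quotient_proj z = u" "\<And>a. sec a u = bundle_class z (a z)"
proof -
  define z where "z = (SOME z. z \<in> P \<and> quotient_proj z = u)"
  have "\<exists>z. z \<in> P \<and> quotient_proj z = u" using PB_over[OF assms] PB_P by metis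
  then have "z \<in> P \<and> quotient_proj z = u" unfolding z_def by (rule someI_ex)
  then show thesis
    using assms by (intro that[of z]) (auto simp: PB_def section_of_def z_def Let_def)
qed

lemma sec_over:
  assumes a: "\<And>z k. z \<in> PB \<Longrightarrow> unitary k \<Longrightarrow> a (conj_tuple z k) = conj_mat k (a z)" and z: "z \<in> PB"
  shows "sec a (quotient_proj z) = bundle_class z (a z)"
proof -
  obtain w where w: "w \<in> PB" "quotient_proj w = quotient_proj z"
    and sec: "\<And>a. sec a (quotient_proj z) = bundle_class w (a w)"
    using section_choice[OF PB_B[OF z]] by metis
  obtain k where k: "unitary k" "z = conj_tuple w k"
    using P_orbit[OF PB_P[OF w(1)] PB_P[OF z] w(2)] .
  then show ?thesis using a[OF w(1) k(1)] bundle_class_conj[OF k(1)] sec by metis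
qed

lemma sec_T: "a \<in> T \<Longrightarrow> z \<in> PB \<Longrightarrow> sec a (quotient_proj z) = bundle_class z (a z)"
  by (rule sec_over[OF T_equivariant])

lemma sec_extensional: "sec a \<in> extensional B"
  by (simp add: section_of_def)

lemma sec_cong: assumes "\<And>z. z \<in> PB \<Longrightarrow> a z = b z" shows "sec a = sec b"
proof (rule extensionalityI[OF sec_extensional sec_extensional])
  fix u assume "u \<in> B"
  then obtain z where "z \<in> PB" "\<And>a. sec a u = bundle_class z (a z)" using section_choice by metis
  then show "sec a u = sec b u" using assms by simp
qed

lemma sec_inject:
  assumes "a \<in> T" "b \<in> T" "sec a = sec b" "z \<in> PB" shows "a z = b z"
  using sec_T[OF assms(1,4)] sec_T[OF assms(2,4)] assms(3) bundle_class_inject[OF PB_generating[OF assms(4)]]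
  by metis

lemma section_op_sec:
  assumes "unitary_equivariant op"
  shows "section_op B op (sec a) (sec b) = sec (\<lambda>z. op (a z) (b z))"
proof (rule extensionalityI[OF _ sec_extensional])
  show "section_op B op (sec a) (sec b) \<in> extensional B" by (simp add: section_op_def)
  fix u assume u: "u \<in> B"
  then obtain z where "z \<in> PB" "\<And>a. sec a u = bundle_class z (a z)" using section_choice by metis
  then show "section_op B op (sec a) (sec b) u = sec (\<lambda>z. op (a z) (b z)) u"
    using u fibre_op_bundle_class[OF PB_generating assms] by (simp add: section_op_def)
qed

lemma section_norm_le:
  assumes "\<And>z. z \<in> PB \<Longrightarrow> onorm ((*v) (a z)) \<le> e" shows "section_norm B (sec a) \<le> e"
  unfolding section_norm_def
proof (rule cSUP_least)
  show "B \<noteq> {}" by (rule domain_boundary_nonempty)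
  fix u assume "u \<in> B"
  then obtain z where "z \<in> PB" "\<And>a. sec a u = bundle_class z (a z)" using section_choice by metis
  then show "fibre_norm (sec a u) \<le> e" using assms by (simp add: fibre_norm_bundle_class)
qed

lemma sec_continuous_section:
  assumes a: "a \<in> T" shows "sec a \<in> continuous_sections P B"
  unfolding continuous_sections_def
proof (intro CollectI conjI ballI)
  show "sec a \<in> extensional B" by (rule sec_extensional)
  show "bundle_proj (sec a u) = u" if "u \<in> B" for u
    using section_choice[OF that] bundle_proj_bundle_class by metis
  have quot: "quotient_map (top_of_set PB) (subtopology analytic_topology B) quotient_proj"
  proof -
    have "closedin X_top B" using domain_boundary_is_boundary by (simp add: closed_boundary_def)
    then have "quotient_map (subtopology (top_of_set P) PB) (subtopology X_top B) quotient_proj"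
      by (intro quotient_map_restriction[OF quotient_map_P]) (auto simp: PB_def)
    moreover have "P \<inter> PB = PB" "X \<inter> B = B" using domain_boundary_subset by (auto simp: PB_def)
    ultimately show ?thesis by (simp add: subtopology_subtopology)
  qed
  show "continuous_map (subtopology analytic_topology B) (bundle_topology P) (sec a)"
  proof (rule continuous_compose_quotient_map[OF quot])
    have "continuous_map (top_of_set PB) (top_of_set (P \<times> UNIV)) (\<lambda>z. (z, a z))"
      using T_continuous[OF a] PB_P by (auto intro!: continuous_intros)
    then have "continuous_map (top_of_set PB) (bundle_topology P) (case_prod bundle_class \<circ> (\<lambda>z. (z, a z)))"
      using continuous_map_bundle_class by (rule continuous_map_compose)
    then show "continuous_map (top_of_set PB) (bundle_topology P) (sec a \<circ> quotient_proj)"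
      by (rule continuous_map_eq) (simp add: sec_T[OF a])
  qed
qed

lemma continuous_section_representative:
  assumes \<sigma>: "\<sigma> \<in> continuous_sections P B"
  obtains a where "\<sigma> = sec a" "\<And>z. z \<in> PB \<Longrightarrow> \<sigma> (quotient_proj z) = bundle_class z (a z)"
proof -
  have "\<exists>A. \<sigma> (quotient_proj z) = bundle_class z A" if z: "z \<in> PB" for z
  proof -
    have "\<sigma> (quotient_proj z) \<in> topspace (bundle_topology P)"
      using \<sigma> PB_B[OF z] PB_X[OF z] X_spectrum
      by (auto simp: continuous_sections_def continuous_map_def topspace_analytic Pi_iff)
    then obtain w A where w: "w \<in> P" "\<sigma> (quotient_proj z) = bundle_class w A"
      unfolding topspace_bundle_topology bundle_space_def by blast
    have "bundle_proj (\<sigma> (quotient_proj z)) = quotient_proj z"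
      using \<sigma> PB_B[OF z] by (simp add: continuous_sections_def)
    then have "quotient_proj w = quotient_proj z" using w(2) bundle_proj_bundle_class by metis
    then obtain k where "unitary k" "z = conj_tuple w k" using P_orbit[OF w(1) PB_P[OF z]] by blast
    then show ?thesis using w(2) bundle_class_conj by metis
  qed
  then obtain a where a: "\<And>z. z \<in> PB \<Longrightarrow> \<sigma> (quotient_proj z) = bundle_class z (a z)" by metis
  have "\<sigma> = sec a"
  proof (rule extensionalityI[OF _ sec_extensional])
    show "\<sigma> \<in> extensional B" using \<sigma> by (simp add: continuous_sections_def)
    fix u assume "u \<in> B"
    then obtain z where "z \<in> PB" "quotient_proj z = u" "\<And>a. sec a u = bundle_class z (a z)"
      using section_choice by metis
    then show "\<sigma> u = sec a u" using a by metis
  qed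
  then show thesis using that a by blast
qed

lemma fibre_norm_bounded:
  assumes "\<sigma> \<in> continuous_sections P B"
  obtains C where "\<And>u. u \<in> B \<Longrightarrow> fibre_norm (\<sigma> u) \<le> C"
proof -
  have cont: "continuous_map (subtopology analytic_topology B) (bundle_topology P) \<sigma>"
    using assms by (simp add: continuous_sections_def)
  have "closedin X_top B" using domain_boundary_is_boundary by (simp add: closed_boundary_def)
  then have "compactin X_top B" using compact_X_top closedin_compact_space by blast
  then have "compactin (subtopology analytic_topology B) B"
    using domain_boundary_subset by (simp add: compactin_subtopology)
  then have "compactin euclideanreal ((fibre_norm \<circ> \<sigma>) ` B)"
    using continuous_map_compose[OF cont continuous_map_fibre_norm] by (rule image_compactin)
  then have "bounded ((fibre_norm \<circ> \<sigma>) ` B)" by (simp add: compact_imp_bounded)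
  then obtain C where "\<forall>x\<in>(fibre_norm \<circ> \<sigma>) ` B. norm x \<le> C" by (auto simp: bounded_iff)
  then show thesis using that[of C] by force
qed

text \<open>
  Continuity of a section in the tracial function algebra only serves to make its fibre norm
  bounded, so that the supremum in \<^const>\<open>section_norm\<close> is a bound at every point.
\<close>

theorem tracial_function_algebra_eq: "tracial_function_algebra D P = sec ` T"
proof (intro equalityI subsetI)
  fix \<sigma> assume "\<sigma> \<in> tracial_function_algebra D P"
  then have \<sigma>: "\<sigma> \<in> continuous_sections P B"
    and ap: "\<And>e. e > 0 \<Longrightarrow> \<exists>\<phi>\<in>trace_algebra. section_norm B (section_op B (-) \<sigma> (sec \<phi>)) < e"
    by (auto simp: tracial_function_algebra_def)
  obtain a where a: "\<sigma> = sec a" "\<And>z. z \<in> PB \<Longrightarrow> \<sigma> (quotient_proj z) = bundle_class z (a z)"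
    using continuous_section_representative[OF \<sigma>] by blast
  obtain C where C: "\<And>u. u \<in> B \<Longrightarrow> fibre_norm (\<sigma> u) \<le> C" using fibre_norm_bounded[OF \<sigma>] by blast
  define N where "N = (real CARD('n))\<^sup>2"
  have N: "N > 0" by (simp add: N_def)
  have "a \<in> T" unfolding T_def
  proof (intro CollectI allI impI)
    fix e :: real assume e: "e > 0"
    then obtain \<phi> where \<phi>: "\<phi> \<in> trace_algebra" "section_norm B (section_op B (-) \<sigma> (sec \<phi>)) < e / (2 * N)"
      using ap[of "e / (2 * N)"] N by auto
    obtain C' where C': "\<And>z. z \<in> P \<Longrightarrow> norm (\<phi> z) \<le> C'" using trace_algebra_bounded[OF \<phi>(1)] by blast
    have le: "onorm ((*v) (a z - \<phi> z)) \<le> e / (2 * N)" if z: "z \<in> PB" for z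
    proof -
      have val: "section_op B (-) \<sigma> (sec \<phi>) (quotient_proj z) = bundle_class z (a z - \<phi> z)" if z: "z \<in> PB" for z
        using PB_B[OF z] a(2)[OF z] sec_T[OF T_trace_algebra[OF \<phi>(1)] z]
          fibre_op_bundle_class[OF PB_generating[OF z] unitary_equivariant_ops(2)]
        by (simp add: section_op_def)
      have "fibre_norm (section_op B (-) \<sigma> (sec \<phi>) u) \<le> C + N * C'" if u: "u \<in> B" for u
      proof -
        obtain w where w: "w \<in> PB" "quotient_proj w = u" using PB_over[OF u] .
        have "(\<lambda>x. (a w - \<phi> w) *v x) = (\<lambda>x. a w *v x + (- \<phi> w) *v x)"
          by (simp add: matrix_vector_mult_add_rdistrib[symmetric] fun_eq_iff)
        then have "onorm ((*v) (a w - \<phi> w)) \<le> onorm ((*v) (a w)) + onorm ((*v) (- \<phi> w))"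
          using onorm_triangle[OF matrix_vector_bounded_linear[of "a w"] matrix_vector_bounded_linear[of "- \<phi> w"]]
          by simp
        also have "onorm ((*v) (a w)) \<le> C"
          using C[OF u] a(2)[OF w(1)] w(2) by (simp add: fibre_norm_bundle_class)
        also have "onorm ((*v) (- \<phi> w)) \<le> N * C'"
        proof -
          have "onorm ((*v) (- \<phi> w)) \<le> N * norm (- \<phi> w)" unfolding N_def by (rule onorm_le_norm)
          also have "\<dots> \<le> N * C'" using C'[OF PB_P[OF w(1)]] N by (intro mult_left_mono) auto
          finally show ?thesis .
        qed
        finally show ?thesis using val[OF w(1)] w(2) by (simp add: fibre_norm_bundle_class)
      qed
      then have "bdd_above ((\<lambda>u. fibre_norm (section_op B (-) \<sigma> (sec \<phi>) u)) ` B)"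
        by (auto simp: bdd_above_def)
      then have "fibre_norm (section_op B (-) \<sigma> (sec \<phi>) (quotient_proj z)) \<le> section_norm B (section_op B (-) \<sigma> (sec \<phi>))"
        unfolding section_norm_def using PB_B[OF z] by (intro cSUP_upper)
      then show ?thesis using val[OF z] \<phi>(2) by (simp add: fibre_norm_bundle_class)
    qed
    have "norm (a z - \<phi> z) < e" if z: "z \<in> PB" for z
    proof -
      have "norm (a z - \<phi> z) \<le> N * onorm ((*v) (a z - \<phi> z))" unfolding N_def by (rule norm_le_onorm)
      also have "\<dots> \<le> N * (e / (2 * N))" using le[OF z] N by (intro mult_left_mono) auto
      also have "\<dots> < e" using N e by simp
      finally show ?thesis .
    qed
    then show "\<exists>\<phi>\<in>trace_algebra. \<forall>z\<in>PB. norm (a z - \<phi> z) < e"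
      using \<phi>(1) by blast
  qed
  then show "\<sigma> \<in> sec ` T" using a(1) by blast
next
  fix \<sigma> assume "\<sigma> \<in> sec ` T"
  then obtain a where a: "a \<in> T" "\<sigma> = sec a" by blast
  define N where "N = (real CARD('n))\<^sup>2"
  have N: "N > 0" by (simp add: N_def)
  have "\<exists>\<phi>\<in>trace_algebra. section_norm B (section_op B (-) \<sigma> (sec \<phi>)) < e" if e: "e > 0" for e
  proof -
    obtain \<phi> where \<phi>: "\<phi> \<in> trace_algebra" "\<forall>z\<in>PB. norm (a z - \<phi> z) < e / (2 * N)"
      using T_D[OF a(1), of "e / (2 * N)"] e N by auto
    have "section_norm B (sec (\<lambda>z. a z - \<phi> z)) \<le> e / 2"
    proof (rule section_norm_le)
      fix z assume z: "z \<in> PB"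
      have "onorm ((*v) (a z - \<phi> z)) \<le> N * norm (a z - \<phi> z)" unfolding N_def by (rule onorm_le_norm)
      also have "\<dots> \<le> N * (e / (2 * N))" using \<phi>(2) z N by (intro mult_left_mono) (auto intro: less_imp_le)
      also have "\<dots> = e / 2" using N by simp
      finally show "onorm ((*v) (a z - \<phi> z)) \<le> e / 2" .
    qed
    then show ?thesis
      using \<phi>(1) e a(2) section_op_sec[OF unitary_equivariant_ops(2), of a \<phi>]
      by (intro bexI[of _ \<phi>]) auto
  qed
  then show "\<sigma> \<in> tracial_function_algebra D P"
    using sec_continuous_section[OF a(1)] a(2) by (simp add: tracial_function_algebra_def)
qed

end


section \<open>The correspondence of ideals\<close>

lemma (in ring) idealI_mult_closed:
  assumes sub: "I \<subseteq> carrier R" and zero: "\<zero> \<in> I"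
    and add: "\<And>x y. x \<in> I \<Longrightarrow> y \<in> I \<Longrightarrow> x \<oplus> y \<in> I"
    and left: "\<And>x y. x \<in> carrier R \<Longrightarrow> y \<in> I \<Longrightarrow> x \<otimes> y \<in> I"
    and right: "\<And>x y. x \<in> carrier R \<Longrightarrow> y \<in> I \<Longrightarrow> y \<otimes> x \<in> I"
  shows "ideal I R"
proof (rule idealI)
  show "ring R" by (rule ring_axioms)
  show "subgroup I (add_monoid R)"
  proof (rule subgroup.intro)
    fix x assume x: "x \<in> I"
    then have "(\<ominus> \<one>) \<otimes> x \<in> I" by (intro left) auto
    moreover have "(\<ominus> \<one>) \<otimes> x = \<ominus> x" using x sub by (simp add: l_minus subset_iff)
    ultimately show "inv\<^bsub>add_monoid R\<^esub> x \<in> I" by (simp add: a_inv_def)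
  qed (use assms in auto)
qed (use left right in auto)

context tracial_setting
begin

abbreviation res :: "(('n, 'd) point \<Rightarrow> complex) \<Rightarrow> ('n, 'd) point \<Rightarrow> complex" where
  "res f \<equiv> restrict f X"

text \<open>
  A function on \<open>X\<close>, pulled back to a function with values in the scalar matrices.
\<close>

definition scalar :: "(('n, 'd) point \<Rightarrow> complex) \<Rightarrow> ('n, 'd) mats \<Rightarrow> complex^'n^'n" where
  "scalar f z = mat (f (quotient_proj z))"

text \<open>
  The two rings of the correspondence. Their elements are written as \<open>res f\<close> with \<open>f\<close> in \<open>R\<close> and as
  \<open>sec a\<close> with \<open>a\<close> in \<open>T\<close>.
\<close>

abbreviation RR where "RR \<equiv> invariant_function_ring D"
abbreviation SS where "SS \<equiv> tracial_function_ring D P"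

lemma carrier_RR: "carrier RR = res ` R"
  by (simp add: invariant_function_ring_def invariant_function_algebra_eq)

lemma ops_RR:
  "res f \<otimes>\<^bsub>RR\<^esub> res g = res (\<lambda>u. f u * g u)" "res f \<oplus>\<^bsub>RR\<^esub> res g = res (\<lambda>u. f u + g u)"
  "\<one>\<^bsub>RR\<^esub> = res (\<lambda>u. 1)" "\<zero>\<^bsub>RR\<^esub> = res (\<lambda>u. 0)"
  by (auto simp: invariant_function_ring_def fun_eq_iff)

lemma carrier_SS: "carrier SS = sec ` T"
  by (simp add: tracial_function_ring_def tracial_function_algebra_eq)

lemma ops_SS:
  "sec a \<otimes>\<^bsub>SS\<^esub> sec b = sec (\<lambda>z. a z ** b z)" "sec a \<oplus>\<^bsub>SS\<^esub> sec b = sec (\<lambda>z. a z + b z)"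
  "\<one>\<^bsub>SS\<^esub> = sec (\<lambda>z. mat 1)" "\<zero>\<^bsub>SS\<^esub> = sec (\<lambda>z. 0)"
  by (simp_all add: tracial_function_ring_def section_op_sec unitary_equivariant_ops)

lemma ring_RR: "ring RR"
proof (rule ringI)
  show "abelian_group RR"
  proof (rule abelian_groupI)
    fix x assume "x \<in> carrier RR"
    then obtain f where f: "f \<in> R" "x = res f" by (auto simp: carrier_RR)
    have "res (\<lambda>u. (-1) * f u) \<in> carrier RR"
      unfolding carrier_RR using R_mult[OF R_const f(1)] by (rule imageI)
    moreover have "res (\<lambda>u. (-1) * f u) \<oplus>\<^bsub>RR\<^esub> x = \<zero>\<^bsub>RR\<^esub>" by (simp add: f(2) ops_RR)
    ultimately show "\<exists>y\<in>carrier RR. y \<oplus>\<^bsub>RR\<^esub> x = \<zero>\<^bsub>RR\<^esub>" by blast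
  qed (auto simp: carrier_RR ops_RR add_ac intro!: imageI R_add R_const)
  show "Group.monoid RR"
    by (rule monoidI) (auto simp: carrier_RR ops_RR mult.assoc intro!: imageI R_mult R_const)
qed (auto simp: carrier_RR ops_RR algebra_simps)

lemma ring_SS: "ring SS"
proof (rule ringI)
  show "abelian_group SS"
  proof (rule abelian_groupI)
    fix x assume "x \<in> carrier SS"
    then obtain a where a: "a \<in> T" "x = sec a" by (auto simp: carrier_SS)
    have "sec (\<lambda>z. - a z) \<in> carrier SS" unfolding carrier_SS using T_uminus[OF a(1)] by (rule imageI)
    moreover have "sec (\<lambda>z. - a z) \<oplus>\<^bsub>SS\<^esub> x = \<zero>\<^bsub>SS\<^esub>" by (simp add: a(2) ops_SS)
    ultimately show "\<exists>y\<in>carrier SS. y \<oplus>\<^bsub>SS\<^esub> x = \<zero>\<^bsub>SS\<^esub>" by blast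
  qed (auto simp: carrier_SS ops_SS add_ac intro!: imageI T_add T_zero)
  show "Group.monoid SS"
    by (rule monoidI) (auto simp: carrier_SS ops_SS matrix_mul_assoc intro!: imageI T_mult T_const)
qed (auto simp: carrier_SS ops_SS matrix_add_ldistrib matrix_add_distrib_right)

lemma scalar_T: "f \<in> R \<Longrightarrow> scalar f \<in> T"
  unfolding scalar_def[abs_def] by (rule T_scalar)

lemma scalar_section_res: "scalar_section D P (res f) = sec (scalar f)"
  unfolding scalar_section_def by (rule sec_cong) (simp add: scalar_def PB_X)

lemma ideal_RR_add: "ideal I RR \<Longrightarrow> res f \<in> I \<Longrightarrow> res g \<in> I \<Longrightarrow> res (\<lambda>u. f u + g u) \<in> I"
  using additive_subgroup.a_closed[OF ideal.axioms(1), of I RR "res f" "res g"] by (simp add: ops_RR)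

lemma ideal_RR_mult: "ideal I RR \<Longrightarrow> f \<in> R \<Longrightarrow> res g \<in> I \<Longrightarrow> res (\<lambda>u. f u * g u) \<in> I"
  using ideal.I_l_closed[of I RR "res g" "res f"] by (simp add: ops_RR carrier_RR)

lemma ideal_RR_elem: assumes "ideal I RR" "x \<in> I" obtains f where "f \<in> R" "x = res f"
  using ideal.Icarr[OF assms] by (auto simp: carrier_RR)

lemma ideal_SS_add: "ideal J SS \<Longrightarrow> sec a \<in> J \<Longrightarrow> sec b \<in> J \<Longrightarrow> sec (\<lambda>z. a z + b z) \<in> J"
  using additive_subgroup.a_closed[OF ideal.axioms(1), of J SS "sec a" "sec b"] by (simp add: ops_SS)

lemma ideal_SS_left: "ideal J SS \<Longrightarrow> b \<in> T \<Longrightarrow> sec a \<in> J \<Longrightarrow> sec (\<lambda>z. b z ** a z) \<in> J"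
  using ideal.I_l_closed[of J SS "sec a" "sec b"] by (simp add: ops_SS carrier_SS)

lemma ideal_SS_right: "ideal J SS \<Longrightarrow> b \<in> T \<Longrightarrow> sec a \<in> J \<Longrightarrow> sec (\<lambda>z. a z ** b z) \<in> J"
  using ideal.I_r_closed[of J SS "sec a" "sec b"] by (simp add: ops_SS carrier_SS)

lemma ideal_SS_zero: "ideal J SS \<Longrightarrow> sec (\<lambda>z. 0) \<in> J"
  using additive_subgroup.zero_closed[OF ideal.axioms(1), of J SS] by (simp add: ops_SS)

lemma ideal_SS_elem: assumes "ideal J SS" "x \<in> J" obtains a where "a \<in> T" "x = sec a"
  using ideal.Icarr[OF assms] by (auto simp: carrier_SS)

lemma ideal_SS_sum:
  assumes "ideal J SS" "\<And>k. k \<in> K \<Longrightarrow> sec (a k) \<in> J"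
  shows "sec (\<lambda>z. \<Sum>k\<in>K. a k z) \<in> J"
  using assms(2) ideal_SS_zero[OF assms(1)]
  by (induction K rule: infinite_finite_induct) (auto intro: ideal_SS_add[OF assms(1)])

text \<open>
  The trace of a section over the Shilov boundary \<open>B\<close> extends to a member of \<open>R\<close>. If \<open>a\<close> is the
  uniform limit on \<open>PB\<close> of \<open>\<phi> m\<close>, then the invariants \<open>p m = trace (\<phi> m)\<close> form a uniform Cauchy
  sequence on \<open>B\<close>, hence also on \<open>X\<close>, because \<open>B\<close> is a boundary for \<open>R\<close>.
\<close>

theorem trace_T:
  assumes a: "a \<in> T"
  obtains h where "h \<in> R" "\<And>z. z \<in> PB \<Longrightarrow> h (quotient_proj z) = trace (a z)"
proof -
  define N where "N = real CARD('n)"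
  have N: "N > 0" by (simp add: N_def)
  have "\<exists>\<phi>\<in>trace_algebra. \<forall>z\<in>PB. norm (a z - \<phi> z) < inverse (Suc m)" for m
    using T_D[OF a, of "inverse (Suc m)"] by simp
  then obtain \<phi> where \<phi>: "\<And>m. \<phi> m \<in> trace_algebra"
    and ap: "\<And>m z. z \<in> PB \<Longrightarrow> norm (a z - \<phi> m z) < inverse (Suc m)" by metis
  define p where "p m z = trace (\<phi> m z)" for m z
  have p: "p m \<in> invariant_polynomials" for m
    unfolding p_def[abs_def] using \<phi> by (rule trace_algebra_trace)
  have near: "cmod (trace (a z) - p m z) \<le> N * inverse (Suc m)" if z: "z \<in> PB" for m z
  proof -
    have "cmod (trace (a z - \<phi> m z)) \<le> N * norm (a z - \<phi> m z)" unfolding N_def by (rule norm_trace_le)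
    also have "\<dots> \<le> N * inverse (Suc m)" using ap[OF z, of m] N by (intro mult_left_mono) auto
    finally show ?thesis by (simp add: trace_sub p_def)
  qed
  have cauchy: "cmod (u (p m) - u (p k)) \<le> N * inverse (Suc m) + N * inverse (Suc k)"
    if u: "u \<in> X" for u m k
  proof -
    have pR: "(\<lambda>u. u (p m) + (-1) * u (p k)) \<in> R" by (intro R_add R_mult R_const evaluation_mem p)
    have "cmod (u (p m) + (-1) * u (p k)) \<le> N * inverse (Suc m) + N * inverse (Suc k)"
    proof (rule bounded_by_boundary[OF pR _ u])
      fix v assume "v \<in> B"
      then obtain z where z: "z \<in> PB" "quotient_proj z = v" by (rule PB_over)
      have "cmod (p m z - p k z) \<le> cmod (trace (a z) - p m z) + cmod (trace (a z) - p k z)"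
        using norm_triangle_ineq4[of "trace (a z) - p k z" "trace (a z) - p m z"] by simp
      also have "\<dots> \<le> N * inverse (Suc m) + N * inverse (Suc k)"
        using near[OF z(1)] by (intro add_mono)
      finally show "cmod (v (p m) + (-1) * v (p k)) \<le> N * inverse (Suc m) + N * inverse (Suc k)"
        using z(2) quotient_proj_apply[OF p, of z] by auto
    qed
    then show ?thesis by simp
  qed
  have small: "\<exists>M. \<forall>m\<ge>M. N * inverse (Suc m) < e" if e: "e > 0" for e
  proof -
    obtain M where "inverse (real (Suc M)) < e / N" using reals_Archimedean[of "e / N"] e N by auto
    then have M: "N * inverse (Suc M) < e" using N by (simp add: field_simps)
    have "N * inverse (Suc m) < e" if "m \<ge> M" for m
    proof -
      have "N * inverse (Suc m) \<le> N * inverse (Suc M)"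
        using that N by (intro mult_left_mono le_imp_inverse_le) auto
      with M show ?thesis by simp
    qed
    then show ?thesis by blast
  qed
  define h :: "('n, 'd) point \<Rightarrow> complex" where "h u = lim (\<lambda>m. u (p m))" for u
  have lim: "(\<lambda>m. u (p m)) \<longlonglongrightarrow> h u" if u: "u \<in> X" for u
  proof -
    have "Cauchy (\<lambda>m. u (p m))"
    proof (rule CauchyI)
      fix e :: real assume "e > 0"
      then obtain M where M: "\<And>m. m \<ge> M \<Longrightarrow> N * inverse (Suc m) < e/2" using small[of "e/2"] by auto
      have "cmod (u (p m) - u (p k)) < e" if "m \<ge> M" "k \<ge> M" for m k
        using cauchy[OF u, of m k] M[OF that(1)] M[OF that(2)] by linarith
      then show "\<exists>M. \<forall>m\<ge>M. \<forall>k\<ge>M. cmod (u (p m) - u (p k)) < e" by blast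
    qed
    then show ?thesis unfolding h_def using Cauchy_convergent_iff convergent_LIMSEQ_iff by blast
  qed
  have hR: "h \<in> R" unfolding R_def
  proof (intro CollectI allI impI)
    fix e :: real assume "e > 0"
    then obtain M where M: "\<And>m. m \<ge> M \<Longrightarrow> N * inverse (Suc m) < e/3" using small[of "e/3"] by auto
    have "cmod (h u - u (p M)) < e" if u: "u \<in> X" for u
    proof -
      have "(\<lambda>k. cmod (u (p k) - u (p M))) \<longlonglongrightarrow> cmod (h u - u (p M))"
        by (intro tendsto_intros lim u)
      moreover have "cmod (u (p k) - u (p M)) \<le> e/3 + e/3" if "k \<ge> M" for k
        using cauchy[OF u, of k M] M[OF that] M[OF order_refl] by linarith
      ultimately have "cmod (h u - u (p M)) \<le> e/3 + e/3" by (intro LIMSEQ_le_const2) auto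
      then show ?thesis using \<open>e > 0\<close> by simp
    qed
    then show "\<exists>p\<in>invariant_polynomials. \<forall>u\<in>X. cmod (h u - u p) < e" using p by blast
  qed
  have "h (quotient_proj z) = trace (a z)" if z: "z \<in> PB" for z
  proof -
    have "(\<lambda>m. p m z) \<longlonglongrightarrow> h (quotient_proj z)"
      using lim[OF PB_X[OF z]] quotient_proj_apply[OF p, of z] by simp
    moreover have "(\<lambda>m. p m z) \<longlonglongrightarrow> trace (a z)"
    proof (rule LIMSEQ_I)
      fix e :: real assume "e > 0"
      then obtain M where M: "\<And>m. m \<ge> M \<Longrightarrow> N * inverse (Suc m) < e" using small by blast
      have "cmod (p m z - trace (a z)) < e" if "m \<ge> M" for m
        using near[OF z, of m] M[OF that] by (simp add: norm_minus_commute)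
      then show "\<exists>M. \<forall>m\<ge>M. norm (p m z - trace (a z)) < e" by blast
    qed
    ultimately show ?thesis by (rule LIMSEQ_unique)
  qed
  then show thesis using that hR by blast
qed

text \<open>
  Membership in an ideal may be tested locally: the functions \<open>f\<close> with \<open>f * a\<close> in \<open>J\<close> form an ideal
  of \<open>R\<close>, and the regular functions in it have no common zero in \<open>X\<close>, so it contains the
  constant \<open>1\<close>.
\<close>

theorem ideal_membership_local:
  assumes J: "ideal J SS" and a: "a \<in> T"
    and loc: "\<And>z0. z0 \<in> P \<Longrightarrow> \<exists>p\<in>invariant_polynomials. p z0 \<noteq> 0 \<and> sec (\<lambda>z. mat (p z) ** a z) \<in> J"
  shows "sec a \<in> J"
proof (rule ccontr)
  assume notin: "sec a \<notin> J"
  define K where "K = {f \<in> R. sec (\<lambda>z. scalar f z ** a z) \<in> J}"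
  have "uniform_algebra.proper_ideal X R K"
    unfolding uniform_algebra.proper_ideal_def[OF uniform_algebra_R]
  proof (intro conjI ballI allI impI)
    show "K \<subseteq> R" by (auto simp: K_def)
    show "(\<lambda>u. 1) \<notin> K" using notin by (simp add: K_def scalar_def)
  next
    fix f g assume "f \<in> K" "g \<in> K"
    then have f: "f \<in> R" "sec (\<lambda>z. scalar f z ** a z) \<in> J" and g: "g \<in> R" "sec (\<lambda>z. scalar g z ** a z) \<in> J"
      by (auto simp: K_def)
    have "scalar (\<lambda>u. f u + g u) z ** a z = scalar f z ** a z + scalar g z ** a z" for z
      by (simp add: scalar_def mat_mult_left vec_eq_iff distrib_right)
    then show "(\<lambda>u. f u + g u) \<in> K"
      using ideal_SS_add[OF J f(2) g(2)] R_add[OF f(1) g(1)] by (simp add: K_def)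
  next
    fix f g assume f: "f \<in> R" and "g \<in> K"
    then have g: "g \<in> R" "sec (\<lambda>z. scalar g z ** a z) \<in> J" by (auto simp: K_def)
    have "scalar (\<lambda>u. f u * g u) z ** a z = scalar f z ** (scalar g z ** a z)" for z
      by (simp add: scalar_def mat_mult matrix_mul_assoc)
    then show "(\<lambda>u. f u * g u) \<in> K"
      using ideal_SS_left[OF J scalar_T[OF f] g(2)] R_mult[OF f g(1)] by (simp add: K_def)
  next
    fix f :: "('n, 'd) point \<Rightarrow> complex" assume f: "\<forall>u\<in>X. f u = 0"
    have "f \<in> R" by (rule R_cong[OF R_const[of 0]]) (use f in auto)
    moreover have "sec (\<lambda>z. scalar f z ** a z) = sec (\<lambda>z. 0)"
      by (rule sec_cong) (use f PB_X in \<open>simp add: scalar_def mat_mult_left vec_eq_iff\<close>)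
    ultimately show "f \<in> K" using ideal_SS_zero[OF J] by (simp add: K_def)
  qed
  then obtain w where w: "w \<in> X" and zero: "\<And>p. p \<in> invariant_polynomials \<Longrightarrow> (\<lambda>u. u p) \<in> K \<Longrightarrow> w p = 0"
    using proper_ideal_has_zero[OF convex] by blast
  obtain z0 where z0: "z0 \<in> P" "w = quotient_proj z0" using w quotient_proj_P by blast
  obtain p where p: "p \<in> invariant_polynomials" "p z0 \<noteq> 0" "sec (\<lambda>z. mat (p z) ** a z) \<in> J"
    using loc[OF z0(1)] by blast
  have "(\<lambda>u. u p) \<in> K"
    using p evaluation_mem by (simp add: K_def scalar_def quotient_proj_apply)
  then show False using zero p z0(2) by (simp add: quotient_proj_apply)
qed

text \<open>
  Up to a factor \<open>p\<close> that does not vanish at a given tuple \<open>z0\<close>, the trace of \<open>a\<close> is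
  \<open>\<Sum>k. w k ** a ** v k\<close>, which belongs to \<open>J\<close> together with \<open>a\<close>.
\<close>

lemma trace_mem_ideal:
  assumes J: "ideal J SS" and a: "a \<in> T" "sec a \<in> J"
    and h: "h \<in> R" "\<And>z. z \<in> PB \<Longrightarrow> h (quotient_proj z) = trace (a z)"
  shows "sec (scalar h) \<in> J"
proof (rule ideal_membership_local[OF J scalar_T[OF h(1)]])
  fix z0 assume "z0 \<in> P"
  obtain p :: "('n, 'd) mats \<Rightarrow> complex" and w v :: "'n \<times> 'n \<Rightarrow> ('n, 'd) mats \<Rightarrow> complex^'n^'n"
    where p: "p \<in> invariant_polynomials" "p z0 \<noteq> 0"
      and w: "\<And>k. w k \<in> trace_algebra" and v: "\<And>k. v k \<in> trace_algebra"
      and id: "\<And>z A. (\<Sum>k\<in>UNIV. w k z ** A ** v k z) = mat (p z * trace A)"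
    using casimir_element_exists[OF P_generating[OF \<open>z0 \<in> P\<close>]] by blast
  have "sec (\<lambda>z. mat (p z) ** scalar h z) = sec (\<lambda>z. \<Sum>k\<in>UNIV. w k z ** a z ** v k z)"
    by (rule sec_cong) (simp add: id scalar_def h(2) mat_mult)
  also have "\<dots> \<in> J"
    by (intro ideal_SS_sum[OF J] ideal_SS_right[OF J] ideal_SS_left[OF J] a T_trace_algebra w v)
  finally show "\<exists>p\<in>invariant_polynomials. p z0 \<noteq> 0 \<and> sec (\<lambda>z. mat (p z) ** scalar h z) \<in> J"
    using p by blast
qed

lemma scalar_section_image_mult:
  "x \<in> scalar_section D P ` I \<Longrightarrow> s \<in> carrier SS \<Longrightarrow> x \<otimes>\<^bsub>SS\<^esub> s \<in> extended_ideal D P I"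
  unfolding extended_ideal_def by (rule ideal_prod.prod)

text \<open>
  Every element of the extended ideal is the section of some \<open>a\<close> in \<open>T\<close> which inherits each property
  \<open>Q\<close> that holds for the products and is preserved by sums.
\<close>

lemma extended_ideal_induct [consumes 2, case_names prod sum]:
  assumes I: "ideal I RR" and x: "x \<in> extended_ideal D P I"
    and prod: "\<And>f s. f \<in> R \<Longrightarrow> res f \<in> I \<Longrightarrow> s \<in> T \<Longrightarrow> Q (\<lambda>z. scalar f z ** s z)"
    and sum: "\<And>a b. a \<in> T \<Longrightarrow> b \<in> T \<Longrightarrow> sec a \<in> extended_ideal D P I \<Longrightarrow> sec b \<in> extended_ideal D P I \<Longrightarrow>
      Q a \<Longrightarrow> Q b \<Longrightarrow> Q (\<lambda>z. a z + b z)"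
  obtains a where "a \<in> T" "x = sec a" "Q a"
proof -
  have "x \<in> extended_ideal D P I \<and> (\<exists>a\<in>T. x = sec a \<and> Q a)"
    using x unfolding extended_ideal_def
  proof (induction rule: ideal_prod.induct)
    case (prod i j)
    obtain i' where "i' \<in> I" "i = scalar_section D P i'" using prod by blast
    moreover obtain f where "f \<in> R" "i' = res f" using ideal_RR_elem[OF I \<open>i' \<in> I\<close>] .
    ultimately have f: "f \<in> R" "res f \<in> I" "i = sec (scalar f)" by (auto simp: scalar_section_res)
    obtain s where s: "s \<in> T" "j = sec s" using prod by (auto simp: carrier_SS)
    have "i \<otimes>\<^bsub>SS\<^esub> j = sec (\<lambda>z. scalar f z ** s z)" by (simp add: f s ops_SS)
    moreover have "(\<lambda>z. scalar f z ** s z) \<in> T" by (intro T_mult scalar_T f s)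
    ultimately show ?case using assms(3)[OF f(1,2) s(1)] ideal_prod.prod[OF prod] by blast
  next
    case (sum s1 s2)
    then obtain a b where ab: "a \<in> T" "s1 = sec a" "Q a" "b \<in> T" "s2 = sec b" "Q b" by blast
    have s12: "s1 \<oplus>\<^bsub>SS\<^esub> s2 = sec (\<lambda>z. a z + b z)" by (simp add: ab ops_SS)
    have "Q (\<lambda>z. a z + b z)"
      using sum ab by (intro assms(4)) (auto simp: extended_ideal_def)
    moreover have "(\<lambda>z. a z + b z) \<in> T" by (intro T_add ab)
    ultimately have "\<exists>c\<in>T. s1 \<oplus>\<^bsub>SS\<^esub> s2 = sec c \<and> Q c" using s12 by blast
    with sum show ?case by (blast intro: ideal_prod.sum)
  qed
  then show thesis using that by blast
qed

lemma extended_ideal_prod_mem: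
  assumes "res f \<in> I" "s \<in> T" shows "sec (\<lambda>z. scalar f z ** s z) \<in> extended_ideal D P I"
  using scalar_section_image_mult[of "sec (scalar f)" I "sec s"] assms scalar_section_res[of f]
  by (force simp: ops_SS carrier_SS)

lemma extended_ideal_sum_mem:
  assumes "sec a \<in> extended_ideal D P I" "sec b \<in> extended_ideal D P I"
  shows "sec (\<lambda>z. a z + b z) \<in> extended_ideal D P I"
  using ideal_prod.sum[of "sec a" SS _ _ "sec b"] assms by (simp add: extended_ideal_def ops_SS)

lemma extended_ideal_is_ideal:
  assumes I: "ideal I RR" shows "ideal (extended_ideal D P I) SS"
proof (rule ring.idealI_mult_closed[OF ring_SS])
  let ?E = "extended_ideal D P I"
  show "?E \<subseteq> carrier SS"
  proof
    fix x assume "x \<in> ?E"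
    with I obtain a where "a \<in> T" "x = sec a" "True" by (rule extended_ideal_induct) auto
    then show "x \<in> carrier SS" by (simp add: carrier_SS)
  qed
  have "res (\<lambda>u. 0) \<in> I"
    using additive_subgroup.zero_closed[OF ideal.axioms(1)[OF I]] by (simp add: ops_RR)
  then have "sec (\<lambda>z. scalar (\<lambda>u. 0) z ** mat 0) \<in> ?E" using T_const by (rule extended_ideal_prod_mem)
  then show "\<zero>\<^bsub>SS\<^esub> \<in> ?E" by (simp add: ops_SS mat_0)
  show "x \<oplus>\<^bsub>SS\<^esub> y \<in> ?E" if "x \<in> ?E" "y \<in> ?E" for x y
    using that unfolding extended_ideal_def by (rule ideal_prod.sum)
  fix x y assume x: "x \<in> carrier SS" and y: "y \<in> ?E"
  obtain b where b: "b \<in> T" "x = sec b" using x by (auto simp: carrier_SS)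
  define Q :: "(('n, 'd) mats \<Rightarrow> complex^'n^'n) \<Rightarrow> bool" where "Q a \<longleftrightarrow> sec (\<lambda>z. b z ** a z) \<in> ?E \<and> sec (\<lambda>z. a z ** b z) \<in> ?E" for a
  obtain a where a: "a \<in> T" "y = sec a" "Q a"
    using I y
  proof (rule extended_ideal_induct)
    fix f s assume fs: "f \<in> R" "res f \<in> I" "s \<in> T"
    have "b z ** (scalar f z ** s z) = scalar f z ** (b z ** s z)" for z
      unfolding scalar_def by (metis mat_mult_right matrix_mul_assoc)
    then show "Q (\<lambda>z. scalar f z ** s z)"
      using extended_ideal_prod_mem[OF fs(2) T_mult[OF b(1) fs(3)]]
        extended_ideal_prod_mem[OF fs(2) T_mult[OF fs(3) b(1)]]
      by (simp add: Q_def matrix_mul_assoc)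
  next
    fix c d assume "Q c" "Q d"
    then show "Q (\<lambda>z. c z + d z)"
      using extended_ideal_sum_mem unfolding Q_def
      by (simp add: matrix_add_ldistrib matrix_add_distrib_right)
  qed
  then show "x \<otimes>\<^bsub>SS\<^esub> y \<in> ?E" "y \<otimes>\<^bsub>SS\<^esub> x \<in> ?E" by (simp_all add: b(2) Q_def ops_SS)
qed

lemma contracted_ideal_iff:
  "f \<in> R \<Longrightarrow> res f \<in> contracted_ideal D P J \<longleftrightarrow> sec (scalar f) \<in> J"
  by (simp add: contracted_ideal_def carrier_RR scalar_section_res)

lemma contracted_ideal_elem:
  assumes "x \<in> contracted_ideal D P J" obtains f where "f \<in> R" "x = res f" "sec (scalar f) \<in> J"
  using assms by (auto simp: contracted_ideal_def carrier_RR scalar_section_res)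

lemma contracted_ideal_is_ideal:
  assumes J: "ideal J SS" shows "ideal (contracted_ideal D P J) RR"
proof (rule ring.idealI_mult_closed[OF ring_RR])
  let ?C = "contracted_ideal D P J"
  show "?C \<subseteq> carrier RR" by (auto simp: contracted_ideal_def)
  have "scalar (\<lambda>u. 0) = (\<lambda>z. 0)" by (simp add: scalar_def fun_eq_iff mat_0)
  then show "\<zero>\<^bsub>RR\<^esub> \<in> ?C" using ideal_SS_zero[OF J] by (simp add: ops_RR contracted_ideal_iff R_const)
  show "x \<oplus>\<^bsub>RR\<^esub> y \<in> ?C" if xy: "x \<in> ?C" "y \<in> ?C" for x y
  proof -
    obtain f where f: "f \<in> R" "x = res f" "sec (scalar f) \<in> J" using contracted_ideal_elem[OF xy(1)] .
    obtain g where g: "g \<in> R" "y = res g" "sec (scalar g) \<in> J" using contracted_ideal_elem[OF xy(2)] .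
    have "scalar (\<lambda>u. f u + g u) = (\<lambda>z. scalar f z + scalar g z)" by (simp add: scalar_def fun_eq_iff mat_add)
    then show ?thesis using ideal_SS_add[OF J f(3) g(3)] f g by (simp add: ops_RR contracted_ideal_iff R_add)
  qed
  show mult: "x \<otimes>\<^bsub>RR\<^esub> y \<in> ?C" if xy: "x \<in> carrier RR" "y \<in> ?C" for x y
  proof -
    obtain f where f: "f \<in> R" "x = res f" using xy by (auto simp: carrier_RR)
    obtain g where g: "g \<in> R" "y = res g" "sec (scalar g) \<in> J" using contracted_ideal_elem[OF xy(2)] .
    have "scalar (\<lambda>u. f u * g u) = (\<lambda>z. scalar f z ** scalar g z)" by (simp add: scalar_def fun_eq_iff mat_mult)
    then show ?thesis
      using ideal_SS_left[OF J scalar_T[OF f(1)] g(3)] f g by (simp add: ops_RR contracted_ideal_iff R_mult)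
  qed
  show "y \<otimes>\<^bsub>RR\<^esub> x \<in> ?C" if "x \<in> carrier RR" "y \<in> ?C" for x y
  proof -
    have "y \<otimes>\<^bsub>RR\<^esub> x = x \<otimes>\<^bsub>RR\<^esub> y"
      by (simp add: invariant_function_ring_def mult.commute)
    then show ?thesis using mult[OF that] by simp
  qed
qed

text \<open>
  The trace of an element of the extended ideal of \<open>I\<close> belongs to \<open>I\<close>, and the trace of a scalar
  section \<open>f\<close> is \<open>n * f\<close>, first on the boundary \<open>B\<close> and then on \<open>X\<close>.
\<close>

theorem contracted_extended:
  assumes I: "ideal I RR" shows "contracted_ideal D P (extended_ideal D P I) = I"
proof (intro equalityI subsetI)
  fix x assume "x \<in> I"
  then obtain f where f: "f \<in> R" "x = res f" using ideal_RR_elem[OF I] by blast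
  have "sec (\<lambda>z. scalar f z ** mat 1) \<in> extended_ideal D P I"
    using \<open>x \<in> I\<close> f(2) by (intro extended_ideal_prod_mem T_const) simp
  then show "x \<in> contracted_ideal D P (extended_ideal D P I)"
    by (simp add: f contracted_ideal_iff)
next
  fix x assume "x \<in> contracted_ideal D P (extended_ideal D P I)"
  then obtain f where f: "f \<in> R" "x = res f" and mem: "sec (scalar f) \<in> extended_ideal D P I"
    by (rule contracted_ideal_elem)
  define Q :: "(('n, 'd) mats \<Rightarrow> complex^'n^'n) \<Rightarrow> bool" where "Q a \<longleftrightarrow> (\<exists>g\<in>R. res g \<in> I \<and> (\<forall>z\<in>PB. g (quotient_proj z) = trace (a z)))" for a
  obtain a where a: "a \<in> T" "sec (scalar f) = sec a" "Q a"
    using I mem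
  proof (rule extended_ideal_induct)
    fix g s assume gs: "g \<in> R" "res g \<in> I" "s \<in> T"
    obtain h where h: "h \<in> R" "\<And>z. z \<in> PB \<Longrightarrow> h (quotient_proj z) = trace (s z)" using trace_T[OF gs(3)] by blast
    show "Q (\<lambda>z. scalar g z ** s z)"
      unfolding Q_def
    proof (intro bexI conjI ballI)
      show "(\<lambda>u. h u * g u) \<in> R" by (intro R_mult h gs)
      show "res (\<lambda>u. h u * g u) \<in> I" using I h(1) gs(2) by (rule ideal_RR_mult)
    qed (simp add: h(2) scalar_def trace_mat_mult)
  next
    fix a b assume "Q a" "Q b"
    then obtain g h where "g \<in> R" "res g \<in> I" "\<forall>z\<in>PB. g (quotient_proj z) = trace (a z)"
      "h \<in> R" "res h \<in> I" "\<forall>z\<in>PB. h (quotient_proj z) = trace (b z)" by (auto simp: Q_def)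
    then show "Q (\<lambda>z. a z + b z)"
      unfolding Q_def
      by (intro bexI[of _ "\<lambda>u. g u + h u"]) (auto simp: trace_add intro: R_add ideal_RR_add[OF I])
  qed
  obtain g where g: "g \<in> R" "res g \<in> I" "\<And>z. z \<in> PB \<Longrightarrow> g (quotient_proj z) = trace (a z)"
    using a(3) by (auto simp: Q_def)
  let ?n = "of_nat CARD('n) :: complex"
  have "?n * f u = g u" if u: "u \<in> X" for u
  proof -
    have R': "(\<lambda>u. ?n * f u + (-1) * g u) \<in> R" by (intro R_add R_mult R_const f g)
    have "cmod (?n * f u + (-1) * g u) \<le> 0"
    proof (rule bounded_by_boundary[OF R' _ u])
      fix v assume "v \<in> B"
      then obtain z where z: "z \<in> PB" "quotient_proj z = v" by (rule PB_over)
      have "scalar f z = a z" using sec_inject[OF scalar_T[OF f(1)] a(1,2) z(1)] .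
      then have "trace (scalar f z) = g v" using g(3)[OF z(1)] z(2) by simp
      then show "cmod (?n * f v + (-1) * g v) \<le> 0" using z(2) by (simp add: scalar_def trace_mat)
    qed
    then show ?thesis by simp
  qed
  then have "res f = res (\<lambda>u. (1 / ?n) * g u)" by (intro restrict_ext) (simp add: field_simps)
  also have "\<dots> \<in> I" using I R_const g(2) by (rule ideal_RR_mult)
  finally show "x \<in> I" using f(2) by simp
qed

text \<open>
  Locally, up to the factor \<open>p\<close>, an element \<open>a\<close> of \<open>J\<close> is the combination of the \<open>w k\<close> with
  coefficients the traces of \<open>a ** v k\<close>, and these traces belong to the contraction of \<open>J\<close>.
\<close>

theorem extended_contracted:
  assumes J: "ideal J SS" shows "extended_ideal D P (contracted_ideal D P J) = J"
proof (intro equalityI subsetI)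
  let ?C = "contracted_ideal D P J"
  have C: "ideal ?C RR" using J by (rule contracted_ideal_is_ideal)
  {
    fix x assume x: "x \<in> extended_ideal D P ?C"
    obtain a where "a \<in> T" "x = sec a" "sec a \<in> J"
      using C x
    proof (rule extended_ideal_induct)
      fix f s assume "f \<in> R" "res f \<in> ?C" "s \<in> T"
      then show "sec (\<lambda>z. scalar f z ** s z) \<in> J"
        using ideal_SS_right[OF J] by (simp add: contracted_ideal_iff)
    qed (rule ideal_SS_add[OF J])
    then show "x \<in> J" by simp
  next
    fix x assume "x \<in> J"
    then obtain a where a: "a \<in> T" "x = sec a" using ideal_SS_elem[OF J] by blast
    have E: "ideal (extended_ideal D P ?C) SS" using C by (rule extended_ideal_is_ideal)
    have "sec a \<in> extended_ideal D P ?C"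
    proof (rule ideal_membership_local[OF E a(1)])
      fix z0 assume "z0 \<in> P"
      obtain p :: "('n, 'd) mats \<Rightarrow> complex" and w v :: "'n \<times> 'n \<Rightarrow> ('n, 'd) mats \<Rightarrow> complex^'n^'n"
        where p: "p \<in> invariant_polynomials" "p z0 \<noteq> 0"
          and w: "\<And>k. w k \<in> trace_algebra" and v: "\<And>k. v k \<in> trace_algebra"
          and id: "\<And>z A. (\<Sum>k\<in>UNIV. mat (trace (A ** v k z)) ** w k z) = mat (p z) ** A"
        using casimir_element_exists[OF P_generating[OF \<open>z0 \<in> P\<close>]] by blast
      have av: "(\<lambda>z. a z ** v k z) \<in> T" "sec (\<lambda>z. a z ** v k z) \<in> J" for k
      proof -
        show "(\<lambda>z. a z ** v k z) \<in> T" by (intro T_mult T_trace_algebra v a(1))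
        have "sec a \<in> J" using a(2) \<open>x \<in> J\<close> by simp
        then show "sec (\<lambda>z. a z ** v k z) \<in> J" by (rule ideal_SS_right[OF J T_trace_algebra[OF v]])
      qed
      have "\<exists>h\<in>R. \<forall>z\<in>PB. h (quotient_proj z) = trace (a z ** v k z)" for k
        using trace_T[OF av(1)] by metis
      then obtain h where h: "\<And>k. h k \<in> R"
        "\<And>k z. z \<in> PB \<Longrightarrow> h k (quotient_proj z) = trace (a z ** v k z)" by metis
      have hC: "res (h k) \<in> ?C" for k
        using trace_mem_ideal[OF J av h(1)] h by (simp add: contracted_ideal_iff)
      have "sec (\<lambda>z. mat (p z) ** a z) = sec (\<lambda>z. \<Sum>k\<in>UNIV. scalar (h k) z ** w k z)"
        by (rule sec_cong) (simp add: id[symmetric] scalar_def h(2))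
      also have "\<dots> \<in> extended_ideal D P ?C"
        by (intro ideal_SS_sum[OF E] extended_ideal_prod_mem hC T_trace_algebra w)
      finally show "\<exists>p\<in>invariant_polynomials. p z0 \<noteq> 0 \<and> sec (\<lambda>z. mat (p z) ** a z) \<in> extended_ideal D P ?C"
        using p by blast
    qed
    then show "x \<in> extended_ideal D P ?C" using a(2) by simp
  }
qed

end

theorem corollary1p10:
  fixes D :: "('n::finite, 'd::finite) point set"
    and P :: "('n, 'd) mats set"
  assumes "CARD('d) \<ge> 2" and "CARD('n) \<ge> 2"
    and "D \<noteq> {}"
    and "openin (subtopology analytic_topology regular_locus) D"
    and "connectedin analytic_topology D"
    and "compactin analytic_topology (closure_in_spectrum D)"
    and "closure_in_spectrum D \<subseteq> regular_locus"
    and "reduction D P"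
    and "invariantly_convex (closure_in_spectrum D)"
  shows "bij_betw (extended_ideal D P)
           {I. ideal I (invariant_function_ring D)} {J. ideal J (tracial_function_ring D P)} \<and>
         bij_betw (contracted_ideal D P)
           {J. ideal J (tracial_function_ring D P)} {I. ideal I (invariant_function_ring D)} \<and>
         (\<forall>I. ideal I (invariant_function_ring D) \<longrightarrow>
           contracted_ideal D P (extended_ideal D P I) = I) \<and>
         (\<forall>J. ideal J (tracial_function_ring D P) \<longrightarrow>
           extended_ideal D P (contracted_ideal D P J) = J)"
proof -
  have "D \<subseteq> topspace analytic_topology" using assms(5) by (rule connectedin_subset_topspace)
  then have "closure_in_spectrum D \<noteq> {}" using \<open>D \<noteq> {}\<close> closure_of_subset by blast
  then interpret tracial_setting D P
    using assms by unfold_locales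
  have 1: "bij_betw (extended_ideal D P) {I. ideal I RR} {J. ideal J SS}"
    by (rule bij_betw_byWitness[where f' = "contracted_ideal D P"])
      (auto simp: contracted_extended extended_contracted extended_ideal_is_ideal contracted_ideal_is_ideal)
  have 2: "bij_betw (contracted_ideal D P) {J. ideal J SS} {I. ideal I RR}"
    by (rule bij_betw_byWitness[where f' = "extended_ideal D P"])
      (auto simp: contracted_extended extended_contracted extended_ideal_is_ideal contracted_ideal_is_ideal)
  show ?thesis using 1 2 contracted_extended extended_contracted by blast
qed

end
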